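(* Let $\Gamma$ be a countable discrete sofic group, let $n\ge 1$, and let $f\in M_n(\mathbb{Z}(\Gamma))\cap GL_n(L(\Gamma))$. If $f$ is not invertible in $M_n(\mathbb{Z}(\Gamma))$, then $\det_{L(\Gamma)}(f)>1$.
   Context: For $n\in\mathbb{N}$, $u_n$ is the uniform probability measure on $\{1,\dots,n\}$ and $S_n$ is the symmetric group. A sofic approximation of a countable discrete group $\Gamma$ is a sequence of functions (not assumed to be homomorphisms) $\sigma_i\colon\Gamma\to S_{d_i}$ such that $u_{d_i}(\{j:\sigma_i(gh)(j)=\sigma_i(g)\sigma_i(h)(j)\})\to 1$ for all $g,h\in\Gamma$ and $u_{d_i}(\{j:\sigma_i(g)(j)\ne j\})\to 1$ for all $g\in\Gamma\setminus\{e\}$. $\Gamma$ is sofic if it has a sofic approximation. $\mathbb{Z}(\Gamma)\subseteq\mathbb{C}(\Gamma)$ are the integral and complex group rings. $\lambda$ is the left regular representation on $\ell^2(\Gamma)$, $(\lambda(g)\xi)(h)=\xi(g^{-1}h)$, extended linearly to $\mathbb{C}(\Gamma)$. The group von Neumann algebra $L(\Gamma)$ is the weak operator topology closure of $\lambda(\mathbb{C}(\Gamma))$ in $B(\ell^2(\Gamma))$, and $\mathbb{C}(\Gamma)$ is identified with its image $\lambda(\mathbb{C}(\Gamma))\subseteq L(\Gamma)$. $GL_n(L(\Gamma))$ is the group of invertible elements of $M_n(L(\Gamma))\subseteq B(\ell^2(\Gamma)^{\oplus n})$. Let $\tau(x)=\langle x\delta_e,\delta_e\rangle$ for $x\in L(\Gamma)$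 and $\mathrm{Tr}\otimes\tau(A)=\sum_{j=1}^n\tau(A_{jj})$ for $A\in M_n(L(\Gamma))$. For $f\in GL_n(L(\Gamma))$ the Fuglede–Kadison determinant is $\det_{L(\Gamma)}(f)=\exp\big(\mathrm{Tr}\otimes\tau(\log|f|)\big)$, where $|f|=(f^*f)^{1/2}$. *)

theory Defs
  imports
    "HOL-Analysis.Analysis"
    "HOL-Library.Poly_Mapping"
    "HOL-Computational_Algebra.Polynomial"
begin

text \<open>
  The group \<open>\<Gamma>\<close> is a type of class \<^class>\<open>group_add\<close>, the library class of not necessarily
  commutative groups, which is written additively: \<open>g + h\<close>, \<open>- g\<close> and \<open>0\<close> stand for
  \<open>gh\<close>, \<open>g\<^sup>-\<^sup>1\<close> and \<open>e\<close>. With this convention the group rings \<open>\<int>(\<Gamma>)\<close> and \<open>\<complex>(\<Gamma>)\<close> are the types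
  \<open>'g \<Rightarrow>\<^sub>0 int\<close> and \<open>'g \<Rightarrow>\<^sub>0 complex\<close>, whose library product is the convolution product.
\<close>

section \<open>Sofic groups\<close>

definition sofic_approximation ::
    "(nat \<Rightarrow> nat) \<Rightarrow> (nat \<Rightarrow> 'g::group_add \<Rightarrow> nat \<Rightarrow> nat) \<Rightarrow> bool" where
  "sofic_approximation d \<sigma> \<longleftrightarrow>
     (\<forall>i. d i \<ge> 1) \<and>
     (\<forall>i g. \<sigma> i g permutes {1..d i}) \<and>
     (\<forall>g h. (\<lambda>i. measure (uniform_count_measure {1..d i})
               {j \<in> {1..d i}. \<sigma> i (g + h) j = \<sigma> i g (\<sigma> i h j)}) \<longlonglongrightarrow> 1) \<and>
     (\<forall>g. g \<noteq> 0 \<longrightarrow> (\<lambda>i. measure (uniform_count_measure {1..d i})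
               {j \<in> {1..d i}. \<sigma> i g j \<noteq> j}) \<longlonglongrightarrow> 1)"

definition sofic :: "'g::group_add itself \<Rightarrow> bool" where
  "sofic _ \<longleftrightarrow> (\<exists>d (\<sigma> :: nat \<Rightarrow> 'g \<Rightarrow> nat \<Rightarrow> nat). sofic_approximation d \<sigma>)"


section \<open>Complex Hilbert spaces\<close>

text \<open>
  The complex inner product is linear in the first argument; its real part is the inner product
  of the underlying real Hilbert space, so that norm and topology are those of the library.
\<close>

class complex_hilbert_space = real_inner + banach +
  fixes scaleC :: "complex \<Rightarrow> 'a \<Rightarrow> 'a" (infixr "*\<^sub>C" 75)
    and cinner :: "'a \<Rightarrow> 'a \<Rightarrow> complex"
  assumes scaleC_add_right: "c *\<^sub>C (x + y) = c *\<^sub>C x + c *\<^sub>C y"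
    and scaleC_add_left: "(b + c) *\<^sub>C x = b *\<^sub>C x + c *\<^sub>C x"
    and scaleC_scaleC: "b *\<^sub>C (c *\<^sub>C x) = (b * c) *\<^sub>C x"
    and scaleC_of_real: "complex_of_real r *\<^sub>C x = r *\<^sub>R x"
    and cinner_add_left: "cinner (x + y) z = cinner x z + cinner y z"
    and cinner_scaleC_left: "cinner (c *\<^sub>C x) y = c * cinner x y"
    and cinner_commute: "cinner x y = cnj (cinner y x)"
    and Re_cinner: "Re (cinner x y) = inner x y"

lemma norm_scaleC: "norm (c *\<^sub>C x) = cmod c * norm (x :: 'a::complex_hilbert_space)"
proof -
  have im: "Im (cinner x x) = 0"
    using arg_cong[OF cinner_commute[of x x], of Im] by simp
  have "inner (c *\<^sub>C x) (c *\<^sub>C x) = Re (c * (cnj c * cnj (cinner x x)))"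
    by (metis Re_cinner cinner_commute cinner_scaleC_left complex_cnj_mult)
  also have "\<dots> = (cmod c)\<^sup>2 * inner x x"
    unfolding cmod_power2 using im
    by (simp add: Re_cinner[symmetric] power2_eq_square algebra_simps)
  finally show ?thesis
    by (simp add: norm_eq_sqrt_inner real_sqrt_mult)
qed

lemma bounded_linear_scaleC:
  "bounded_linear (\<lambda>x. c *\<^sub>C (x :: 'a::complex_hilbert_space))"
proof (rule bounded_linear_intro[where K = "cmod c"])
  show "c *\<^sub>C (x + y) = c *\<^sub>C x + c *\<^sub>C y" for x y :: 'a
    by (rule scaleC_add_right)
  show "c *\<^sub>C (r *\<^sub>R x) = r *\<^sub>R c *\<^sub>C x" for r and x :: 'a
    by (metis mult.commute scaleC_of_real scaleC_scaleC)
  show "norm (c *\<^sub>C x) \<le> norm x * cmod c" for x :: 'a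
    by (simp add: norm_scaleC)
qed

instantiation vec :: (complex_hilbert_space, finite) complex_hilbert_space
begin

definition scaleC_vec :: "complex \<Rightarrow> ('a, 'b) vec \<Rightarrow> ('a, 'b) vec" where
  "scaleC_vec c x = (\<chi> j. c *\<^sub>C (x $ j))"

definition cinner_vec :: "('a, 'b) vec \<Rightarrow> ('a, 'b) vec \<Rightarrow> complex" where
  "cinner_vec x y = (\<Sum>j\<in>UNIV. cinner (x $ j) (y $ j))"

instance
proof
  fix b c :: complex and r :: real and x y z :: "('a, 'b) vec"
  show "c *\<^sub>C (x + y) = c *\<^sub>C x + c *\<^sub>C y"
    by (simp add: scaleC_vec_def vec_eq_iff scaleC_add_right)
  show "(b + c) *\<^sub>C x = b *\<^sub>C x + c *\<^sub>C x"
    by (simp add: scaleC_vec_def vec_eq_iff scaleC_add_left)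
  show "b *\<^sub>C (c *\<^sub>C x) = (b * c) *\<^sub>C x"
    by (simp add: scaleC_vec_def vec_eq_iff scaleC_scaleC)
  show "complex_of_real r *\<^sub>C x = r *\<^sub>R x"
    by (simp add: scaleC_vec_def vec_eq_iff scaleC_of_real)
  show "cinner (x + y) z = cinner x z + cinner y z"
    by (simp add: cinner_vec_def cinner_add_left sum.distrib)
  show "cinner (c *\<^sub>C x) y = c * cinner x y"
    by (simp add: cinner_vec_def scaleC_vec_def cinner_scaleC_left sum_distrib_left)
  show "cinner x y = cnj (cinner y x)"
    unfolding cinner_vec_def cnj_sum by (rule sum.cong[OF refl]) (rule cinner_commute)
  show "Re (cinner x y) = inner x y"
    by (simp add: cinner_vec_def inner_vec_def Re_cinner)
qed

end


section \<open>The Hilbert space of square-summable functions\<close>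

typedef 'i ell2 = "{x :: 'i \<Rightarrow> complex. (\<lambda>i. (cmod (x i))\<^sup>2) summable_on UNIV}"
  by (rule exI[of _ "\<lambda>_. 0"]) simp

setup_lifting type_definition_ell2

lemma ell2_add:
  assumes "(\<lambda>i. (cmod (x i))\<^sup>2) summable_on UNIV" "(\<lambda>i. (cmod (y i))\<^sup>2) summable_on UNIV"
  shows "(\<lambda>i. (cmod (x i + y i))\<^sup>2) summable_on UNIV"
proof (rule summable_on_comparison_test)
  show "(\<lambda>i. 2 * ((cmod (x i))\<^sup>2 + (cmod (y i))\<^sup>2)) summable_on UNIV"
    by (intro summable_on_cmult_right summable_on_add assms)
  fix i
  have "(cmod (x i + y i))\<^sup>2 \<le> (cmod (x i) + cmod (y i))\<^sup>2"
    by (intro power_mono norm_triangle_ineq) auto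
  also have "\<dots> \<le> 2 * ((cmod (x i))\<^sup>2 + (cmod (y i))\<^sup>2)"
    using sum_squares_bound[of "cmod (x i)" "cmod (y i)"] by (simp add: power2_sum)
  finally show "(cmod (x i + y i))\<^sup>2 \<le> 2 * ((cmod (x i))\<^sup>2 + (cmod (y i))\<^sup>2)" .
qed simp

lemma ell2_scale:
  assumes "(\<lambda>i. (cmod (x i))\<^sup>2) summable_on UNIV"
  shows "(\<lambda>i. (cmod (c * x i))\<^sup>2) summable_on UNIV"
  unfolding norm_mult power_mult_distrib by (rule summable_on_cmult_right[OF assms])

lemma ell2_prod:
  assumes "(\<lambda>i. (cmod (x i))\<^sup>2) summable_on UNIV" "(\<lambda>i. (cmod (y i))\<^sup>2) summable_on UNIV"
  shows "(\<lambda>i. x i * cnj (y i)) summable_on UNIV"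
proof (rule Infinite_Sum.abs_summable_summable, rule Infinite_Sum.abs_summable_on_comparison_test')
  show "(\<lambda>i. (cmod (x i))\<^sup>2 + (cmod (y i))\<^sup>2) summable_on UNIV"
    by (intro summable_on_add assms)
  fix i
  show "norm (x i * cnj (y i)) \<le> (cmod (x i))\<^sup>2 + (cmod (y i))\<^sup>2"
    unfolding norm_mult complex_mod_cnj
    using sum_squares_bound[of "cmod (x i)" "cmod (y i)"]
      mult_nonneg_nonneg[OF norm_ge_zero norm_ge_zero, of "x i" "y i"] by linarith
qed

lemma summable_Re_ell2:
  assumes "(\<lambda>i. (cmod (x i))\<^sup>2) summable_on UNIV" "(\<lambda>i. (cmod (y i))\<^sup>2) summable_on UNIV"
  shows "(\<lambda>i. Re (x i * cnj (y i))) summable_on UNIV"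
  by (rule summable_on_Re[OF ell2_prod[OF assms]])

lemma Re_mult_cnj_self: "Re (z * cnj z) = (cmod z)\<^sup>2"
  unfolding cmod_power2 by (simp add: power2_eq_square)

instantiation ell2 :: (type) real_inner
begin

lift_definition zero_ell2 :: "'a ell2" is "\<lambda>_. 0" by simp

lift_definition plus_ell2 :: "'a ell2 \<Rightarrow> 'a ell2 \<Rightarrow> 'a ell2" is "\<lambda>x y i. x i + y i"
  by (rule ell2_add)

lift_definition uminus_ell2 :: "'a ell2 \<Rightarrow> 'a ell2" is "\<lambda>x i. - x i" by simp

lift_definition minus_ell2 :: "'a ell2 \<Rightarrow> 'a ell2 \<Rightarrow> 'a ell2" is "\<lambda>x y i. x i - y i"
  using ell2_add[where y = "\<lambda>i. - y i" for y] by simp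

lift_definition scaleR_ell2 :: "real \<Rightarrow> 'a ell2 \<Rightarrow> 'a ell2" is "\<lambda>r x i. complex_of_real r * x i"
  by (rule ell2_scale)

lift_definition inner_ell2 :: "'a ell2 \<Rightarrow> 'a ell2 \<Rightarrow> real" is
  "\<lambda>x y. \<Sum>\<^sub>\<infinity>i. Re (x i * cnj (y i))" .

definition norm_ell2 :: "'a ell2 \<Rightarrow> real" where
  "norm_ell2 x = sqrt (inner x x)"

definition dist_ell2 :: "'a ell2 \<Rightarrow> 'a ell2 \<Rightarrow> real" where
  "dist_ell2 x y = norm (x - y)"

definition sgn_ell2 :: "'a ell2 \<Rightarrow> 'a ell2" where
  "sgn_ell2 x = inverse (norm x) *\<^sub>R x"

definition uniformity_ell2 :: "('a ell2 \<times> 'a ell2) filter" where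
  "uniformity_ell2 = (INF e\<in>{0<..}. principal {(x, y). dist x y < e})"

definition open_ell2 :: "'a ell2 set \<Rightarrow> bool" where
  "open_ell2 U \<longleftrightarrow> (\<forall>x\<in>U. \<forall>\<^sub>F (x', y) in uniformity. x' = x \<longrightarrow> y \<in> U)"

instance
proof
  fix a b c x y z :: "'a ell2" and r s :: real and U :: "'a ell2 set"
  show "a + b + c = a + (b + c)" by transfer (simp add: add.assoc)
  show "a + b = b + a" by transfer (simp add: add.commute)
  show "0 + a = a" by transfer simp
  show "- a + a = 0" by transfer simp
  show "a - b = a + - b" by transfer simp
  show "r *\<^sub>R (x + y) = r *\<^sub>R x + r *\<^sub>R y" by transfer (simp add: algebra_simps)
  show "(r + s) *\<^sub>R x = r *\<^sub>R x + s *\<^sub>R x" by transfer (simp add: algebra_simps)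
  show "r *\<^sub>R s *\<^sub>R x = (r * s) *\<^sub>R x" by transfer (simp add: algebra_simps)
  show "1 *\<^sub>R x = x" by transfer simp
  show "dist x y = norm (x - y)" by (rule dist_ell2_def)
  show "sgn x = inverse (norm x) *\<^sub>R x" by (simp add: sgn_ell2_def)
  show "uniformity = (INF e\<in>{0<..}. principal {(x, y :: 'a ell2). dist x y < e})"
    by (rule uniformity_ell2_def)
  show "open U \<longleftrightarrow> (\<forall>x\<in>U. \<forall>\<^sub>F (x', y) in uniformity. x' = x \<longrightarrow> y \<in> U)"
    by (rule open_ell2_def)
  show "inner x y = inner y x"
    by transfer (simp add: algebra_simps)
  show "inner (x + y) z = inner x z + inner y z"
  proof transfer
    fix x y z :: "'a \<Rightarrow> complex"
    assume "(\<lambda>i. (cmod (x i))\<^sup>2) summable_on UNIV" "(\<lambda>i. (cmod (y i))\<^sup>2) summable_on UNIV"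
      "(\<lambda>i. (cmod (z i))\<^sup>2) summable_on UNIV"
    then show "(\<Sum>\<^sub>\<infinity>i. Re ((x i + y i) * cnj (z i))) =
        (\<Sum>\<^sub>\<infinity>i. Re (x i * cnj (z i))) + (\<Sum>\<^sub>\<infinity>i. Re (y i * cnj (z i)))"
      unfolding distrib_right plus_complex.sel by (intro infsum_add summable_Re_ell2)
  qed
  show "inner (r *\<^sub>R x) y = r * inner x y"
    by transfer (simp add: infsum_cmult_right'[symmetric] algebra_simps)
  show "0 \<le> inner x x"
    by transfer (intro infsum_nonneg, unfold Re_mult_cnj_self, simp)
  show "inner x x = 0 \<longleftrightarrow> x = 0"
  proof transfer
    fix x :: "'a \<Rightarrow> complex"
    assume s: "(\<lambda>i. (cmod (x i))\<^sup>2) summable_on UNIV"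
    show "(\<Sum>\<^sub>\<infinity>i. Re (x i * cnj (x i))) = 0 \<longleftrightarrow> x = (\<lambda>_. 0)"
      unfolding Re_mult_cnj_self
    proof
      assume sum0: "(\<Sum>\<^sub>\<infinity>i. (cmod (x i))\<^sup>2) = 0"
      have "(cmod (x i))\<^sup>2 = 0" for i
        by (rule nonneg_infsum_le_0D[OF eq_refl[OF sum0] s]) auto
      then show "x = (\<lambda>_. 0)" by (simp add: fun_eq_iff)
    qed simp
  qed
  show "norm x = sqrt (inner x x)" by (rule norm_ell2_def)
qed

end

lemma norm_ell2_power2: "(norm x)\<^sup>2 = (\<Sum>\<^sub>\<infinity>i. (cmod (Rep_ell2 x i))\<^sup>2)"
  unfolding power2_norm_eq_inner inner_ell2.rep_eq Re_mult_cnj_self ..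

lemma ell2_partial_sum_le:
  assumes "finite F"
  shows "(\<Sum>i\<in>F. (cmod (Rep_ell2 x i))\<^sup>2) \<le> (norm x)\<^sup>2"
  unfolding norm_ell2_power2
  using Rep_ell2[of x] by (intro finite_sum_le_infsum assms) auto

lemma ell2_coord_le: "cmod (Rep_ell2 x i) \<le> norm x"
  using ell2_partial_sum_le[of "{i}" x] by (simp add: power2_le_iff_abs_le)

instance ell2 :: (type) banach
proof
  fix X :: "nat \<Rightarrow> 'a ell2"
  assume X: "Cauchy X"
  have "Cauchy (\<lambda>n. Rep_ell2 (X n) i)" for i
  proof (rule metric_CauchyI)
    fix e :: real assume "e > 0"
    then obtain M where M: "\<And>m n. m \<ge> M \<Longrightarrow> n \<ge> M \<Longrightarrow> dist (X m) (X n) < e"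
      using X unfolding Cauchy_def by blast
    have "dist (Rep_ell2 (X m) i) (Rep_ell2 (X n) i) \<le> dist (X m) (X n)" for m n
      using ell2_coord_le[of "X m - X n" i] by (simp add: dist_norm minus_ell2.rep_eq)
    then show "\<exists>M. \<forall>m\<ge>M. \<forall>n\<ge>M. dist (Rep_ell2 (X m) i) (Rep_ell2 (X n) i) < e"
      using M by (meson le_less_trans)
  qed
  then have "\<exists>l. \<forall>i. (\<lambda>n. Rep_ell2 (X n) i) \<longlonglongrightarrow> l i"
    by (intro choice) (auto simp: Cauchy_convergent_iff convergent_def)
  then obtain l where l: "\<And>i. (\<lambda>n. Rep_ell2 (X n) i) \<longlonglongrightarrow> l i" by blast
  have part: "(\<Sum>i\<in>F. (cmod (Rep_ell2 (X m) i - l i))\<^sup>2) \<le> e\<^sup>2"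
    if F: "finite F" and M: "\<And>n. n \<ge> M \<Longrightarrow> dist (X m) (X n) \<le> e" for F M m e
  proof (rule LIMSEQ_le_const2)
    show "(\<lambda>n. \<Sum>i\<in>F. (cmod (Rep_ell2 (X m) i - Rep_ell2 (X n) i))\<^sup>2) \<longlonglongrightarrow>
        (\<Sum>i\<in>F. (cmod (Rep_ell2 (X m) i - l i))\<^sup>2)"
      by (intro tendsto_intros l)
    have "(\<Sum>i\<in>F. (cmod (Rep_ell2 (X m) i - Rep_ell2 (X n) i))\<^sup>2) \<le> e\<^sup>2" if "n \<ge> M" for n
    proof -
      have "(\<Sum>i\<in>F. (cmod (Rep_ell2 (X m) i - Rep_ell2 (X n) i))\<^sup>2) \<le> (norm (X m - X n))\<^sup>2"
        using ell2_partial_sum_le[OF F, of "X m - X n"] by (simp add: minus_ell2.rep_eq)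
      also have "\<dots> \<le> e\<^sup>2"
        using M[OF that] by (intro power_mono) (auto simp: dist_norm)
      finally show ?thesis .
    qed
    then show "\<exists>N. \<forall>n\<ge>N. (\<Sum>i\<in>F. (cmod (Rep_ell2 (X m) i - Rep_ell2 (X n) i))\<^sup>2) \<le> e\<^sup>2"
      by blast
  qed
  have summ: "(\<lambda>i. (cmod (Rep_ell2 (X m) i - l i))\<^sup>2) summable_on UNIV"
    if M: "\<And>n. n \<ge> M \<Longrightarrow> dist (X m) (X n) \<le> e" for M m e
    using part[OF _ M] by (intro nonneg_bdd_above_summable_on) (auto simp: bdd_above_def)
  obtain M1 where M1: "\<And>m n. m \<ge> M1 \<Longrightarrow> n \<ge> M1 \<Longrightarrow> dist (X m) (X n) < 1"
    using X unfolding Cauchy_def by (metis zero_less_one)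
  have "(\<lambda>i. (cmod (- (Rep_ell2 (X M1) i - l i)))\<^sup>2) summable_on UNIV"
    unfolding norm_minus_cancel
    by (rule summ[of M1 M1 1]) (use M1 in \<open>auto simp: less_imp_le\<close>)
  then have "(\<lambda>i. (cmod (Rep_ell2 (X M1) i + - (Rep_ell2 (X M1) i - l i)))\<^sup>2) summable_on UNIV"
    using Rep_ell2[of "X M1"] by (intro ell2_add) auto
  then have lsum: "(\<lambda>i. (cmod (l i))\<^sup>2) summable_on UNIV" by simp
  define L where "L = Abs_ell2 l"
  have RL: "Rep_ell2 L = l"
    unfolding L_def using lsum by (simp add: Abs_ell2_inverse)
  have "X \<longlonglongrightarrow> L"
  proof (rule metric_LIMSEQ_I)
    fix r :: real assume r: "r > 0"
    then obtain M where M: "\<And>m n. m \<ge> M \<Longrightarrow> n \<ge> M \<Longrightarrow> dist (X m) (X n) < r / 2"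
      using X unfolding Cauchy_def by (meson half_gt_zero)
    have "dist (X m) L < r" if "m \<ge> M" for m
    proof -
      have M': "dist (X m) (X n) \<le> r / 2" if "n \<ge> M" for n
        using M[OF \<open>m \<ge> M\<close> that] by simp
      have "(norm (X m - L))\<^sup>2 \<le> (r / 2)\<^sup>2"
        unfolding norm_ell2_power2 minus_ell2.rep_eq RL
        by (rule infsum_le_finite_sums[OF summ[OF M']]) (auto intro: part[OF _ M'])
      then have "norm (X m - L) \<le> r / 2"
        by (rule power2_le_imp_le) (use r in auto)
      then show ?thesis using r by (simp add: dist_norm)
    qed
    then show "\<exists>M. \<forall>m\<ge>M. dist (X m) L < r" by blast
  qed
  then show "convergent X" by (auto simp: convergent_def)
qed

instantiation ell2 :: (type) complex_hilbert_space
begin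

lift_definition scaleC_ell2 :: "complex \<Rightarrow> 'a ell2 \<Rightarrow> 'a ell2" is "\<lambda>c x i. c * x i"
  by (rule ell2_scale)

lift_definition cinner_ell2 :: "'a ell2 \<Rightarrow> 'a ell2 \<Rightarrow> complex" is
  "\<lambda>x y. \<Sum>\<^sub>\<infinity>i. x i * cnj (y i)" .

instance
proof
  fix b c :: complex and r :: real and x y z :: "'a ell2"
  show "c *\<^sub>C (x + y) = c *\<^sub>C x + c *\<^sub>C y" by transfer (simp add: algebra_simps)
  show "(b + c) *\<^sub>C x = b *\<^sub>C x + c *\<^sub>C x" by transfer (simp add: algebra_simps)
  show "b *\<^sub>C (c *\<^sub>C x) = (b * c) *\<^sub>C x" by transfer (simp add: algebra_simps)
  show "complex_of_real r *\<^sub>C x = r *\<^sub>R x" by transfer simp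
  show "cinner (x + y) z = cinner x z + cinner y z"
    by transfer (simp add: distrib_right infsum_add ell2_prod)
  show "cinner (c *\<^sub>C x) y = c * cinner x y"
    by transfer (simp add: infsum_cmult_right'[symmetric] mult.assoc)
  show "cinner x y = cnj (cinner y x)"
    by transfer (simp add: infsum_cnj[symmetric] mult.commute)
  show "Re (cinner x y) = inner x y"
    by transfer (rule infsum_Re[symmetric], rule ell2_prod)
qed

end

lift_definition delta :: "'i \<Rightarrow> 'i ell2" is "\<lambda>i j. if j = i then 1 else 0"
proof -
  fix i :: 'i
  show "(\<lambda>j. (cmod (if j = i then 1 else 0))\<^sup>2) summable_on UNIV"
    by (rule finite_nonzero_values_imp_summable_on) (rule finite_subset[of _ "{i}"], auto)
qed


section \<open>Bounded operators\<close>

text \<open>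
  The library type \<open>'h \<Rightarrow>\<^sub>L 'h\<close> consists of the bounded real-linear maps; \<open>B(H)\<close> is the set of
  those that are complex-linear.
\<close>

definition bounded_operators :: "('h::complex_hilbert_space \<Rightarrow>\<^sub>L 'h) set" where
  "bounded_operators = {T :: 'h \<Rightarrow>\<^sub>L 'h. \<forall>c x. T (c *\<^sub>C x) = c *\<^sub>C T x}"

lift_definition scalar_op :: "complex \<Rightarrow> 'h::complex_hilbert_space \<Rightarrow>\<^sub>L 'h" is "\<lambda>c x. c *\<^sub>C x"
  by (rule bounded_linear_scaleC)

definition hilbert_adjoint ::
    "('h::complex_hilbert_space \<Rightarrow>\<^sub>L 'h) \<Rightarrow> 'h \<Rightarrow>\<^sub>L 'h" where
  "hilbert_adjoint T =
     (THE S. S \<in> bounded_operators \<and> (\<forall>x y. cinner (T x) y = cinner x (S y)))"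

definition spectrum :: "('h::complex_hilbert_space \<Rightarrow>\<^sub>L 'h) \<Rightarrow> complex set" where
  "spectrum T = {z. \<not> (\<exists>S\<in>bounded_operators.
     S o\<^sub>L (T - scalar_op z) = id_blinfun \<and> (T - scalar_op z) o\<^sub>L S = id_blinfun)}"

definition weak_operator_topology :: "('h::complex_hilbert_space \<Rightarrow>\<^sub>L 'h) topology" where
  "weak_operator_topology =
     pullback_topology bounded_operators (\<lambda>T (x, y). cinner (T x) y) euclidean"

definition poly_op :: "real poly \<Rightarrow> ('h::complex_hilbert_space \<Rightarrow>\<^sub>L 'h) \<Rightarrow> 'h \<Rightarrow>\<^sub>L 'h" where
  "poly_op p T = (\<Sum>k\<le>degree p. coeff p k *\<^sub>R (((o\<^sub>L) T ^^ k) id_blinfun))"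

text \<open>
  Continuous functional calculus \<open>\<phi>(T)\<close> of a self-adjoint operator \<open>T\<close> and a real function \<open>\<phi>\<close>
  continuous on its (real) spectrum: the common norm limit of \<open>p\<^sub>k(T)\<close> over all sequences of
  polynomials \<open>p\<^sub>k\<close> that converge to \<open>\<phi>\<close> uniformly on the spectrum.
\<close>

definition func_calc ::
    "(real \<Rightarrow> real) \<Rightarrow> ('h::complex_hilbert_space \<Rightarrow>\<^sub>L 'h) \<Rightarrow> 'h \<Rightarrow>\<^sub>L 'h" where
  "func_calc \<phi> T = (THE S. \<forall>p :: nat \<Rightarrow> real poly.
     uniform_limit {t. complex_of_real t \<in> spectrum T} (\<lambda>k. poly (p k)) \<phi> sequentially \<longrightarrow>
     (\<lambda>k. poly_op (p k) T) \<longlonglongrightarrow> S)"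

definition abs_op :: "('h::complex_hilbert_space \<Rightarrow>\<^sub>L 'h) \<Rightarrow> 'h \<Rightarrow>\<^sub>L 'h" where
  "abs_op T = func_calc sqrt (hilbert_adjoint T o\<^sub>L T)"


section \<open>Matrices of operators\<close>

lemma bounded_linear_op_of_matrix:
  fixes A :: "('h::real_normed_vector \<Rightarrow>\<^sub>L 'h)^'n^'n"
  shows "bounded_linear (\<lambda>x. \<chi> j. \<Sum>k\<in>UNIV. (A $ j $ k) (x $ k))"
proof (rule bounded_linear_intro[where K = "\<Sum>j\<in>UNIV. \<Sum>k\<in>UNIV. norm (A $ j $ k)"])
  fix x y :: "'h^'n" and r :: real
  show "(\<chi> j. \<Sum>k\<in>UNIV. (A $ j $ k) ((x + y) $ k)) =
      (\<chi> j. \<Sum>k\<in>UNIV. (A $ j $ k) (x $ k)) + (\<chi> j. \<Sum>k\<in>UNIV. (A $ j $ k) (y $ k))"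
    by (simp add: vec_eq_iff blinfun.add_right sum.distrib)
  show "(\<chi> j. \<Sum>k\<in>UNIV. (A $ j $ k) ((r *\<^sub>R x) $ k)) =
      r *\<^sub>R (\<chi> j. \<Sum>k\<in>UNIV. (A $ j $ k) (x $ k))"
    by (simp add: vec_eq_iff blinfun.scaleR_right scaleR_sum_right)
  have "norm (\<chi> j. \<Sum>k\<in>UNIV. (A $ j $ k) (x $ k)) \<le>
      (\<Sum>j\<in>UNIV. norm (\<Sum>k\<in>UNIV. (A $ j $ k) (x $ k)))"
    unfolding norm_vec_def by (rule order_trans[OF L2_set_le_sum]) auto
  also have "\<dots> \<le> (\<Sum>j\<in>UNIV. \<Sum>k\<in>UNIV. norm (A $ j $ k) * norm x)"
  proof (rule sum_mono, rule sum_norm_le)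
    fix j k
    show "norm ((A $ j $ k) (x $ k)) \<le> norm (A $ j $ k) * norm x"
      by (rule order_trans[OF norm_blinfun mult_left_mono[OF Finite_Cartesian_Product.norm_nth_le]])
        simp
  qed
  finally show "norm (\<chi> j. \<Sum>k\<in>UNIV. (A $ j $ k) (x $ k)) \<le>
      norm x * (\<Sum>j\<in>UNIV. \<Sum>k\<in>UNIV. norm (A $ j $ k))"
    by (simp add: sum_distrib_left mult.commute)
qed

definition op_of_matrix ::
    "('h::real_normed_vector \<Rightarrow>\<^sub>L 'h)^'n^'n \<Rightarrow> ('h^'n) \<Rightarrow>\<^sub>L ('h^'n)" where
  "op_of_matrix A = Blinfun (\<lambda>x. \<chi> j. \<Sum>k\<in>UNIV. (A $ j $ k) (x $ k))"

lemma op_of_matrix_apply: "op_of_matrix A x = (\<chi> j. \<Sum>k\<in>UNIV. (A $ j $ k) (x $ k))"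
  unfolding op_of_matrix_def by (simp add: bounded_linear_Blinfun_apply bounded_linear_op_of_matrix)

lemma bounded_linear_axis: "bounded_linear (\<lambda>x :: 'h::real_normed_vector. axis k x :: 'h^'n)"
proof (rule bounded_linear_intro[where K = 1])
  fix x :: 'h
  have "norm (axis k x :: 'h^'n) \<le> (\<Sum>j\<in>UNIV. norm ((axis k x :: 'h^'n) $ j))"
    unfolding norm_vec_def by (rule L2_set_le_sum) simp
  also have "\<dots> = (\<Sum>j\<in>UNIV. if j = k then norm x else 0)"
    by (rule sum.cong) (auto simp: axis_def)
  finally show "norm (axis k x :: 'h^'n) \<le> norm x * 1"
    by simp
qed (auto simp: axis_def vec_eq_iff)

definition matrix_entry ::
    "(('h::real_normed_vector^'n) \<Rightarrow>\<^sub>L ('h^'n)) \<Rightarrow> 'n \<Rightarrow> 'n \<Rightarrow> 'h \<Rightarrow>\<^sub>L 'h" where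
  "matrix_entry T j k = Blinfun (\<lambda>x. T (axis k x) $ j)"

lemma matrix_entry_apply: "matrix_entry T j k x = T (axis k x) $ j"
proof -
  have "bounded_linear (\<lambda>x. T (axis k x) $ j)"
    by (rule bounded_linear_compose[OF bounded_linear_vec_nth
          bounded_linear_compose[OF blinfun.bounded_linear_right bounded_linear_axis]])
  then show ?thesis
    unfolding matrix_entry_def by (simp add: bounded_linear_Blinfun_apply)
qed

lemma matrix_entry_op_of_matrix: "matrix_entry (op_of_matrix A) j k = A $ j $ k"
proof (rule blinfun_eqI)
  fix x
  have "(\<Sum>i\<in>UNIV. (A $ j $ i) (axis k x $ i)) = (\<Sum>i\<in>UNIV. if i = k then (A $ j $ i) x else 0)"
    by (intro sum.cong) (auto simp: axis_def)
  then show "matrix_entry (op_of_matrix A) j k x = (A $ j $ k) x"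
    by (simp add: matrix_entry_apply op_of_matrix_apply)
qed


section \<open>The group von Neumann algebra\<close>

lift_definition translate :: "'g::group_add \<Rightarrow> 'g ell2 \<Rightarrow> 'g ell2" is "\<lambda>g x h. x (- g + h)"
proof -
  fix g :: 'g and x :: "'g \<Rightarrow> complex"
  assume "(\<lambda>h. (cmod (x h))\<^sup>2) summable_on UNIV"
  moreover have "bij (\<lambda>h. - g + h)"
    by (rule bij_betw_byWitness[where f' = "\<lambda>h. g + h"]) (auto simp: add.assoc[symmetric])
  ultimately show "(\<lambda>h. (cmod (x (- g + h)))\<^sup>2) summable_on UNIV"
    by (subst summable_on_reindex_bij_betw[where f = "\<lambda>h. (cmod (x h))\<^sup>2"])
qed

lemma bounded_linear_translate: "bounded_linear (translate g)"
proof (rule bounded_linear_intro[where K = 1])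
  show "translate g (x + y) = translate g x + translate g y" for x y
    by transfer simp
  show "translate g (r *\<^sub>R x) = r *\<^sub>R translate g x" for r x
    by transfer simp
  have bij: "bij (\<lambda>h. - g + h)"
    by (rule bij_betw_byWitness[where f' = "\<lambda>h. g + h"]) (auto simp: add.assoc[symmetric])
  have "(norm (translate g x))\<^sup>2 = (norm x)\<^sup>2" for x
    unfolding norm_ell2_power2 translate.rep_eq
    by (rule infsum_reindex_bij_betw[OF bij, where f = "\<lambda>h. (cmod (Rep_ell2 x h))\<^sup>2"])
  then show "norm (translate g x) \<le> norm x * 1" for x
    by simp
qed

lift_definition left_regular :: "('g::group_add \<Rightarrow>\<^sub>0 complex) \<Rightarrow> 'g ell2 \<Rightarrow>\<^sub>L 'g ell2" is
  "\<lambda>a x. \<Sum>g\<in>Poly_Mapping.keys a. Poly_Mapping.lookup a g *\<^sub>C translate g x"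
  by (rule bounded_linear_sum)
    (rule bounded_linear_compose[OF bounded_linear_scaleC bounded_linear_translate])

definition group_vN :: "('g::group_add ell2 \<Rightarrow>\<^sub>L 'g ell2) set" where
  "group_vN = weak_operator_topology closure_of range left_regular"

definition matrix_vN :: "(('g::group_add ell2^'n) \<Rightarrow>\<^sub>L ('g ell2^'n)) set" where
  "matrix_vN = {op_of_matrix A | A. \<forall>j k. A $ j $ k \<in> group_vN}"

definition GL_vN :: "(('g::group_add ell2^'n) \<Rightarrow>\<^sub>L ('g ell2^'n)) set" where
  "GL_vN = {T \<in> matrix_vN. \<exists>S\<in>matrix_vN. S o\<^sub>L T = id_blinfun \<and> T o\<^sub>L S = id_blinfun}"

definition vN_trace :: "('g::group_add ell2 \<Rightarrow>\<^sub>L 'g ell2) \<Rightarrow> complex" where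
  "vN_trace T = cinner (T (delta 0)) (delta 0)"

definition matrix_trace :: "(('g::group_add ell2^'n) \<Rightarrow>\<^sub>L ('g ell2^'n)) \<Rightarrow> complex" where
  "matrix_trace T = (\<Sum>j\<in>UNIV. vN_trace (matrix_entry T j j))"

text \<open>
  The trace of the self-adjoint operator \<open>log |T|\<close> is real; \<open>Re\<close> only changes its type.
\<close>

definition fk_det :: "(('g::group_add ell2^'n) \<Rightarrow>\<^sub>L ('g ell2^'n)) \<Rightarrow> real" where
  "fk_det T = exp (Re (matrix_trace (func_calc ln (abs_op T))))"

definition integral_op :: "('g::group_add \<Rightarrow>\<^sub>0 int)^'n^'n \<Rightarrow> ('g ell2^'n) \<Rightarrow>\<^sub>L ('g ell2^'n)" where
  "integral_op f = op_of_matrix (\<chi> j k. left_regular (Poly_Mapping.map of_int (f $ j $ k)))"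

end

theory Submission
  imports
    Defs
    "HOL-Computational_Algebra.Fundamental_Theorem_Algebra"
    "Jordan_Normal_Form.Schur_Decomposition"
begin

text \<open>
  Put \<open>a = f\<^sup>* f\<close>. The vector \<open>\<xi> = a\<^sup>-\<^sup>1 \<delta>\<close> is square-summable, and integral square-summable vectors are
  finitely supported; so if \<open>f\<close> is not invertible over \<open>\<int>(\<Gamma>)\<close>, then some \<open>\<xi>\<close> has a coordinate \<open>v\<close> that is
  not an integer. In a sofic model on \<open>d\<close> points, \<open>a\<close> becomes an integral positive semidefinite matrix
  \<open>A\<close>. Around each point \<open>s\<close> of a well separated set \<open>S\<close> of positive density, replace one column of \<open>A\<close>
  by the integral vector \<open>\<delta>\<^sub>s - k (column)\<close>, where \<open>k\<close> is \<open>\<lfloor>v\<rfloor>\<close> or \<open>\<lceil>v\<rceil>\<close>. After a perturbation of \<open>o(d)\<close>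
  diagonal entries of \<open>A\<close> and a suitable choice of the \<open>k\<close> this gives a nonsingular integral matrix \<open>B\<close>, so
  \<open>\<bar>det B\<bar> \<ge> 1\<close>.

  For a polynomial \<open>p\<close> approximating \<open>1/t\<close> on the spectrum of \<open>a\<close>, the columns of \<open>p(A) B\<close> have norm about 1,
  except that a unimodular column operation brings the replaced ones down to norm about \<open>\<bar>v - k\<bar> < 1\<close>.
  By Hadamard's inequality \<open>det (p(A)) \<le> exp (- c d)\<close> for a constant \<open>c > 0\<close>. On the other hand
  \<open>log det (p(A))\<close> is at least the trace of \<open>q(A)\<close> for every polynomial \<open>q \<le> log p\<close>, and these traces, divided
  by \<open>d\<close>, come arbitrarily close to \<open>- 2 log det f\<close>. Hence \<open>log det f > 0\<close>. No control of the small
  eigenvalues of \<open>A\<close> is needed, because \<open>p\<close> and \<open>q\<close> are bounded near 0.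
\<close>

section \<open>Determinants of integral matrices\<close>

text \<open>Integrality with no column replaced would give only \<open>log det f\<close> \<ge> 0;
  strictness needs a fixed proportion of the columns to become shorter by a fixed factor. The source
  of this is \<open>a \<xi> = \<delta>\<close>: as \<open>p(A)\<close> is locally an approximate
  inverse of \<open>A\<close>, subtracting from \<open>\<delta>\<^sub>s\<close> the columns with
  coefficients \<open>\<xi>\<close> would leave almost nothing. The coefficient of the replaced
  column itself must be an integer, or \<open>B\<close> is no longer integral; those of the other
  columns may be arbitrary reals, since they enter through a unimodular operation. So, up to a small
  tail, everything cancels except the difference of \<open>v\<close> and \<open>k\<close>.
  Separation of \<open>S\<close> ensures that a column subtracted at one point is never one that is
  replaced at another, so that the operations do not interfere.

  The perturbation is there because \<open>A\<close> may be singular although \<open>a\<close> is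
  invertible. Its size is at most the multiplicity of the eigenvalue 0, and the trace of a
  nonnegative polynomial that is 1 at 0 and tiny on the spectrum of \<open>a\<close> bounds this
  multiplicity.\<close>

lemma index_mult_mat_sum:
  assumes "X \<in> carrier_mat n m" "Y \<in> carrier_mat m l" "i < n" "j < l"
  shows "(X * Y) $$ (i,j) = (\<Sum>k<m. X $$ (i,k) * Y $$ (k,j))"
  using assms by (auto simp: scalar_prod_def atLeast0LessThan intro!: sum.cong)

section \<open>Polynomials of matrices, similarity and triangular form\<close>

text \<open>Horner evaluation; \<open>dim_row A\<close> supplies the size of the scalar and zero
  matrices, which the type does not carry.\<close>

definition poly_mat :: "'a::comm_ring_1 poly \<Rightarrow> 'a mat \<Rightarrow> 'a mat" where
  "poly_mat p A = fold_coeffs (\<lambda>a M. a \<cdot>\<^sub>m 1\<^sub>m (dim_row A) + A * M) p (0\<^sub>m (dim_row A) (dim_row A))"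

lemma poly_mat_0 [simp]: "A \<in> carrier_mat n n \<Longrightarrow> poly_mat 0 A = 0\<^sub>m n n"
  by (simp add: poly_mat_def)

lemma poly_mat_pCons:
  assumes "A \<in> carrier_mat n n"
  shows "poly_mat (pCons a p) A = a \<cdot>\<^sub>m 1\<^sub>m n + A * poly_mat p A"
proof (cases "a = 0 \<and> p = 0")
  case True
  have "(0::'a) \<cdot>\<^sub>m 1\<^sub>m n = 0\<^sub>m n n" by (rule eq_matI) auto
  then show ?thesis using assms True by (simp add: poly_mat_0[where n = n])
next
  case False
  then show ?thesis using assms by (auto simp: poly_mat_def)
qed

lemma poly_mat_carrier [simp]:
  assumes "A \<in> carrier_mat n n"
  shows "poly_mat p A \<in> carrier_mat n n"
  using assms by (induction p) (auto simp: poly_mat_pCons)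

lemma poly_mat_similar:
  assumes "B \<in> carrier_mat n n" "P \<in> carrier_mat n n" "Q \<in> carrier_mat n n"
    and PQ: "P * Q = 1\<^sub>m n" and QP: "Q * P = 1\<^sub>m n"
  shows "poly_mat p (P * B * Q) = P * poly_mat p B * Q"
proof (induction p)
  case 0
  show ?case using assms by (simp add: poly_mat_0[where n = n])
next
  case (pCons a p)
  let ?R = "poly_mat p B"
  have c: "?R \<in> carrier_mat n n" "P * B * Q \<in> carrier_mat n n" using assms by auto
  note assoc = assoc_mult_mat[where n\<^sub>1=n and n\<^sub>2=n and n\<^sub>3=n and n\<^sub>4=n]
  have RQ: "?R * Q \<in> carrier_mat n n" using c(1) assms(3) by (rule mult_carrier_mat)
  have "Q * (P * (?R * Q)) = (Q * P) * (?R * Q)"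
    by (rule assoc[OF assms(3,2) RQ, symmetric])
  also have "\<dots> = ?R * Q" unfolding QP using RQ by (rule left_mult_one_mat)
  finally have "P * B * (?R * Q) = P * B * (Q * (P * (?R * Q)))" by simp
  also have "\<dots> = (P * B * Q) * (P * ?R * Q)"
    unfolding assoc[OF assms(2) c(1) assms(3)]
    by (rule assoc[symmetric]) (use assms RQ in \<open>auto intro!: mult_carrier_mat[where n = n]\<close>)
  finally have "(P * B * Q) * (P * ?R * Q) = P * B * (?R * Q)" ..
  also have "\<dots> = (P * B * ?R) * Q"
    by (rule assoc[symmetric]) (use assms c in \<open>auto intro!: mult_carrier_mat[where n = n]\<close>)
  also have "P * B * ?R = P * (B * ?R)" by (rule assoc[OF assms(2,1) c(1)])
  finally have 1: "(P * B * Q) * (P * ?R * Q) = P * (B * ?R) * Q" .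
  have 2: "P * (a \<cdot>\<^sub>m 1\<^sub>m n) * Q = a \<cdot>\<^sub>m 1\<^sub>m n"
    using assms by (simp add: mult_smult_distrib[where n=n and nr=n and nc=n]
        mult_smult_assoc_mat[where n=n and nr=n and nc=n] PQ)
  have "P * poly_mat (pCons a p) B * Q = P * (a \<cdot>\<^sub>m 1\<^sub>m n) * Q + P * (B * ?R) * Q"
    unfolding poly_mat_pCons[OF assms(1)]
    by (subst mult_add_distrib_mat[where nr=n and n=n and nc=n];
        (subst add_mult_distrib_mat[where nr=n and n=n and nc=n])?)
      (use assms c in \<open>auto intro!: mult_carrier_mat[where n = n]\<close>)
  then show ?case
    unfolding poly_mat_pCons[OF c(2)] pCons.IH 1 2 by simp
qed

lemma poly_mat_upper_triangular:
  assumes B: "B \<in> carrier_mat n n" and ut: "upper_triangular B"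
  shows "upper_triangular (poly_mat p B) \<and> (\<forall>i<n. poly_mat p B $$ (i,i) = poly p (B $$ (i,i)))"
proof (induction p)
  case 0
  show ?case using assms by (auto simp: upper_triangular_def)
next
  case (pCons a p)
  let ?R = "poly_mat p B"
  have c: "?R \<in> carrier_mat n n" using B by simp
  have ix: "(B * ?R) $$ (i,j) = (if j < i then 0 else (B * ?R) $$ (i,j)) \<and>
      (B * ?R) $$ (i,i) = B $$ (i,i) * ?R $$ (i,i)" if ij: "i < n" "j < n" for i j
  proof -
    have e: "(B * ?R) $$ (i,j) = (\<Sum>k<n. B $$ (i,k) * ?R $$ (k,j))" if "i < n" "j < n" for i j
      using index_mult_mat_sum[OF B c that] .
    have z: "B $$ (i,k) * ?R $$ (k,j) = 0" if "k < n" "k \<noteq> i \<or> j < i" "j \<le> i" for k j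
    proof (cases "k < i")
      case True
      then show ?thesis using ut ij B by (auto simp: upper_triangular_def)
    next
      case False
      then have "j < k" using that by auto
      then show ?thesis using pCons.IH that c by (auto simp: upper_triangular_def)
    qed
    have "(B * ?R) $$ (i,i) = (\<Sum>k<n. if k = i then B $$ (i,i) * ?R $$ (i,i) else 0)"
      unfolding e[OF ij(1) ij(1)] by (rule sum.cong) (use z in auto)
    moreover have "(B * ?R) $$ (i,j) = 0" if "j < i"
      unfolding e[OF ij] by (rule sum.neutral) (use z that in auto)
    ultimately show ?thesis using ij by auto
  qed
  show ?case
    unfolding poly_mat_pCons[OF B] upper_triangular_def
  proof (intro allI impI conjI)
    have ad: "(a \<cdot>\<^sub>m 1\<^sub>m n + B * ?R) $$ (i,j) = (if i = j then a else 0) + (B * ?R) $$ (i,j)"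
      if "i < n" "j < n" for i j
      using that B carrier_matD[OF c] by (simp del: index_mult_mat(1))
    fix i j assume "i < dim_row (a \<cdot>\<^sub>m 1\<^sub>m n + B * ?R)" "j < i"
    then have ij: "i < n" "j < n" "j < i" using B carrier_matD[OF c] by auto
    show "(a \<cdot>\<^sub>m 1\<^sub>m n + B * ?R) $$ (i,j) = 0"
      unfolding ad[OF ij(1,2)] using ix[OF ij(1,2)] ij(3) by simp
  next
    fix i assume i: "i < n"
    have "(a \<cdot>\<^sub>m 1\<^sub>m n + B * ?R) $$ (i,i) = a + (B * ?R) $$ (i,i)"
      using i B carrier_matD[OF c] by (simp del: index_mult_mat(1))
    then show "(a \<cdot>\<^sub>m 1\<^sub>m n + B * ?R) $$ (i,i) = poly (pCons a p) (B $$ (i,i))"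
      using ix[OF i i] pCons.IH i by simp
  qed
qed

lemma trace_similar:
  fixes P B Q :: "'a::comm_ring_1 mat"
  assumes "B \<in> carrier_mat n n" "P \<in> carrier_mat n n" "Q \<in> carrier_mat n n" "Q * P = 1\<^sub>m n"
  shows "(\<Sum>i<n. (P * B * Q) $$ (i,i)) = (\<Sum>i<n. B $$ (i,i))"
proof -
  have "(\<Sum>i<n. (P * B * Q) $$ (i,i)) = (\<Sum>i<n. \<Sum>k<n. (P * B) $$ (i,k) * Q $$ (k,i))"
    using assms by (intro sum.cong refl, subst index_mult_mat_sum[of _ n n _ n]) auto
  also have "\<dots> = (\<Sum>k<n. \<Sum>i<n. Q $$ (k,i) * (P * B) $$ (i,k))"
    by (subst sum.swap) (simp add: mult.commute)
  also have "\<dots> = (\<Sum>k<n. (Q * (P * B)) $$ (k,k))"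
    using assms by (intro sum.cong refl, subst index_mult_mat_sum[of Q n n _ n]) auto
  also have "Q * (P * B) = B"
    using assms by (simp flip: assoc_mult_mat)
  finally show ?thesis .
qed

section \<open>Spectra of real symmetric matrices\<close>

text \<open>Write the eigenvector as \<open>x + \<i> y\<close>. Symmetry equates the product of
  \<open>A x\<close> with \<open>y\<close> and that of \<open>x\<close> with \<open>A y\<close>,
  which leaves \<open>Im z * (x \<bullet> x + y \<bullet> y) = 0\<close>. With
  \<open>Im z = 0\<close> both \<open>x\<close> and \<open>y\<close> satisfy the real eigenvalue
  equation, and one of them is nonzero.\<close>

lemma symmetric_mat_real_eigenvalue:
  fixes A :: "real mat"
  assumes A: "A \<in> carrier_mat n n" and sym: "transpose_mat A = A"
    and ev: "eigenvalue (map_mat complex_of_real A) z"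
  shows "Im z = 0 \<and> eigenvalue A (Re z)"
proof -
  obtain v where v: "v \<in> carrier_vec n" "v \<noteq> 0\<^sub>v n" 
    and Av: "map_mat complex_of_real A *\<^sub>v v = z \<cdot>\<^sub>v v"
    using ev A unfolding eigenvalue_def eigenvector_def by auto
  define x where "x = map_vec Re v"
  define y where "y = map_vec Im v"
  have xy: "x \<in> carrier_vec n" "y \<in> carrier_vec n" using v unfolding x_def y_def by auto
  have comp: "(\<Sum>j<n. complex_of_real (A $$ (i,j)) * vec_index v j) = z * vec_index v i" if "i < n" for i
    using arg_cong[OF Av, of "\<lambda>w. vec_index w i"] that A v
    by (simp add: scalar_prod_def atLeast0LessThan)
  have Ax: "A *\<^sub>v x = Re z \<cdot>\<^sub>v x - Im z \<cdot>\<^sub>v y"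
    by (rule eq_vecI) (use arg_cong[OF comp, of _ Re] A v in
      \<open>auto simp: x_def y_def scalar_prod_def atLeast0LessThan\<close>)
  have Ay: "A *\<^sub>v y = Im z \<cdot>\<^sub>v x + Re z \<cdot>\<^sub>v y"
    by (rule eq_vecI) (use arg_cong[OF comp, of _ Im] A v in
      \<open>auto simp: x_def y_def scalar_prod_def atLeast0LessThan\<close>)
  have "(A *\<^sub>v x) \<bullet> y = x \<bullet> (A *\<^sub>v y)"
    using transpose_vec_mult_scalar[OF A xy(1,2)] sym
    by (metis A comm_scalar_prod mult_mat_vec_carrier xy(1) xy(2))
  then have "Re z * (x \<bullet> y) - Im z * (y \<bullet> y) = Im z * (x \<bullet> x) + Re z * (x \<bullet> y)"
    unfolding Ax Ay using xy
    by (simp add: minus_scalar_prod_distrib[of _ n] scalar_prod_add_distrib[of _ n])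
  then have "Im z * (x \<bullet> x + y \<bullet> y) = 0" by (simp add: algebra_simps)
  moreover have "x \<bullet> x + y \<bullet> y > 0"
  proof -
    obtain i where i: "i < n" "vec_index v i \<noteq> 0" using v by (metis carrier_vecD eq_vecI index_zero_vec)
    have "x \<bullet> x + y \<bullet> y = (\<Sum>j<n. (Re (vec_index v j))\<^sup>2 + (Im (vec_index v j))\<^sup>2)"
      using v by (simp add: x_def y_def scalar_prod_def atLeast0LessThan sum.distrib power2_eq_square)
    also have "\<dots> > 0"
      by (rule sum_pos2[of _ i]) (use i in \<open>auto simp: complex_eq_iff sum_power2_gt_zero_iff\<close>)
    finally show ?thesis .
  qed
  ultimately have im: "Im z = 0" by auto
  have "A *\<^sub>v x = Re z \<cdot>\<^sub>v x" "A *\<^sub>v y = Re z \<cdot>\<^sub>v y"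
    unfolding Ax Ay im using xy by auto
  moreover have "x \<noteq> 0\<^sub>v n \<or> y \<noteq> 0\<^sub>v n"
    using \<open>x \<bullet> x + y \<bullet> y > 0\<close> xy by auto
  ultimately show ?thesis
    using im A xy unfolding eigenvalue_def eigenvector_def by auto
qed

text \<open>Triangular form is enough, because determinant and trace of \<open>p(A)\<close> are read
  off the diagonal. Since all complex eigenvalues are real, the characteristic polynomial splits
  over the reals and the Schur decomposition applies. The list \<open>es\<close> carries
  multiplicities.\<close>

lemma symmetric_mat_spectrum:
  fixes A :: "real mat"
  assumes A: "A \<in> carrier_mat n n" and sym: "transpose_mat A = A"
  obtains es where "length es = n" "\<And>e. e \<in> set es \<Longrightarrow> eigenvalue A e"
    "\<And>p. Determinant.det (poly_mat p A) = (\<Prod>e\<leftarrow>es. poly p e)"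
    "\<And>p. (\<Sum>i<n. poly_mat p A $$ (i,i)) = (\<Sum>e\<leftarrow>es. poly p e)"
proof -
  interpret rp: map_poly_inj_idom_hom complex_of_real ..
  let ?C = "map_mat complex_of_real A"
  have C: "?C \<in> carrier_mat n n" using A by simp
  obtain zs where zs: "char_poly ?C = (\<Prod>a\<leftarrow>zs. [:- a, 1:])" "length zs = n"
    using char_poly_factorized[OF C] by blast
  have ev: "Im z = 0 \<and> eigenvalue A (Re z)" if "z \<in> set zs" for z
  proof -
    have "poly (char_poly ?C) z = 0"
      unfolding zs(1) poly_prod_list using that by (auto simp: prod_list_zero_iff)
    then show ?thesis
      using symmetric_mat_real_eigenvalue[OF A sym] eigenvalue_root_char_poly[OF C] by blast
  qed
  define es where "es = map Re zs"
  have zes: "zs = map complex_of_real es"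
    unfolding es_def map_map by (rule map_idI[symmetric]) (use ev in \<open>auto simp: complex_eq_iff\<close>)
  have "map_poly complex_of_real (char_poly A) = map_poly complex_of_real (\<Prod>a\<leftarrow>es. [:- a, 1:])"
  proof -
    have "map_poly complex_of_real (\<Prod>a\<leftarrow>es. [:- a, 1:]) = (\<Prod>a\<leftarrow>zs. [:- a, 1:])"
      unfolding zes by (simp add: rp.hom_prod_list o_def map_poly_pCons)
    then show ?thesis by (simp add: of_real_hom.char_poly_hom[OF A] flip: zs(1))
  qed
  then have cp: "char_poly A = (\<Prod>a\<leftarrow>es. [:- a, 1:])"
    by (rule injD[OF rp.inj_f])
  obtain B P Q where dec: "schur_decomposition A es = (B,P,Q)"
    by (cases "schur_decomposition A es") auto
  from schur_decomposition[OF A cp dec]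
  have wit: "similar_mat_wit A B P Q" and ut: "upper_triangular B" and diag: "diag_mat B = es" by auto
  note w = similar_mat_witD2[OF A wit]
  have len: "length es = n" using zs(2) by (simp add: es_def)
  have Bii: "B $$ (i,i) = es ! i" if "i < n" for i
    using diag that w(5) by (auto simp: diag_mat_def)
  have cB: "poly_mat p B \<in> carrier_mat n n" for p using w(5) by simp
  have pA: "poly_mat p A = P * poly_mat p B * Q" for p
    unfolding w(3) by (rule poly_mat_similar[OF w(5,6,7,1,2)])
  have tri: "upper_triangular (poly_mat p B)" for p
    using poly_mat_upper_triangular[OF w(5) ut] by blast
  have trii: "poly_mat p B $$ (i,i) = poly p (es ! i)" if "i < n" for i p
    using poly_mat_upper_triangular[OF w(5) ut, of p] Bii that by simp
  have dm: "diag_mat (poly_mat p B) = map (poly p) es" for p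
    by (rule nth_equalityI) (use trii carrier_matD[OF cB] len in \<open>auto simp: diag_mat_def\<close>)
  show ?thesis
  proof
    show "length es = n" by fact
    show "eigenvalue A e" if "e \<in> set es" for e
      using that ev by (auto simp: es_def)
    show "Determinant.det (poly_mat p A) = (\<Prod>e\<leftarrow>es. poly p e)" for p
    proof -
      have "Determinant.det (poly_mat p A) = Determinant.det (poly_mat p B) * Determinant.det (P * Q)"
        unfolding pA Determinant.det_mult[OF mult_carrier_mat[OF w(6) cB] w(7)]
          Determinant.det_mult[OF w(6) cB] Determinant.det_mult[OF w(6,7)] by simp
      also have "\<dots> = (\<Prod>e\<leftarrow>es. poly p e)"
        unfolding w(1) using det_upper_triangular[OF tri cB] dm[of p] by simp
      finally show ?thesis .
    qed
    show "(\<Sum>i<n. poly_mat p A $$ (i,i)) = (\<Sum>e\<leftarrow>es. poly p e)" for p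
      unfolding pA trace_similar[OF cB w(6,7,2)] 
      unfolding sum_list_sum_nth by (rule sum.cong) (use len trii in auto)
  qed
qed

section \<open>Hadamard's inequality in additive form\<close>

text \<open>Factor by factor \<open>x \<le> exp (x - 1)\<close>, with equality at 1; little is lost
  when the factors are close to 1.\<close>

lemma prod_list_le_exp_sum: "(\<And>e. e \<in> set es \<Longrightarrow> 0 \<le> e) \<Longrightarrow> (\<Prod>e\<leftarrow>es. e) \<le> exp ((\<Sum>e\<leftarrow>es. e) - real (length es))"
proof (induction es)
  case (Cons e es)
  have "e \<le> exp (e - 1)" using exp_ge_add_one_self[of "e - 1"] by simp
  then have "e * (\<Prod>e\<leftarrow>es. e) \<le> exp (e - 1) * exp ((\<Sum>e\<leftarrow>es. e) - real (length es))"
    using Cons by (intro mult_mono) (auto intro!: prod_list_nonneg)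
  then show ?case by (simp add: algebra_simps flip: exp_add)
qed simp

lemma poly_mat_X: "A \<in> carrier_mat n n \<Longrightarrow> poly_mat [:c, 1:] A = c \<cdot>\<^sub>m 1\<^sub>m n + A"
  by (rule eq_matI) (auto simp: poly_mat_pCons[of _ n] poly_mat_0[of _ n])

lemma scalar_prod_self_nonneg: "0 \<le> (v::real vec) \<bullet> v"
  by (auto simp: scalar_prod_def intro!: sum_nonneg)

lemma scalar_prod_self_pos:
  assumes "v \<in> carrier_vec n" "v \<noteq> 0\<^sub>v n"
  shows "0 < (v::real vec) \<bullet> v"
proof -
  obtain i where i: "i < n" "vec_index v i \<noteq> 0"
    using assms by (metis carrier_vecD eq_vecI index_zero_vec)
  have "0 < (\<Sum>j<n. vec_index v j * vec_index v j)"
    by (rule sum_pos2[of _ i]) (use i in \<open>auto simp: zero_less_mult_iff not_less\<close>)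
  then show ?thesis using assms by (simp add: scalar_prod_def atLeast0LessThan)
qed

text \<open>The eigenvalues of \<open>transpose X * X\<close> are nonnegative, with product
  \<open>(det X)^2\<close> and sum the total of the squared column norms. Unlike the product form of
  Hadamard's inequality, this form lets the contributions of different kinds of columns simply be
  added.\<close>

lemma det_sq_le_exp:
  fixes X :: "real mat"
  assumes X: "X \<in> carrier_mat n n"
  shows "(Determinant.det X)\<^sup>2 \<le> exp ((\<Sum>i<n. \<Sum>j<n. (X $$ (i,j))\<^sup>2) - real n)"
proof -
  let ?A = "transpose_mat X * X"
  have A: "?A \<in> carrier_mat n n" using X by auto
  have sym: "transpose_mat ?A = ?A"
    using X by (subst transpose_mult[of _ n n _ n]) auto
  obtain es where es: "length es = n" "\<And>e. e \<in> set es \<Longrightarrow> eigenvalue ?A e"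
    "\<And>p. Determinant.det (poly_mat p ?A) = (\<Prod>e\<leftarrow>es. poly p e)"
    "\<And>p. (\<Sum>i<n. poly_mat p ?A $$ (i,i)) = (\<Sum>e\<leftarrow>es. poly p e)"
    using symmetric_mat_spectrum[OF A sym] by blast
  have pos: "0 \<le> e" if e: "e \<in> set es" for e
  proof -
    obtain v where v: "v \<in> carrier_vec n" "v \<noteq> 0\<^sub>v n" "?A *\<^sub>v v = e \<cdot>\<^sub>v v"
      using es(2)[OF e] A X unfolding eigenvalue_def eigenvector_def by auto
    have "e * (v \<bullet> v) = v \<bullet> (?A *\<^sub>v v)" using v by simp
    also have "\<dots> = v \<bullet> (transpose_mat X *\<^sub>v (X *\<^sub>v v))"
      using X v by (subst assoc_mult_mat_vec[of _ n n _ n]) auto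
    also have "\<dots> = (X *\<^sub>v v) \<bullet> (X *\<^sub>v v)"
      using transpose_vec_mult_scalar[OF X v(1), of "X *\<^sub>v v"] X v(1)
        comm_scalar_prod[of v n "transpose_mat X *\<^sub>v (X *\<^sub>v v)"] by auto
    also have "\<dots> \<ge> 0" by (rule scalar_prod_self_nonneg)
    finally show ?thesis using scalar_prod_self_pos[OF v(1,2)] by (simp add: zero_le_mult_iff)
  qed
  have pX: "poly_mat [:0, 1:] ?A = ?A"
    unfolding poly_mat_X[OF A] by (rule eq_matI) (use A X in auto)
  have "(\<Sum>i<n. ?A $$ (i,i)) = (\<Sum>i<n. \<Sum>j<n. (X $$ (j,i))\<^sup>2)"
    using X by (intro sum.cong refl, subst index_mult_mat_sum[of _ n n _ n]) (auto simp: power2_eq_square)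
  also have "\<dots> = (\<Sum>i<n. \<Sum>j<n. (X $$ (i,j))\<^sup>2)" by (rule sum.swap)
  finally have tr: "(\<Sum>e\<leftarrow>es. e) = (\<Sum>i<n. \<Sum>j<n. (X $$ (i,j))\<^sup>2)"
    using es(4)[of "[:0,1:]"] by (simp add: pX)
  have "(Determinant.det X)\<^sup>2 = Determinant.det ?A"
    using X by (simp add: Determinant.det_mult[of _ n] det_transpose[OF X] power2_eq_square)
  also have "\<dots> = (\<Prod>e\<leftarrow>es. e)" using es(3)[of "[:0,1:]"] by (simp add: pX)
  also have "\<dots> \<le> exp ((\<Sum>e\<leftarrow>es. e) - real n)"
    using prod_list_le_exp_sum[of es] pos es(1) by simp
  finally show ?thesis unfolding tr .
qed

section \<open>Column operations and diagonal perturbations\<close>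

text \<open>One column at a time by Cramer's rule. As \<open>x t\<close> vanishes at the other
  places of \<open>T\<close>, the partly replaced matrix and \<open>C\<close> agree on
  \<open>x t\<close>.\<close>

lemma det_replace_cols:
  fixes C :: "real mat"
  assumes C: "C \<in> carrier_mat n n" and T: "finite T" "T \<subseteq> {..<n}"
    and x: "\<And>t. t \<in> T \<Longrightarrow> x t \<in> carrier_vec n"
    and off: "\<And>t t'. t \<in> T \<Longrightarrow> t' \<in> T \<Longrightarrow> t' \<noteq> t \<Longrightarrow> vec_index (x t) t' = 0"
  shows "Determinant.det (mat n n (\<lambda>(i,j). if j \<in> T then vec_index (C *\<^sub>v x j) i else C $$ (i,j))) =
    (\<Prod>t\<in>T. vec_index (x t) t) * Determinant.det C"
  using T x off
proof (induction T rule: finite_induct)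
  case empty
  have "mat n n (\<lambda>(i,j). C $$ (i,j)) = C" using C by auto
  then show ?case by simp
next
  case (insert t T)
  let ?D = "\<lambda>T. mat n n (\<lambda>(i,j). if j \<in> T then vec_index (C *\<^sub>v x j) i else C $$ (i,j))"
  have xt: "x t \<in> carrier_vec n" and tn: "t < n" using insert.prems by auto
  have "?D T *\<^sub>v x t = C *\<^sub>v x t"
  proof (rule eq_vecI)
    fix i assume "i < dim_vec (C *\<^sub>v x t)"
    then have i: "i < n" using C by simp
    have "(\<Sum>j = 0..<n. ?D T $$ (i,j) * vec_index (x t) j) = (\<Sum>j = 0..<n. C $$ (i,j) * vec_index (x t) j)"
      using insert.prems insert.hyps i by (intro sum.cong refl) auto
    then show "vec_index (?D T *\<^sub>v x t) i = vec_index (C *\<^sub>v x t) i"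
      using i C xt by (simp add: scalar_prod_def)
  qed (use C in auto)
  then have "?D (insert t T) = replace_col (?D T) (?D T *\<^sub>v x t) t"
    by (intro eq_matI) (auto simp: replace_col_def)
  then have "Determinant.det (?D (insert t T)) = vec_index (x t) t * Determinant.det (?D T)"
    using cramer_lemma_mat[of "?D T" n "x t" t] xt tn by simp
  also have "Determinant.det (?D T) = (\<Prod>t\<in>T. vec_index (x t) t) * Determinant.det C"
    by (rule insert.IH) (use insert.prems in auto)
  finally show ?case using insert.hyps by simp
qed

definition diag_ind :: "nat \<Rightarrow> nat set \<Rightarrow> real mat" where
  "diag_ind n J = mat n n (\<lambda>(i,j). if i = j \<and> i \<in> J then 1 else 0)"

lemma diag_ind_carrier [simp]: "diag_ind n J \<in> carrier_mat n n"
  by (simp add: diag_ind_def)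

lemma dim_diag_ind [simp]: "dim_row (diag_ind n J) = n" "dim_col (diag_ind n J) = n"
  by (simp_all add: diag_ind_def)

lemma diag_ind_mult_index:
  assumes "i < n" "v \<in> carrier_vec n"
  shows "vec_index (diag_ind n J *\<^sub>v v) i = (if i \<in> J then vec_index v i else 0)"
proof -
  have "vec_index (diag_ind n J *\<^sub>v v) i = (\<Sum>k<n. diag_ind n J $$ (i,k) * vec_index v k)"
    using assms by (auto simp: scalar_prod_def diag_ind_def atLeast0LessThan)
  also have "\<dots> = (\<Sum>k<n. if k = i then (if i \<in> J then vec_index v i else 0) else 0)"
    using assms by (intro sum.cong) (auto simp: diag_ind_def)
  finally show ?thesis using assms by simp
qed

text \<open>A kernel vector \<open>w\<close> of the matrix perturbed on \<open>J - {j}\<close> makes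
  two nonnegative forms add up to 0. Hence \<open>w\<close> vanishes on \<open>J - {j}\<close>, and
  then \<open>A w = 0\<close>. If its entry at \<open>j\<close> vanished too, \<open>w\<close> would
  also be killed by the matrix perturbed on \<open>J\<close>, which is nonsingular.\<close>

lemma exists_kernel_vector:
  fixes A :: "real mat"
  assumes A: "A \<in> carrier_mat n n"
    and psd: "\<And>v. v \<in> carrier_vec n \<Longrightarrow> 0 \<le> v \<bullet> (A *\<^sub>v v)"
    and nz: "Determinant.det (A + diag_ind n J) \<noteq> 0"
    and z: "Determinant.det (A + diag_ind n (J - {j})) = 0"
    and j: "j \<in> J" "j < n"
  shows "\<exists>v\<in>carrier_vec n. A *\<^sub>v v = 0\<^sub>v n \<and> vec_index v j = 1 \<and> (\<forall>i<n. i \<in> J - {j} \<longrightarrow> vec_index v i = 0)"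
proof -
  let ?D = "diag_ind n (J - {j})"
  have c: "A + ?D \<in> carrier_mat n n" "A + diag_ind n J \<in> carrier_mat n n" using A by auto
  obtain w where w: "w \<in> carrier_vec n" "w \<noteq> 0\<^sub>v n" "(A + ?D) *\<^sub>v w = 0\<^sub>v n"
    using z det_0_iff_vec_prod_zero[OF c(1)] by auto
  have AD: "A *\<^sub>v w + ?D *\<^sub>v w = 0\<^sub>v n"
    using w A by (simp add: add_mult_distrib_mat_vec[of _ n n])
  have "0 = w \<bullet> (A *\<^sub>v w + ?D *\<^sub>v w)" unfolding AD using w by simp
  also have "\<dots> = w \<bullet> (A *\<^sub>v w) + w \<bullet> (?D *\<^sub>v w)"
    using A w mult_mat_vec_carrier[OF diag_ind_carrier w(1)] by (intro scalar_prod_add_distrib[of _ n]) auto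
  finally have s: "w \<bullet> (A *\<^sub>v w) + w \<bullet> (?D *\<^sub>v w) = 0" by simp
  have D: "w \<bullet> (?D *\<^sub>v w) = (\<Sum>i<n. if i \<in> J - {j} then (vec_index w i)\<^sup>2 else 0)"
    using w diag_ind_mult_index[OF _ w(1), of _ "J - {j}"]
    by (auto simp: scalar_prod_def atLeast0LessThan power2_eq_square diag_ind_def intro!: sum.cong)
  then have "w \<bullet> (?D *\<^sub>v w) = 0"
    using s psd[OF w(1)] by (smt (verit) sum_nonneg zero_le_power2)
  then have "\<forall>i\<in>{..<n}. (if i \<in> J - {j} then (vec_index w i)\<^sup>2 else 0) = 0"
    unfolding D by (subst (asm) sum_nonneg_eq_0_iff) auto
  then have off: "vec_index w i = 0" if "i < n" "i \<in> J - {j}" for i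
    using that by (metis lessThan_iff power_eq_0_iff)
  have Dw: "?D *\<^sub>v w = 0\<^sub>v n"
    by (rule eq_vecI) (use off w diag_ind_mult_index[OF _ w(1)] in \<open>auto simp del: index_mult_mat_vec\<close>)
  have Aw: "A *\<^sub>v w = 0\<^sub>v n" using AD A w unfolding Dw by auto
  have wj: "vec_index w j \<noteq> 0"
  proof
    assume "vec_index w j = 0"
    then have "diag_ind n J *\<^sub>v w = 0\<^sub>v n"
      by (intro eq_vecI) (use off w diag_ind_mult_index[OF _ w(1)] in \<open>auto simp del: index_mult_mat_vec\<close>)
    then have "(A + diag_ind n J) *\<^sub>v w = 0\<^sub>v n"
      using Aw w A by (simp add: add_mult_distrib_mat_vec[of _ n n])
    then show False using nz det_0_iff_vec_prod_zero[OF c(2)] w by auto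
  qed
  show ?thesis
  proof (intro bexI conjI allI impI)
    let ?v = "(1 / vec_index w j) \<cdot>\<^sub>v w"
    show "?v \<in> carrier_vec n" using w by simp
    have "(1 / vec_index w j) \<cdot>\<^sub>v 0\<^sub>v n = 0\<^sub>v n" by (rule eq_vecI) auto
    then show "A *\<^sub>v ?v = 0\<^sub>v n" unfolding mult_mat_vec[OF A w(1)] Aw .
    show "vec_index ?v j = 1" using wj w j by simp
    show "vec_index ?v i = 0" if "i < n" "i \<in> J - {j}" for i using off[OF that] that w by simp
  qed
qed

lemma psd_mat_spectrum:
  fixes A :: "real mat"
  assumes A: "A \<in> carrier_mat n n" and sym: "transpose_mat A = A"
    and psd: "\<And>v. v \<in> carrier_vec n \<Longrightarrow> 0 \<le> v \<bullet> (A *\<^sub>v v)"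
    and bd: "\<And>v. v \<in> carrier_vec n \<Longrightarrow> v \<bullet> (A *\<^sub>v v) \<le> K * (v \<bullet> v)"
  obtains es where "length es = n" "\<And>e. e \<in> set es \<Longrightarrow> 0 \<le> e \<and> e \<le> K"
    "\<And>p. Determinant.det (poly_mat p A) = (\<Prod>e\<leftarrow>es. poly p e)"
    "\<And>p. (\<Sum>i<n. poly_mat p A $$ (i,i)) = (\<Sum>e\<leftarrow>es. poly p e)"
proof -
  obtain es where es: "length es = n" "\<And>e. e \<in> set es \<Longrightarrow> eigenvalue A e"
    "\<And>p. Determinant.det (poly_mat p A) = (\<Prod>e\<leftarrow>es. poly p e)"
    "\<And>p. (\<Sum>i<n. poly_mat p A $$ (i,i)) = (\<Sum>e\<leftarrow>es. poly p e)"
    using symmetric_mat_spectrum[OF A sym] by blast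
  have "0 \<le> e \<and> e \<le> K" if e: "e \<in> set es" for e
  proof -
    obtain v where v: "v \<in> carrier_vec n" "v \<noteq> 0\<^sub>v n" "A *\<^sub>v v = e \<cdot>\<^sub>v v"
      using es(2)[OF e] A unfolding eigenvalue_def eigenvector_def by auto
    have "v \<bullet> (A *\<^sub>v v) = e * (v \<bullet> v)" using v by simp
    then show ?thesis
      using psd[OF v(1)] bd[OF v(1)] scalar_prod_self_pos[OF v(1,2)]
      by (simp add: zero_le_mult_iff mult_le_cancel_right)
  qed
  then show ?thesis using that es by blast
qed

text \<open>Lower bound for \<open>det (A + t I)\<close> near \<open>t = 0\<close>: only zero
  eigenvalues contribute powers of \<open>t\<close>. The constant is the product of the nonzero
  ones.\<close>

lemma prod_list_add_lower:
  assumes "\<And>e. e \<in> set es \<Longrightarrow> (0::real) \<le> e"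
  obtains c where "c > 0"
    "\<And>t. t \<ge> 0 \<Longrightarrow> c * t ^ length (filter (\<lambda>e. e = 0) es) \<le> (\<Prod>e\<leftarrow>es. t + e)"
proof -
  have "\<exists>c>0. \<forall>t\<ge>0. c * t ^ length (filter (\<lambda>e. e = 0) es) \<le> (\<Prod>e\<leftarrow>es. t + e)"
    using assms
  proof (induction es)
    case Nil
    show ?case by (intro exI[of _ 1]) auto
  next
    case (Cons e es)
    then obtain c where c: "c > 0" "\<And>t. t \<ge> 0 \<Longrightarrow> c * t ^ length (filter (\<lambda>e. e = 0) es) \<le> (\<Prod>e\<leftarrow>es. t + e)"
      by auto
    show ?case
    proof (cases "e = 0")
      case True
      then show ?thesis using c
        by (intro exI[of _ c]) (auto simp: mult.left_commute intro!: mult_left_mono)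
    next
      case False
      then have e: "e > 0" using Cons.prems[of e] by simp
      show ?thesis
      proof (intro exI[of _ "e * c"] conjI allI impI)
        fix t :: real assume t: "t \<ge> 0"
        have "e * (c * t ^ length (filter (\<lambda>e. e = 0) es)) \<le> (t + e) * (\<Prod>e\<leftarrow>es. t + e)"
          using t e c(1) c(2)[OF t] by (intro mult_mono) auto
        then show "e * c * t ^ length (filter (\<lambda>e. e = 0) (e # es)) \<le> (\<Prod>e\<leftarrow>e # es. t + e)"
          using False by (simp add: mult.assoc)
      qed (use e c in auto)
    qed
  qed
  then show ?thesis using that by blast
qed

text \<open>
  \<open>A + t I\<close> maps the kernel vector \<open>v j\<close> to \<open>t v j\<close>, and \<open>v\<close> is dual to the unit vectors on \<open>J\<close>;
  hence \<open>det (A + t I)\<close> vanishes to order at least \<open>card J\<close> at \<open>t = 0\<close>.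
\<close>

lemma card_le_zero_eigenvalues:
  fixes A :: "real mat"
  assumes A: "A \<in> carrier_mat n n"
    and es: "\<And>e. e \<in> set es \<Longrightarrow> 0 \<le> e"
    and det: "\<And>p. Determinant.det (poly_mat p A) = (\<Prod>e\<leftarrow>es. poly p e)"
    and J: "J \<subseteq> {..<n}"
    and v: "\<And>j. j \<in> J \<Longrightarrow> v j \<in> carrier_vec n \<and> A *\<^sub>v v j = 0\<^sub>v n \<and> vec_index (v j) j = 1 \<and>
      (\<forall>i<n. i \<in> J - {j} \<longrightarrow> vec_index (v j) i = 0)"
  shows "card J \<le> length (filter (\<lambda>e. e = 0) es)"
proof (rule ccontr)
  let ?m = "length (filter (\<lambda>e. e = 0) es)"
  assume "\<not> card J \<le> ?m"
  then have less: "?m < card J" by simp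
  have finJ: "finite J" using J finite_subset by blast
  define R where "R t = mat n n (\<lambda>(i,k). if k \<in> J then vec_index (v k) i else (t \<cdot>\<^sub>m 1\<^sub>m n + A) $$ (i,k))" for t :: real
  have R: "R t \<in> carrier_mat n n" for t by (simp add: R_def)
  have c: "t \<cdot>\<^sub>m 1\<^sub>m n + A \<in> carrier_mat n n" for t using A by simp
  have Jn: "j < n" if "j \<in> J" for j using J that by auto
  \<comment> \<open>The matrix \<open>?X\<close> has the columns \<open>t * v j\<close> at
    \<open>J\<close>. As the images of the dual vectors \<open>v j\<close> under \<open>?C\<close>
    they give it the determinant of \<open>?C\<close>; as rescaled columns of \<open>R t\<close>
    they give \<open>t ^ card J * det (R t)\<close>.\<close>
  have key: "Determinant.det (t \<cdot>\<^sub>m 1\<^sub>m n + A) = t ^ card J * Determinant.det (R t)" for t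
  proof -
    let ?C = "t \<cdot>\<^sub>m 1\<^sub>m n + A"
    let ?X = "mat n n (\<lambda>(i,j). if j \<in> J then t * vec_index (v j) i else ?C $$ (i,j))"
    have "Determinant.det (mat n n (\<lambda>(i,j). if j \<in> J then vec_index (?C *\<^sub>v v j) i else ?C $$ (i,j))) =
        (\<Prod>j\<in>J. vec_index (v j) j) * Determinant.det ?C"
      by (rule det_replace_cols[OF c finJ J]) (use v Jn in auto)
    moreover have "?C *\<^sub>v v j = t \<cdot>\<^sub>v v j" if "j \<in> J" for j
    proof -
      have vj: "v j \<in> carrier_vec n" "A *\<^sub>v v j = 0\<^sub>v n" using v[OF that] by auto
      have "?C *\<^sub>v v j = (t \<cdot>\<^sub>m 1\<^sub>m n) *\<^sub>v v j + A *\<^sub>v v j"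
        using A vj(1) by (intro add_mult_distrib_mat_vec) auto
      also have "(t \<cdot>\<^sub>m 1\<^sub>m n) *\<^sub>v v j = t \<cdot>\<^sub>v v j"
        by (rule eq_vecI) (use vj in auto)
      finally show ?thesis using vj by simp
    qed
    ultimately have 1: "Determinant.det ?X = Determinant.det ?C"
      using v Jn
      by (smt (verit, ccfv_SIG) carrier_vecD cong_mat index_smult_vec(1) mult_cancel_right2 prod.neutral split_conv)
    have "Determinant.det (mat n n (\<lambda>(i,j). if j \<in> J then vec_index (R t *\<^sub>v (t \<cdot>\<^sub>v unit_vec n j)) i else R t $$ (i,j))) =
        (\<Prod>j\<in>J. vec_index (t \<cdot>\<^sub>v unit_vec n j) j) * Determinant.det (R t)"
      by (rule det_replace_cols[OF R finJ J]) (use Jn in auto)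
    moreover have "vec_index (R t *\<^sub>v (t \<cdot>\<^sub>v unit_vec n j)) i = t * vec_index (v j) i" if "i < n" "j \<in> J" for i j
      using that Jn[OF that(2)] R[of t]
      by (simp add: mult_mat_vec[of _ n n] R_def scalar_prod_right_unit)
    moreover have "mat n n (\<lambda>(i,j). if j \<in> J then vec_index (R t *\<^sub>v (t \<cdot>\<^sub>v unit_vec n j)) i else R t $$ (i,j)) = ?X"
      using calculation(2) by (intro eq_matI) (auto simp: R_def)
    ultimately have "Determinant.det ?X = (\<Prod>j\<in>J. t) * Determinant.det (R t)"
      using Jn by simp
    then show ?thesis using 1 by simp
  qed
  define b where "b = (\<lambda>i j. (1 + \<bar>A $$ (i,j)\<bar> + \<bar>vec_index (v j) i\<bar>)\<^sup>2)"
  define G where "G = exp ((\<Sum>i<n. \<Sum>j<n. b i j))"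
  have bound: "Determinant.det (R t) \<le> G" if t: "0 \<le> t" "t \<le> 1" for t
  proof -
    have "(R t $$ (i,j))\<^sup>2 \<le> b i j" if "i < n" "j < n" for i j
      unfolding b_def abs_le_square_iff[symmetric]
      using that t A by (auto simp: R_def)
    then have "(\<Sum>i<n. \<Sum>j<n. (R t $$ (i,j))\<^sup>2) \<le> (\<Sum>i<n. \<Sum>j<n. b i j)"
      by (intro sum_mono) auto
    then have "(Determinant.det (R t))\<^sup>2 \<le> G"
      using det_sq_le_exp[OF R, of t] unfolding G_def by (smt (verit) exp_le_cancel_iff of_nat_0_le_iff)
    moreover have "G \<ge> 1" unfolding G_def b_def by (simp add: sum_nonneg)
    ultimately have "(Determinant.det (R t))\<^sup>2 \<le> G\<^sup>2"
      by (smt (verit) self_le_power zero_less_numeral)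
    then show ?thesis using \<open>G \<ge> 1\<close> by (smt (verit) power2_le_imp_le)
  qed
  obtain c where c0: "c > 0" "\<And>t. t \<ge> 0 \<Longrightarrow> c * t ^ ?m \<le> (\<Prod>e\<leftarrow>es. t + e)"
    using prod_list_add_lower[of es] es by blast
  have "c \<le> t * G" if t: "0 < t" "t \<le> 1" for t
  proof -
    have "c * t ^ ?m \<le> Determinant.det (t \<cdot>\<^sub>m 1\<^sub>m n + A)"
      using c0(2)[of t] t det[of "[:t, 1:]"] by (simp add: poly_mat_X[OF A])
    also have "\<dots> \<le> t ^ card J * G"
      unfolding key using bound[of t] t by (intro mult_left_mono) auto
    also have "\<dots> = t ^ ?m * (t ^ (card J - ?m) * G)"
      using less by (simp add: power_add[symmetric] mult.assoc[symmetric])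
    also have "\<dots> \<le> t ^ ?m * (t * G)"
    proof -
      have "t ^ (card J - ?m) \<le> t ^ 1" using less t by (intro power_decreasing) auto
      then show ?thesis using t unfolding G_def by (intro mult_left_mono mult_right_mono) auto
    qed
    finally show ?thesis using t by (simp add: mult.commute)
  qed
  \<comment> \<open>For this \<open>t\<close> the bound reads
    \<open>c \<le> t * G \<le> c / 2\<close>.\<close>
  from this[of "min 1 (c / (2 * G))"] have "c \<le> min 1 (c / (2 * G)) * G"
    using c0(1) unfolding G_def by auto
  also have "\<dots> \<le> c / (2 * G) * G" unfolding G_def by (intro mult_right_mono) auto
  also have "\<dots> = c / 2" unfolding G_def by simp
  finally show False using c0(1) by simp
qed

text \<open>
  The determinants obtained from the two choices in one column differ by a nonzero multiple of
  the determinant in which this column is not replaced, so they do not both vanish.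
\<close>

lemma exists_replacement_nonsingular:
  fixes C :: "real mat"
  assumes C: "C \<in> carrier_mat n n" "Determinant.det C \<noteq> 0"
    and T: "finite T" "T \<subseteq> {..<n}"
    and y: "\<And>t. t \<in> T \<Longrightarrow> y t \<in> carrier_vec n"
    and k: "\<And>t. t \<in> T \<Longrightarrow> k True t \<noteq> (k False t :: real)"
  shows "\<exists>b. Determinant.det (mat n n (\<lambda>(i,j). if j \<in> T
    then vec_index (y j) i - k (b j) j * C $$ (i,j) else C $$ (i,j))) \<noteq> 0"
  using T y k
proof (induction T rule: finite_induct)
  case empty
  have "mat n n (\<lambda>(i,j). C $$ (i,j)) = C" using C by auto
  then show ?case using C by simp
next
  case (insert t T)
  let ?M = "\<lambda>b T. mat n n (\<lambda>(i,j). if j \<in> T then vec_index (y j) i - k (b j) j * C $$ (i,j) else C $$ (i,j))"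
  have "\<exists>b. Determinant.det (?M b T) \<noteq> 0" by (rule insert.IH) (use insert.prems in auto)
  then obtain b where b: "Determinant.det (?M b T) \<noteq> 0" by blast
  let ?D = "?M b T"
  have D: "?D \<in> carrier_mat n n" and yt: "y t \<in> carrier_vec n" and t: "t < n" using insert.prems by auto
  obtain E where E: "E \<in> carrier_mat n n" "?D * E = 1\<^sub>m n"
    using det_non_zero_imp_unit[OF D b] by (auto simp: Units_def ring_mat_def)
  \<comment> \<open>\<open>x\<close> solves \<open>?D x = y t\<close>. The new column is
    \<open>?D z\<close>, so by Cramer's rule the determinant is multiplied by the entry of
    \<open>x\<close> at \<open>t\<close> minus \<open>k\<close>; the two values of \<open>k\<close>
    cannot both make this zero.\<close>
  define x where "x = E *\<^sub>v y t"
  have x: "x \<in> carrier_vec n" "?D *\<^sub>v x = y t"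
    using E yt D by (auto simp: x_def simp flip: assoc_mult_mat_vec[OF D E(1) yt])
  obtain \<beta> where \<beta>: "vec_index x t \<noteq> k \<beta> t" using insert.prems(3)[of t] by (metis insertI1)
  define z where "z = x - k \<beta> t \<cdot>\<^sub>v unit_vec n t"
  have z: "z \<in> carrier_vec n" using x by (simp add: z_def)
  have Dz: "vec_index (?D *\<^sub>v z) i = vec_index (y t) i - k \<beta> t * C $$ (i,t)" if "i < n" for i
  proof -
    have "?D *\<^sub>v z = ?D *\<^sub>v x - ?D *\<^sub>v (k \<beta> t \<cdot>\<^sub>v unit_vec n t)"
      unfolding z_def using D x by (intro mult_minus_distrib_mat_vec) auto
    also have "\<dots> = y t - k \<beta> t \<cdot>\<^sub>v (?D *\<^sub>v unit_vec n t)"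
      using D x by (simp add: mult_mat_vec[of _ n n])
    finally show ?thesis
      using that t yt insert.hyps by (simp add: scalar_prod_right_unit)
  qed
  have "?M (b(t := \<beta>)) (insert t T) = replace_col ?D (?D *\<^sub>v z) t"
    by (rule eq_matI) (use Dz insert.hyps in \<open>auto simp: replace_col_def simp del: index_mult_mat_vec\<close>)
  then have "Determinant.det (?M (b(t := \<beta>)) (insert t T)) = vec_index z t * Determinant.det ?D"
    using cramer_lemma_mat[OF D z t] by simp
  also have "\<dots> \<noteq> 0" using b \<beta> t x by (simp add: z_def)
  finally show ?case by blast
qed

lemma det_Ints:
  assumes "A \<in> carrier_mat n n" "\<And>i j. i < n \<Longrightarrow> j < n \<Longrightarrow> A $$ (i,j) \<in> \<int>"
  shows "Determinant.det A \<in> \<int>"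
  unfolding det_def'[OF assms(1)]
  by (intro Ints_sum Ints_mult Ints_prod) (auto simp: sign_def intro!: assms(2) dest: permutes_in_image)

section \<open>Matrices as operators on functions\<close>

text \<open>Horner evaluation for operators on functions over any index type. The same formula then
  serves the finite models and the finitely supported functions on the group, and the two can be
  compared value by value.\<close>

definition poly_app :: "real poly \<Rightarrow> (('i \<Rightarrow> real) \<Rightarrow> 'i \<Rightarrow> real) \<Rightarrow> ('i \<Rightarrow> real) \<Rightarrow> 'i \<Rightarrow> real" where
  "poly_app p F v = fold_coeffs (\<lambda>a w i. a * v i + F w i) p (\<lambda>_. 0)"

lemma poly_app_0 [simp]: "poly_app 0 F v = (\<lambda>_. 0)"
  by (simp add: poly_app_def)

lemma poly_app_pCons:
  assumes "F (\<lambda>_. 0) = (\<lambda>_. 0)"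
  shows "poly_app (pCons a p) F v = (\<lambda>i. a * v i + F (poly_app p F v) i)"
  by (cases "a = 0 \<and> p = 0") (auto simp: poly_app_def assms)

definition ker_app :: "'i set \<Rightarrow> ('i \<Rightarrow> 'i \<Rightarrow> real) \<Rightarrow> ('i \<Rightarrow> real) \<Rightarrow> 'i \<Rightarrow> real" where
  "ker_app I K v = (\<lambda>i. if i \<in> I then \<Sum>j\<in>I. K i j * v j else 0)"

lemma ker_app_0 [simp]: "ker_app I K (\<lambda>_. 0) = (\<lambda>_. 0)"
  by (auto simp: ker_app_def)

definition unit_at :: "'i \<Rightarrow> 'i \<Rightarrow> real" where
  "unit_at j = (\<lambda>i. if i = j then 1 else 0)"

text \<open>
  \<open>J\<close> is a minimal set for which \<open>K\<close> plus the diagonal projection onto \<open>J\<close> is nonsingular. Replacing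
  its columns \<open>t \<in> T\<close> by the integral vectors \<open>y t - h t t \<cdot> (column t)\<close> keeps the determinant a
  nonzero integer, and subtracting the remaining part of \<open>h t\<close> is a unimodular column operation.
\<close>

theorem integral_perturbation_trace_bound:
  fixes I :: "'i set" and K :: "'i \<Rightarrow> 'i \<Rightarrow> real" and h :: "bool \<Rightarrow> 'i \<Rightarrow> 'i \<Rightarrow> real"
  defines "F \<equiv> ker_app I K"
  assumes I: "finite I" and int: "\<And>i j. i \<in> I \<Longrightarrow> j \<in> I \<Longrightarrow> K i j \<in> \<int>"
    and sym: "\<And>i j. i \<in> I \<Longrightarrow> j \<in> I \<Longrightarrow> K i j = K j i"
    and psd: "\<And>v. 0 \<le> (\<Sum>i\<in>I. v i * F v i)"
    and bd: "\<And>v. (\<Sum>i\<in>I. v i * F v i) \<le> C * (\<Sum>i\<in>I. (v i)\<^sup>2)"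
    and T: "T \<subseteq> I" and y: "\<And>t i. t \<in> T \<Longrightarrow> i \<in> I \<Longrightarrow> y t i \<in> \<int>"
    and hint: "\<And>t b. t \<in> T \<Longrightarrow> h b t t \<in> \<int>"
    and hne: "\<And>t. t \<in> T \<Longrightarrow> h True t t \<noteq> h False t t"
    and hoff: "\<And>t t' b. t \<in> T \<Longrightarrow> t' \<in> T \<Longrightarrow> t' \<noteq> t \<Longrightarrow> h b t t' = 0"
    and pq: "\<And>x. 0 \<le> x \<Longrightarrow> x \<le> C \<Longrightarrow> exp (poly q x) \<le> poly p x"
  obtains J b where "J \<subseteq> I"
    "\<And>r. (\<And>x. 0 \<le> x \<Longrightarrow> x \<le> C \<Longrightarrow> 0 \<le> poly r x) \<Longrightarrow> 1 \<le> poly r 0 \<Longrightarrow>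
      real (card J) \<le> (\<Sum>i\<in>I. poly_app r F (unit_at i) i)"
    "2 * (\<Sum>i\<in>I. poly_app q F (unit_at i) i) \<le>
      (\<Sum>j\<in>I. \<Sum>i\<in>I. (poly_app p F (if j \<in> T
        then (\<lambda>i. y j i - (F (h (b j) j) i + (if i \<in> J then h (b j) j i else 0)))
        else (\<lambda>i. F (unit_at j) i + (if i \<in> J then unit_at j i else 0))) i)\<^sup>2) - real (card I)"
proof -
  define n where "n = card I"
  obtain e where e: "bij_betw e {..<n} I"
    using ex_bij_betw_nat_finite[OF I] by (auto simp: n_def atLeast0LessThan)
  have eI: "e i \<in> I" if "i < n" for i using e that by (auto simp: bij_betw_def)
  have einj: "e i = e j \<longleftrightarrow> i = j" if "i < n" "j < n" for i j
    using e that by (auto simp: bij_betw_def inj_on_def)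
  have sumI: "(\<Sum>i\<in>I. g i) = (\<Sum>i<n. g (e i))" for g :: "'i \<Rightarrow> real"
    by (rule sum.reindex_bij_betw[OF e, symmetric])
  define A where "A = mat n n (\<lambda>(i,j). K (e i) (e j))"
  have A: "A \<in> carrier_mat n n" by (simp add: A_def)
  define V where "V w = Matrix.vec n (\<lambda>i. w (e i))" for w :: "'i \<Rightarrow> real"
  have V [simp]: "V w \<in> carrier_vec n" "dim_vec (V w) = n" for w by (simp_all add: V_def)
  have Vi: "vec_index (V w) i = w (e i)" if "i < n" for w i using that by (simp add: V_def)
  have AV: "A *\<^sub>v V w = V (F w)" for w
    by (rule eq_vecI)
      (auto simp: A_def V_def F_def ker_app_def scalar_prod_def sumI eI atLeast0LessThan)
  have Vadd: "a \<cdot>\<^sub>v V w + V w' = V (\<lambda>i. a * w i + w' i)" for a w w'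
    by (rule eq_vecI) (auto simp: V_def)
  have F0: "F (\<lambda>_. 0) = (\<lambda>_. 0)" by (simp add: F_def)
  have pV: "poly_mat r A *\<^sub>v V w = V (poly_app r F w)" for r w
  proof (induction r)
    case 0
    show ?case by (rule eq_vecI) (auto simp: poly_mat_0[OF A] Vi scalar_prod_def)
  next
    case (pCons a r)
    have "poly_mat (pCons a r) A *\<^sub>v V w = (a \<cdot>\<^sub>m 1\<^sub>m n) *\<^sub>v V w + (A * poly_mat r A) *\<^sub>v V w"
      unfolding poly_mat_pCons[OF A] using A poly_mat_carrier[OF A, of r]
      by (intro add_mult_distrib_mat_vec[of _ n n]) auto
    also have "(a \<cdot>\<^sub>m 1\<^sub>m n) *\<^sub>v V w = a \<cdot>\<^sub>v V w"
      by (rule eq_vecI) (auto simp: Vi)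
    also have "(A * poly_mat r A) *\<^sub>v V w = V (F (poly_app r F w))"
      using A poly_mat_carrier[OF A, of r] by (simp add: assoc_mult_mat_vec[of _ n n _ n] pCons.IH AV)
    finally show ?case unfolding Vadd poly_app_pCons[of F, OF F0] .
  qed
  have Vunit: "V (unit_at (e j)) = unit_vec n j" if "j < n" for j
    by (rule eq_vecI) (use that einj in \<open>auto simp: V_def unit_at_def\<close>)
  have col: "vec_index (M *\<^sub>v unit_vec n j) i = M $$ (i,j)"
    if "M \<in> carrier_mat n n" "i < n" "j < n" for M :: "real mat" and i j
    using that by (simp add: scalar_prod_right_unit)
  have tr: "(\<Sum>i\<in>I. poly_app r F (unit_at i) i) = (\<Sum>i<n. poly_mat r A $$ (i,i))" for r
    unfolding sumI
  proof (rule sum.cong)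
    fix i assume "i \<in> {..<n}"
    then have i: "i < n" by simp
    show "poly_app r F (unit_at (e i)) (e i) = poly_mat r A $$ (i,i)"
      using pV[of r "unit_at (e i)"] col[OF poly_mat_carrier[OF A], of i i r] i
      by (simp add: Vunit Vi)
  qed simp
  have vV: "\<exists>w. v = V w" if "v \<in> carrier_vec n" for v
  proof (intro exI eq_vecI)
    let ?w = "\<lambda>x. vec_index v (inv_into {..<n} e x)"
    show "vec_index v i = vec_index (V ?w) i" if "i < dim_vec (V ?w)" for i
      using that e by (simp add: Vi bij_betw_def)
  qed (use that in auto)
  have VV: "V w \<bullet> V w' = (\<Sum>i\<in>I. w i * w' i)" for w w'
    unfolding sumI by (auto simp: scalar_prod_def V_def atLeast0LessThan)
  have symA: "transpose_mat A = A"
    by (rule eq_matI) (use sym eI in \<open>auto simp: A_def\<close>)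
  have psdA: "0 \<le> v \<bullet> (A *\<^sub>v v)" if "v \<in> carrier_vec n" for v
    using vV[OF that] psd by (auto simp: AV VV)
  have bdA: "v \<bullet> (A *\<^sub>v v) \<le> C * (v \<bullet> v)" if "v \<in> carrier_vec n" for v
    using vV[OF that] bd by (auto simp: AV VV power2_eq_square)
  obtain es where es: "length es = n" "\<And>e. e \<in> set es \<Longrightarrow> 0 \<le> e \<and> e \<le> C"
    "\<And>p. Determinant.det (poly_mat p A) = (\<Prod>e\<leftarrow>es. poly p e)"
    "\<And>p. (\<Sum>i<n. poly_mat p A $$ (i,i)) = (\<Sum>e\<leftarrow>es. poly p e)"
    using psd_mat_spectrum[OF A symA psdA bdA] by metis

  define nonsing where "nonsing J \<longleftrightarrow> J \<subseteq> {..<n} \<and> Determinant.det (A + diag_ind n J) \<noteq> 0" for J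
  \<comment> \<open>\<open>A + 1\<close> is positive definite, so some set qualifies and one of
    least cardinality exists.\<close>
  have "nonsing {..<n}"
    unfolding nonsing_def
  proof (intro conjI notI)
    have c: "A + diag_ind n {..<n} \<in> carrier_mat n n" using A by auto
    assume "Determinant.det (A + diag_ind n {..<n}) = 0"
    then obtain v where v: "v \<in> carrier_vec n" "v \<noteq> 0\<^sub>v n" "(A + diag_ind n {..<n}) *\<^sub>v v = 0\<^sub>v n"
      using det_0_iff_vec_prod_zero[OF c] by auto
    have "diag_ind n {..<n} *\<^sub>v v = v"
      by (rule eq_vecI) (use v(1) diag_ind_mult_index[OF _ v(1)] in \<open>auto simp del: index_mult_mat_vec\<close>)
    then have "A *\<^sub>v v + v = 0\<^sub>v n"
      using v A add_mult_distrib_mat_vec[of A n n "diag_ind n {..<n}" v] by simp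
    then have "v \<bullet> (A *\<^sub>v v) + v \<bullet> v = 0"
      using v A scalar_prod_add_distrib[of v n "A *\<^sub>v v" v] by simp
    then show False using psdA[OF v(1)] scalar_prod_self_pos[OF v(1,2)] by simp
  qed simp
  then obtain J where J: "nonsing J" "\<And>J'. nonsing J' \<Longrightarrow> card J \<le> card J'"
    using ex_has_least_nat[of nonsing _ card] by metis
  have Jn: "J \<subseteq> {..<n}" and finJ: "finite J" using J(1) finite_subset by (auto simp: nonsing_def)
  have "\<exists>v. v \<in> carrier_vec n \<and> A *\<^sub>v v = 0\<^sub>v n \<and> vec_index v j = 1 \<and>
      (\<forall>i<n. i \<in> J - {j} \<longrightarrow> vec_index v i = 0)" if j: "j \<in> J" for j
  proof -
    have "card (J - {j}) < card J" using j finJ by (intro card_Diff1_less)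
    then have "\<not> nonsing (J - {j})" using J(2)[of "J - {j}"] by auto
    then have "Determinant.det (A + diag_ind n (J - {j})) = 0" using Jn by (auto simp: nonsing_def)
    then show ?thesis
      using exists_kernel_vector[OF A psdA, of J j] J(1) j Jn by (auto simp: nonsing_def)
  qed
  then obtain v where v: "\<And>j. j \<in> J \<Longrightarrow> v j \<in> carrier_vec n \<and> A *\<^sub>v v j = 0\<^sub>v n \<and> vec_index (v j) j = 1 \<and>
      (\<forall>i<n. i \<in> J - {j} \<longrightarrow> vec_index (v j) i = 0)"
    by metis
  have cardJ: "card J \<le> length (filter (\<lambda>e. e = 0) es)"
    by (rule card_le_zero_eigenvalues[OF A _ es(3) Jn]) (use es(2) v in auto)

  define A' where "A' = A + diag_ind n J"
  have A': "A' \<in> carrier_mat n n" using A by (simp add: A'_def)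
  have A'V: "A' *\<^sub>v V w = V (\<lambda>i. F w i + (if i \<in> e ` J then w i else 0))" for w
  proof (rule eq_vecI)
    fix i assume "i < dim_vec (V (\<lambda>i. F w i + (if i \<in> e ` J then w i else 0)))"
    then have i: "i < n" by simp
    have "A' *\<^sub>v V w = V (F w) + diag_ind n J *\<^sub>v V w"
      unfolding A'_def AV[symmetric] using A by (intro add_mult_distrib_mat_vec[of _ n n]) auto
    moreover have "e i \<in> e ` J \<longleftrightarrow> i \<in> J" using einj[OF i] Jn by auto
    ultimately show "vec_index (A' *\<^sub>v V w) i = vec_index (V (\<lambda>i. F w i + (if i \<in> e ` J then w i else 0))) i"
      using i diag_ind_mult_index[OF i V(1), of J w] by (simp add: Vi del: index_mult_mat_vec)
  qed (use A' in simp)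
  have A'int: "A' $$ (i,j) \<in> \<int>" if "i < n" "j < n" for i j
    using that int[OF eI eI] by (auto simp: A'_def A_def diag_ind_def)
  define T' where "T' = {i. i < n \<and> e i \<in> T}"
  have T': "finite T'" "T' \<subseteq> {..<n}" by (auto simp: T'_def)
  define y' where "y' j = V (y (e j))" for j
  obtain b where b: "Determinant.det (mat n n (\<lambda>(i,j). if j \<in> T'
      then vec_index (y' j) i - h (b j) (e j) (e j) * A' $$ (i,j) else A' $$ (i,j))) \<noteq> 0"
    using exists_replacement_nonsingular[OF A' _ T', of y' "\<lambda>b j. h b (e j) (e j)"] J(1) hne
    by (auto simp: nonsing_def A'_def y'_def T'_def)
  define B where "B = mat n n (\<lambda>(i,j). if j \<in> T'
      then vec_index (y' j) i - h (b j) (e j) (e j) * A' $$ (i,j) else A' $$ (i,j))"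
  have B: "B \<in> carrier_mat n n" by (simp add: B_def)
  have "Determinant.det B \<in> \<int>"
    by (rule det_Ints[OF B]) (use A'int y hint eI in \<open>auto simp: B_def y'_def Vi T'_def\<close>)
  then have detB: "\<bar>Determinant.det B\<bar> \<ge> 1"
    using b unfolding B_def[symmetric] by (rule Ints_nonzero_abs_ge1)
  \<comment> \<open>At its own index \<open>x j\<close> has the entry 1, which makes the operation
    unimodular. Elsewhere it is \<open>- h\<close>, so that it completes the multiple
    \<open>h t t\<close> of column \<open>t\<close>, already subtracted in \<open>B\<close>, to the
    full combination \<open>A' h\<close>.\<close>
  define x where "x j = V (\<lambda>i. (1 + h (b j) (e j) (e j)) * unit_at (e j) i - h (b j) (e j) i)" for j
  define B1 where "B1 = mat n n (\<lambda>(i,j). if j \<in> T' then vec_index (B *\<^sub>v x j) i else B $$ (i,j))"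
  have B1: "B1 \<in> carrier_mat n n" by (simp add: B1_def)
  have "Determinant.det B1 = (\<Prod>t\<in>T'. vec_index (x t) t) * Determinant.det B"
    unfolding B1_def
    by (rule det_replace_cols[OF B T'])
      (use hoff einj in \<open>auto simp: x_def Vi T'_def unit_at_def\<close>)
  also have "(\<Prod>t\<in>T'. vec_index (x t) t) = 1"
    by (rule prod.neutral) (auto simp: x_def Vi T'_def unit_at_def)
  finally have detB1: "\<bar>Determinant.det B1\<bar> \<ge> 1" using detB by simp
  have Bx: "vec_index (B *\<^sub>v x j) i = vec_index (y' j) i - vec_index (A' *\<^sub>v V (h (b j) (e j))) i"
    if ij: "i < n" "j \<in> T'" for i j
  proof -
    have jn: "j < n" "e j \<in> T" using ij(2) by (auto simp: T'_def)
    have "vec_index (B *\<^sub>v x j) i = (\<Sum>m<n. B $$ (i,m) * vec_index (x j) m)"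
      using ij B by (simp add: scalar_prod_def atLeast0LessThan x_def)
    also have "\<dots> = (\<Sum>m<n. (if m = j then vec_index (y' j) i else 0) - A' $$ (i,m) * h (b j) (e j) (e m))"
    proof (rule sum.cong)
      fix m assume "m \<in> {..<n}"
      then have m: "m < n" by simp
      \<comment> \<open>At the replaced columns other than \<open>j\<close> the coefficient is 0 by
        \<open>hoff\<close>; all remaining columns of \<open>B\<close> are columns of
        \<open>A'\<close>.\<close>
      show "B $$ (i,m) * vec_index (x j) m =
          (if m = j then vec_index (y' j) i else 0) - A' $$ (i,m) * h (b j) (e j) (e m)"
        using ij jn m einj[OF m jn(1)] hoff[of "e j" "e m" "b j"]
        by (auto simp: B_def x_def Vi unit_at_def T'_def algebra_simps)
    qed simp
    also have "\<dots> = vec_index (y' j) i - (\<Sum>m<n. A' $$ (i,m) * h (b j) (e j) (e m))"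
      using jn by (simp add: sum_subtractf)
    also have "(\<Sum>m<n. A' $$ (i,m) * h (b j) (e j) (e m)) = vec_index (A' *\<^sub>v V (h (b j) (e j))) i"
      using ij A' by (simp add: scalar_prod_def atLeast0LessThan Vi)
    finally show ?thesis .
  qed
  define b' where "b' = b \<circ> inv_into {..<n} e"
  have b': "b' (e j) = b j" if "j < n" for j using that e by (simp add: b'_def bij_betw_def)
  define u where "u j = (if j \<in> T
        then (\<lambda>i. y j i - (F (h (b' j) j) i + (if i \<in> e ` J then h (b' j) j i else 0)))
        else (\<lambda>i. F (unit_at j) i + (if i \<in> e ` J then unit_at j i else 0)))" for j
  have B1u: "B1 *\<^sub>v unit_vec n j = V (u (e j))" if j: "j < n" for j
  proof (rule eq_vecI)
    fix i assume "i < dim_vec (V (u (e j)))"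
    then have i: "i < n" by simp
    show "vec_index (B1 *\<^sub>v unit_vec n j) i = vec_index (V (u (e j))) i"
    proof (cases "e j \<in> T")
      case True
      then have "j \<in> T'" using j by (simp add: T'_def)
      then show ?thesis
        unfolding col[OF B1 i j] using Bx[OF i, of j] True i j
        by (simp add: B1_def A'V Vi u_def b' y'_def del: index_mult_mat_vec)
    next
      case False
      then have "j \<notin> T'" by (simp add: T'_def)
      then show ?thesis
        unfolding col[OF B1 i j] using False i j col[OF A' i j] A'V[of "unit_at (e j)"]
        by (simp add: B1_def B_def Vunit Vi u_def del: index_mult_mat_vec)
    qed
  qed (use B1 in simp)

  let ?X = "poly_mat p A * B1"
  have X: "?X \<in> carrier_mat n n" using poly_mat_carrier[OF A] B1 by (rule mult_carrier_mat)
  have Xij: "?X $$ (i,j) = poly_app p F (u (e j)) (e i)" if "i < n" "j < n" for i j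
  proof -
    have "?X *\<^sub>v unit_vec n j = poly_mat p A *\<^sub>v (B1 *\<^sub>v unit_vec n j)"
      by (rule assoc_mult_mat_vec[OF poly_mat_carrier[OF A] B1]) simp
    then show ?thesis
      using col[OF X that] that by (simp add: B1u pV Vi del: index_mult_mat_vec)
  qed
  have "exp (\<Sum>e\<leftarrow>es. poly q e) \<le> (\<Prod>e\<leftarrow>es. poly p e)"
    using es(2)
  proof (induction es)
    case (Cons x es)
    have "exp (poly q x) * exp (\<Sum>e\<leftarrow>es. poly q e) \<le> poly p x * (\<Prod>e\<leftarrow>es. poly p e)"
      using Cons pq[of x] by (intro mult_mono) (auto intro: order_trans[OF exp_ge_zero])
    then show ?case by (simp add: exp_add)
  qed simp
  then have lower: "exp (\<Sum>i<n. poly_mat q A $$ (i,i)) \<le> Determinant.det (poly_mat p A)"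
    using es(3,4) by simp
  have "exp (2 * (\<Sum>i<n. poly_mat q A $$ (i,i))) = (exp (\<Sum>i<n. poly_mat q A $$ (i,i)))\<^sup>2"
    by (simp add: exp_double)
  also have "\<dots> \<le> (Determinant.det (poly_mat p A))\<^sup>2"
    by (rule power_mono[OF lower]) simp
  \<comment> \<open>Integrality acts through this inserted factor: \<open>B1\<close> has the
    determinant of \<open>B\<close>, a nonzero integer.\<close>
  also have "\<dots> \<le> (Determinant.det (poly_mat p A))\<^sup>2 * (Determinant.det B1)\<^sup>2"
    using detB1 abs_le_square_iff[of 1 "Determinant.det B1"] by (simp add: mult_le_cancel_left1)
  also have "\<dots> = (Determinant.det ?X)\<^sup>2"
    by (simp add: Determinant.det_mult[OF poly_mat_carrier[OF A] B1] power_mult_distrib)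
  also have "\<dots> \<le> exp ((\<Sum>i<n. \<Sum>j<n. (?X $$ (i,j))\<^sup>2) - real n)"
    by (rule det_sq_le_exp[OF X])
  finally have "2 * (\<Sum>i<n. poly_mat q A $$ (i,i)) \<le> (\<Sum>i<n. \<Sum>j<n. (?X $$ (i,j))\<^sup>2) - real n"
    by simp
  also have "(\<Sum>i<n. \<Sum>j<n. (?X $$ (i,j))\<^sup>2) = (\<Sum>j<n. \<Sum>i<n. (poly_app p F (u (e j)) (e i))\<^sup>2)"
    by (subst sum.swap) (simp add: Xij)
  also have "\<dots> = (\<Sum>j\<in>I. \<Sum>i\<in>I. (poly_app p F (u j) i)\<^sup>2)"
    by (simp add: sumI)
  finally have main: "2 * (\<Sum>i\<in>I. poly_app q F (unit_at i) i) \<le>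
      (\<Sum>j\<in>I. \<Sum>i\<in>I. (poly_app p F (u j) i)\<^sup>2) - real (card I)"
    by (simp add: tr n_def)
  show ?thesis
  proof (rule that)
    show "e ` J \<subseteq> I" using Jn eI by auto
    show "real (card (e ` J)) \<le> (\<Sum>i\<in>I. poly_app r F (unit_at i) i)"
      if r: "\<And>x. 0 \<le> x \<Longrightarrow> x \<le> C \<Longrightarrow> 0 \<le> poly r x" "1 \<le> poly r 0" for r
    proof -
      \<comment> \<open>On \<open>[0, C]\<close> the polynomial \<open>r\<close> majorises the
        indicator of 0, so its trace counts every zero eigenvalue.\<close>
      have "real (length (filter (\<lambda>e. e = 0) es)) \<le> (\<Sum>e\<leftarrow>es. poly r e)"
        using es(2)
      proof (induction es)
        case (Cons x es)
        have "(if x = 0 then 1 else 0) \<le> poly r x" using r Cons.prems[of x] by auto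
        then show ?case using Cons by auto
      qed simp
      moreover have "card (e ` J) \<le> card J" by (rule card_image_le[OF finJ])
      ultimately show ?thesis using cardJ by (simp add: tr es(4))
    qed
    show "2 * (\<Sum>i\<in>I. poly_app q F (unit_at i) i) \<le>
      (\<Sum>j\<in>I. \<Sum>i\<in>I. (poly_app p F (if j \<in> T
        then (\<lambda>i. y j i - (F (h (b' j) j) i + (if i \<in> e ` J then h (b' j) j i else 0)))
        else (\<lambda>i. F (unit_at j) i + (if i \<in> e ` J then unit_at j i else 0))) i)\<^sup>2) - real (card I)"
      using main unfolding u_def .
  qed
qed

no_notation vec_index (infixl "$" 100)
hide_const (open) Module.smult Matrix.mat

section \<open>Functional calculus of self-adjoint operators\<close>

text \<open>For suitable \<open>s\<close> the map \<open>x - s (T x - y)\<close> is a contraction;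
  its fixed point solves \<open>T x = y\<close>.\<close>

lemma coercive_invertible:
  fixes T :: "'h::{real_inner,banach} \<Rightarrow>\<^sub>L 'h"
  assumes m: "m > 0" and co: "\<And>x. m * (norm x)\<^sup>2 \<le> inner (T x) x"
  shows "\<exists>S. S o\<^sub>L T = id_blinfun \<and> T o\<^sub>L S = id_blinfun"
proof -
  have below: "m * norm x \<le> norm (T x)" for x
  proof (cases "x = 0")
    case False
    have "(m * norm x) * norm x \<le> norm (T x) * norm x"
      using order_trans[OF co[of x] norm_cauchy_schwarz[of "T x" x]] by (simp add: power2_eq_square)
    then show ?thesis using False by simp
  qed simp
  define L where "L = norm T + m"
  have L: "L > 0" "norm T \<le> L" "m \<le> L" using m by (auto simp: L_def add_nonneg_pos)
  \<comment> \<open>This \<open>s\<close> minimises \<open>1 - 2 s m + s^2 L^2\<close>, leaving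
    \<open>1 - m^2 / L^2\<close>. The summand \<open>m\<close> in \<open>L\<close> gives
    \<open>m \<le> L\<close>, so that the square root \<open>c\<close> is that of a nonnegative
    number.\<close>
  define s where "s = m / L\<^sup>2"
  define c where "c = sqrt (1 - m\<^sup>2 / L\<^sup>2)"
  have s: "s > 0" using m L by (simp add: s_def)
  have mL: "m\<^sup>2 / L\<^sup>2 \<le> 1" using m L by (simp add: power_mono)
  have c: "0 \<le> c" "c < 1" using m L mL by (auto simp: c_def)
  have contr: "norm (x - s *\<^sub>R T x) \<le> c * norm x" for x
  proof (rule power2_le_imp_le)
    have "norm (T x) \<le> L * norm x"
      by (rule order_trans[OF norm_blinfun mult_right_mono[OF L(2)]]) simp
    then have "(norm (T x))\<^sup>2 \<le> L\<^sup>2 * (norm x)\<^sup>2"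
      by (metis norm_ge_zero power_mono power_mult_distrib)
    then have 1: "s\<^sup>2 * (norm (T x))\<^sup>2 \<le> s\<^sup>2 * (L\<^sup>2 * (norm x)\<^sup>2)"
      by (intro mult_left_mono) auto
    have "(norm (x - s *\<^sub>R T x))\<^sup>2 = (norm x)\<^sup>2 - 2 * s * inner (T x) x + s\<^sup>2 * (norm (T x))\<^sup>2"
      unfolding power2_norm_eq_inner
      by (simp add: inner_diff_left inner_diff_right inner_commute[of x "T x"] power2_eq_square algebra_simps)
    also have "\<dots> \<le> (norm x)\<^sup>2 - 2 * s * (m * (norm x)\<^sup>2) + s\<^sup>2 * (L\<^sup>2 * (norm x)\<^sup>2)"
      using 1 mult_left_mono[OF co[of x], of "2 * s"] s by linarith
    also have "\<dots> = (1 - m\<^sup>2 / L\<^sup>2) * (norm x)\<^sup>2"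
      using L(1) by (simp add: s_def field_simps power2_eq_square)
    also have "\<dots> = (c * norm x)\<^sup>2"
      using mL by (simp add: c_def power_mult_distrib)
    finally show "(norm (x - s *\<^sub>R T x))\<^sup>2 \<le> (c * norm x)\<^sup>2" .
  qed (use c in simp)
  have surj: "\<exists>x. T x = y" for y
  proof -
    have "\<forall>x z. dist (x - s *\<^sub>R (T x - y)) (z - s *\<^sub>R (T z - y)) \<le> c * dist x z"
      using contr[of "_ - _"] by (simp add: dist_norm blinfun.diff_right algebra_simps)
    then have "\<exists>!x. x - s *\<^sub>R (T x - y) = x"
      by (rule banach_fix_type[OF c])
    then show ?thesis using s by auto
  qed
  have inj: "x = z" if "T x = T z" for x z
    using below[of "x - z"] that m by (simp add: blinfun.diff_right mult_le_0_iff)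
  define g where "g y = (SOME x. T x = y)" for y
  have Tg: "T (g y) = y" for y unfolding g_def by (rule someI_ex[OF surj])
  have gT: "g (T x) = x" for x by (rule inj) (rule Tg)
  have "bounded_linear g"
  proof (rule bounded_linear_intro[where K = "1 / m"])
    show "g (x + y) = g x + g y" for x y by (rule inj) (simp add: Tg blinfun.add_right)
    show "g (r *\<^sub>R x) = r *\<^sub>R g x" for r x by (rule inj) (simp add: Tg blinfun.scaleR_right)
    show "norm (g x) \<le> norm x * (1 / m)" for x
      using below[of "g x"] m by (simp add: Tg field_simps)
  qed
  then have "Blinfun g o\<^sub>L T = id_blinfun \<and> T o\<^sub>L Blinfun g = id_blinfun"
    by (auto intro!: blinfun_eqI simp: bounded_linear_Blinfun_apply Tg gT)
  then show ?thesis by blast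
qed

text \<open>\<open>coercive_invertible\<close> produces a real-linear inverse, whereas
  \<open>spectrum\<close> asks for one in \<open>bounded_operators\<close>.\<close>

lemma inverse_complex_linear:
  fixes T S :: "'h::complex_hilbert_space \<Rightarrow>\<^sub>L 'h"
  assumes T: "T \<in> bounded_operators" and ST: "S o\<^sub>L T = id_blinfun" and TS: "T o\<^sub>L S = id_blinfun"
  shows "S \<in> bounded_operators"
  unfolding bounded_operators_def
proof safe
  fix c x
  have TSx: "T (S y) = y" for y using TS by (metis blinfun_apply_blinfun_compose id_blinfun.rep_eq)
  have STx: "S (T y) = y" for y using ST by (metis blinfun_apply_blinfun_compose id_blinfun.rep_eq)
  have "T (c *\<^sub>C S x) = c *\<^sub>C x" using T TSx by (simp add: bounded_operators_def)
  then show "S (c *\<^sub>C x) = c *\<^sub>C S x" using STx by metis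
qed

section \<open>Polynomials of an operator\<close>

lemma poly_op_eq_sum:
  assumes "degree p \<le> n"
  shows "poly_op p T = (\<Sum>k\<le>n. coeff p k *\<^sub>R (((o\<^sub>L) T ^^ k) id_blinfun))"
  unfolding poly_op_def
  by (rule sum.mono_neutral_left) (use assms in \<open>auto simp: coeff_eq_0 not_le\<close>)

lemma poly_op_0 [simp]: "poly_op 0 T = 0"
  by (simp add: poly_op_def)

lemma poly_op_pCons: "poly_op (pCons a p) T = a *\<^sub>R id_blinfun + (T o\<^sub>L poly_op p T)"
proof -
  have "poly_op (pCons a p) T =
      (\<Sum>k\<le>Suc (degree p). coeff (pCons a p) k *\<^sub>R (((o\<^sub>L) T ^^ k) id_blinfun))"
    by (rule poly_op_eq_sum) (rule degree_pCons_le)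
  also have "\<dots> = a *\<^sub>R id_blinfun + (\<Sum>k\<le>degree p. coeff p k *\<^sub>R (T o\<^sub>L (((o\<^sub>L) T ^^ k) id_blinfun)))"
    by (subst sum.atMost_Suc_shift) simp
  also have "(\<Sum>k\<le>degree p. coeff p k *\<^sub>R (T o\<^sub>L (((o\<^sub>L) T ^^ k) id_blinfun))) = T o\<^sub>L poly_op p T"
    unfolding poly_op_def
    by (simp add: bounded_bilinear.sum_right[OF bounded_bilinear_blinfun_compose]
        bounded_bilinear.scaleR_right[OF bounded_bilinear_blinfun_compose])
  finally show ?thesis .
qed

lemma poly_op_pCons_apply: "poly_op (pCons a p) T x = a *\<^sub>R x + T (poly_op p T x)"
  by (simp add: poly_op_pCons blinfun.add_left blinfun.scaleR_left)

lemma poly_op_add: "poly_op (p + q) T = poly_op p T + poly_op q T"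
proof -
  let ?n = "max (degree p) (degree q)"
  show ?thesis
    unfolding poly_op_eq_sum[OF degree_add_le_max] poly_op_eq_sum[OF max.cobounded1[of "degree p" "degree q"]]
      poly_op_eq_sum[OF max.cobounded2[of "degree q" "degree p"]]
    by (simp add: scaleR_add_left sum.distrib)
qed

lemma poly_op_smult: "poly_op (smult c p) T = c *\<^sub>R poly_op p T"
  unfolding poly_op_eq_sum[OF degree_smult_le] poly_op_def by (simp add: scaleR_sum_right)

lemma poly_op_diff: "poly_op (p - q) T = poly_op p T - poly_op q T"
proof -
  have "p - q = p + smult (-1) q" by simp
  then show ?thesis by (simp only: poly_op_add poly_op_smult) simp
qed

lemma poly_op_mult: "poly_op (p * q) T = poly_op p T o\<^sub>L poly_op q T"
proof (induction p)
  case (pCons a p)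
  show ?case
    by (rule blinfun_eqI)
      (simp add: poly_op_add poly_op_smult poly_op_pCons pCons.IH blinfun.add_left blinfun.scaleR_left)
qed simp

lemma poly_op_pcompose: "poly_op (pcompose r p) T = poly_op r (poly_op p T)"
proof (induction r)
  case (pCons a r)
  show ?case
    by (rule blinfun_eqI)
      (simp add: pcompose_pCons poly_op_add poly_op_mult poly_op_pCons pCons.IH
        blinfun.add_left blinfun.scaleR_left)
qed simp

lemma poly_op_commute: "T (poly_op p T x) = poly_op p T (T x)"
  by (induction p) (simp_all add: poly_op_pCons_apply blinfun.add_right blinfun.scaleR_right)

lemma scaleC_0 [simp]: "c *\<^sub>C (0::'h::complex_hilbert_space) = 0"
  using scaleC_add_right[of c 0 "0::'h"] by simp

lemma scaleC_zero [simp]: "0 *\<^sub>C (x::'h::complex_hilbert_space) = 0"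
  using scaleC_add_left[of 0 0 x] by simp

lemma scaleC_one [simp]: "1 *\<^sub>C (x::'h::complex_hilbert_space) = x"
  using scaleC_of_real[of 1 x] by simp

lemma bounded_operators_scaleC: "T \<in> bounded_operators \<Longrightarrow> T (c *\<^sub>C x) = c *\<^sub>C T x"
  by (simp add: bounded_operators_def)

lemma bounded_operators_poly_op:
  assumes "T \<in> bounded_operators"
  shows "poly_op p T \<in> bounded_operators"
proof (induction p)
  case (pCons a p)
  then show ?case
    using assms unfolding bounded_operators_def
    by (auto simp: poly_op_pCons_apply scaleC_add_right scaleC_scaleC mult.commute
        simp flip: scaleC_of_real)
qed (simp add: bounded_operators_def)

lemma cinner_add_right: "cinner x (y + z) = cinner x y + cinner x (z::'h::complex_hilbert_space)"
  by (metis cinner_add_left cinner_commute complex_cnj_add)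

lemma cinner_scaleC_right: "cinner x (c *\<^sub>C y) = cnj c * cinner x (y::'h::complex_hilbert_space)"
  by (metis cinner_scaleC_left cinner_commute complex_cnj_mult complex_cnj_cnj)

lemma cinner_scaleR_left: "cinner (r *\<^sub>R x) y = complex_of_real r * cinner x (y::'h::complex_hilbert_space)"
  by (metis cinner_scaleC_left scaleC_of_real)

lemma cinner_scaleR_right: "cinner x (r *\<^sub>R y) = complex_of_real r * cinner x (y::'h::complex_hilbert_space)"
  by (metis cinner_scaleC_right scaleC_of_real complex_cnj_complex_of_real)

lemma abs_Im_cinner_le: "\<bar>Im (cinner x y)\<bar> \<le> norm x * norm (y::'h::complex_hilbert_space)"
proof -
  have "Im (cinner x y) = inner ((- \<i>) *\<^sub>C x) y"
    by (simp add: cinner_scaleC_left flip: Re_cinner)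
  also have "\<bar>\<dots>\<bar> \<le> norm ((- \<i>) *\<^sub>C x) * norm y" by (rule Cauchy_Schwarz_ineq2)
  finally show ?thesis by (simp add: norm_scaleC)
qed

section \<open>Self-adjoint operators and the norms of their polynomials\<close>

definition self_adjoint_between :: "real \<Rightarrow> real \<Rightarrow> ('h::complex_hilbert_space \<Rightarrow>\<^sub>L 'h) \<Rightarrow> bool" where
  "self_adjoint_between m M T \<longleftrightarrow> T \<in> bounded_operators \<and> (\<forall>x y. cinner (T x) y = cinner x (T y)) \<and>
     (\<forall>x. m * (norm x)\<^sup>2 \<le> inner (T x) x \<and> inner (T x) x \<le> M * (norm x)\<^sup>2)"

lemma self_adjoint_poly_op:
  assumes "self_adjoint_between m M T"
  shows "cinner (poly_op p T x) y = cinner x (poly_op p T y)"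
proof (induction p arbitrary: x y)
  case (pCons a p)
  have "cinner (T (poly_op p T x)) y = cinner (poly_op p T x) (T y)"
    using assms by (simp add: self_adjoint_between_def)
  then show ?case
    by (simp add: poly_op_pCons_apply cinner_add_left cinner_add_right cinner_scaleR_left
        cinner_scaleR_right pCons.IH poly_op_commute)
next
  case 0
  have "cinner 0 y = 0" "cinner x 0 = 0" for x y :: 'a
    using cinner_add_left[of 0 0 y] cinner_add_right[of x 0 0] by simp_all
  then show ?case by simp
qed

text \<open>For \<open>t\<close> outside \<open>[m, M]\<close> either \<open>T - t\<close> or
  \<open>t - T\<close> is coercive, hence invertible.\<close>

lemma real_spectrum_between:
  assumes T: "self_adjoint_between m M T" and t: "complex_of_real t \<in> spectrum T"
  shows "m \<le> t \<and> t \<le> M"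
proof (rule ccontr)
  assume "\<not> (m \<le> t \<and> t \<le> M)"
  define D where "D = T - scalar_op (complex_of_real t)"
  have D: "D x = T x - t *\<^sub>R x" for x
    by (simp add: D_def blinfun.diff_left scalar_op.rep_eq scaleC_of_real)
  have bo: "D \<in> bounded_operators"
    using T bounded_linear_scaleC unfolding self_adjoint_between_def bounded_operators_def
    by (auto simp: D scaleC_of_real[symmetric] scaleC_scaleC mult.commute
        bounded_linear.linear linear_diff[OF bounded_linear.linear[OF bounded_linear_scaleC]])
  have q: "inner (D x) x = inner (T x) x - t * (norm x)\<^sup>2" for x
    by (simp add: D inner_diff_left power2_norm_eq_inner)
  consider "t < m" | "M < t" using \<open>\<not> (m \<le> t \<and> t \<le> M)\<close> by linarith
  then obtain S where "S o\<^sub>L D = id_blinfun" "D o\<^sub>L S = id_blinfun"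
  proof cases
    case 1
    have "(m - t) * (norm x)\<^sup>2 \<le> inner (D x) x" for x
      using T unfolding q self_adjoint_between_def by (simp add: left_diff_distrib)
    from coercive_invertible[OF _ this] 1 show ?thesis using that by auto
  next
    case 2
    have "(t - M) * (norm x)\<^sup>2 \<le> inner ((- D) x) x" for x
      using T q[of x] unfolding self_adjoint_between_def uminus_blinfun.rep_eq inner_minus_left
      by (simp add: left_diff_distrib)
    from coercive_invertible[OF _ this] 2 obtain S
      where "S o\<^sub>L (- D) = id_blinfun" "(- D) o\<^sub>L S = id_blinfun" by auto
    then have "(S o\<^sub>L (- D)) x = x" "((- D) o\<^sub>L S) x = x" for x by simp_all
    then have "S (- D x) = x" "- D (S x) = x" for x by (simp_all add: uminus_blinfun.rep_eq)
    then have "(- S) o\<^sub>L D = id_blinfun" "D o\<^sub>L (- S) = id_blinfun"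
      by (auto intro!: blinfun_eqI simp: uminus_blinfun.rep_eq blinfun.minus_right)
    then show ?thesis using that by blast
  qed
  then show False
    using t inverse_complex_linear[OF bo] unfolding spectrum_def D_def by blast
qed

text \<open>Complex coefficients are allowed because a real polynomial splits into linear factors
  only over the complex numbers.\<close>

definition cpoly_app :: "complex poly \<Rightarrow> ('h::complex_hilbert_space \<Rightarrow>\<^sub>L 'h) \<Rightarrow> 'h \<Rightarrow> 'h" where
  "cpoly_app P T x = fold_coeffs (\<lambda>a y. a *\<^sub>C x + T y) P 0"

lemma cpoly_app_0 [simp]: "cpoly_app 0 T x = 0"
  by (simp add: cpoly_app_def)

lemma cpoly_app_pCons: "cpoly_app (pCons a P) T x = a *\<^sub>C x + T (cpoly_app P T x)"
  by (cases "a = 0 \<and> P = 0") (auto simp: cpoly_app_def)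

lemma cpoly_app_of_real: "cpoly_app (map_poly complex_of_real p) T x = poly_op p T x"
  by (induction p) (simp_all add: map_poly_pCons cpoly_app_pCons poly_op_pCons_apply scaleC_of_real)

lemma cpoly_app_add: "cpoly_app (P + Q) T x = cpoly_app P T x + cpoly_app Q T x"
  by (induction P Q rule: poly_induct2)
    (simp_all add: cpoly_app_pCons scaleC_add_left blinfun.add_right algebra_simps)

lemma cpoly_app_smult:
  assumes "T \<in> bounded_operators"
  shows "cpoly_app (smult c P) T x = c *\<^sub>C cpoly_app P T x"
  by (induction P)
    (simp_all add: cpoly_app_pCons scaleC_add_right scaleC_scaleC bounded_operators_scaleC[OF assms])

definition bounded_below :: "('h::real_normed_vector \<Rightarrow> 'h) \<Rightarrow> bool" where
  "bounded_below f \<longleftrightarrow> (\<exists>d>0. \<forall>x. d * norm x \<le> norm (f x))"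

text \<open>A composition of maps that are bounded below is bounded below. Splitting off the roots
  one by one, some factor \<open>T - z\<close> must therefore fail to be.\<close>

lemma root_not_bounded_below:
  fixes T :: "'h::complex_hilbert_space \<Rightarrow>\<^sub>L 'h"
  assumes T: "T \<in> bounded_operators"
  shows "P \<noteq> 0 \<Longrightarrow> \<not> bounded_below (cpoly_app P T) \<Longrightarrow>
    \<exists>z. poly P z = 0 \<and> \<not> bounded_below (\<lambda>x. T x - z *\<^sub>C x)"
proof (induction "degree P" arbitrary: P)
  case 0
  then obtain c where c: "P = [:c:]" "c \<noteq> 0" by (metis degree_eq_zeroE pCons_0_0)
  have "bounded_below (cpoly_app P T)"
    unfolding bounded_below_def
    by (rule exI[of _ "cmod c"]) (use c in \<open>simp add: cpoly_app_pCons norm_scaleC\<close>)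
  then show ?case using 0 by simp
next
  case (Suc n)
  then have "\<not> constant (poly P)" by (simp add: constant_degree)
  then obtain z where z: "poly P z = 0" using fundamental_theorem_of_algebra by blast
  then obtain Q where Q: "P = [:- z, 1:] * Q" by (metis dvdE poly_eq_0_iff_dvd)
  have "Q \<noteq> 0" using Q Suc.prems by auto
  have deg: "n = degree Q" using Suc.hyps(2) \<open>Q \<noteq> 0\<close> unfolding Q by (subst (asm) degree_mult_eq) auto
  have app: "cpoly_app P T x = T (cpoly_app Q T x) - z *\<^sub>C cpoly_app Q T x" for x
  proof -
    have "cpoly_app P T x = (- z) *\<^sub>C cpoly_app Q T x + T (cpoly_app Q T x)"
      unfolding Q by (simp add: cpoly_app_add cpoly_app_smult[OF T] cpoly_app_pCons del: smult_minus_left)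
    moreover have "(- z) *\<^sub>C y = - (z *\<^sub>C y)" for y :: 'h
      using scaleC_add_left[of "- z" z y] by (simp add: eq_neg_iff_add_eq_0)
    ultimately show ?thesis by simp
  qed
  show ?case
  proof (cases "bounded_below (\<lambda>x. T x - z *\<^sub>C x)")
    case True
    then obtain d where d: "d > 0" "\<And>x. d * norm x \<le> norm (T x - z *\<^sub>C x)"
      by (auto simp: bounded_below_def)
    have "\<not> bounded_below (cpoly_app Q T)"
    proof
      assume "bounded_below (cpoly_app Q T)"
      then obtain d' where d': "d' > 0" "\<And>x. d' * norm x \<le> norm (cpoly_app Q T x)"
        by (auto simp: bounded_below_def)
      have "(d * d') * norm x \<le> norm (cpoly_app P T x)" for x
        unfolding app mult.assoc using d(1)
        by (intro order_trans[OF mult_left_mono[OF d'(2)] d(2)]) simp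
      then have "bounded_below (cpoly_app P T)"
        unfolding bounded_below_def using d(1) d'(1) by (intro exI[of _ "d * d'"]) auto
      then show False using Suc.prems by simp
    qed
    from Suc.hyps(1)[OF deg \<open>Q \<noteq> 0\<close> this] show ?thesis unfolding Q by auto
  next
    case False
    then show ?thesis using z by blast
  qed
qed

lemma not_bounded_below_in_spectrum:
  fixes T :: "'h::complex_hilbert_space \<Rightarrow>\<^sub>L 'h"
  assumes nb: "\<not> bounded_below (\<lambda>x. T x - z *\<^sub>C x)"
  shows "z \<in> spectrum T"
proof (rule ccontr)
  assume "z \<notin> spectrum T"
  then obtain S where S: "S o\<^sub>L (T - scalar_op z) = id_blinfun" by (auto simp: spectrum_def)
  have 1: "S (T x - z *\<^sub>C x) = x" for x
    using arg_cong[OF S, of "\<lambda>U. blinfun_apply U x"] by (simp add: blinfun.diff_left scalar_op.rep_eq)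
  have "norm x \<le> (norm S + 1) * norm (T x - z *\<^sub>C x)" for x
    using norm_blinfun[of S "T x - z *\<^sub>C x"] unfolding 1 by (simp add: algebra_simps) (smt (verit) norm_ge_zero)
  then have "bounded_below (\<lambda>x. T x - z *\<^sub>C x)"
    unfolding bounded_below_def
    by (intro exI[of _ "1 / (norm S + 1)"]) (auto simp: field_simps add_pos_nonneg)
  then show False using nb by simp
qed

text \<open>By self-adjointness, pairing \<open>(T - z) x\<close> with \<open>x\<close> has
  imaginary part \<open>- Im z * (norm x)^2\<close>; Cauchy-Schwarz turns this into a lower bound
  whenever \<open>Im z\<close> is nonzero.\<close>

lemma not_bounded_below_real:
  fixes T :: "'h::complex_hilbert_space \<Rightarrow>\<^sub>L 'h"
  assumes T: "self_adjoint_between m M T" and nb: "\<not> bounded_below (\<lambda>x. T x - z *\<^sub>C x)"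
  shows "Im z = 0"
proof (rule ccontr)
  assume z: "Im z \<noteq> 0"
  have "\<bar>Im z\<bar> * norm x \<le> norm (T x - z *\<^sub>C x)" for x
  proof (cases "x = 0")
    case False
    have "cinner (T x) x = cnj (cinner (T x) x)"
      using T cinner_commute[of "T x" x] by (simp add: self_adjoint_between_def)
    then have r: "Im (cinner (T x) x) = 0" by (simp add: complex_eq_iff)
    have xx: "Im (cinner x x) = 0" using cinner_commute[of x x] by (simp add: complex_eq_iff)
    have "cinner (T x - z *\<^sub>C x) x = cinner (T x) x - z * cinner x x"
      using cinner_add_left[of "T x - z *\<^sub>C x" "z *\<^sub>C x" x] by (simp add: cinner_scaleC_left)
    then have "Im (cinner (T x - z *\<^sub>C x) x) = - Im z * (norm x)\<^sup>2"
      using r xx by (simp add: Re_cinner power2_norm_eq_inner)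
    then have "\<bar>Im z\<bar> * (norm x)\<^sup>2 \<le> norm (T x - z *\<^sub>C x) * norm x"
      using abs_Im_cinner_le[of "T x - z *\<^sub>C x" x] by (simp add: abs_mult)
    then show ?thesis using False by (simp add: power2_eq_square)
  qed simp
  then have "bounded_below (\<lambda>x. T x - z *\<^sub>C x)"
    unfolding bounded_below_def using z by (intro exI[of _ "\<bar>Im z\<bar>"]) auto
  then show False using nb by simp
qed

text \<open>With \<open>N = norm U\<close>, the square of \<open>norm (U (U x) - N^2 x)\<close> is
  at most \<open>N^2 * (N^2 * (norm x)^2 - (norm (U x))^2)\<close>, and this is small where
  \<open>U\<close> nearly attains its norm.\<close>

lemma not_bounded_below_norm_square:
  fixes U :: "'h::complex_hilbert_space \<Rightarrow>\<^sub>L 'h"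
  assumes U: "\<And>x y. cinner (U x) y = cinner x (U y)" and pos: "norm U > 0"
  shows "\<not> bounded_below (\<lambda>x. U (U x) - (norm U)\<^sup>2 *\<^sub>R x)"
proof
  define N where "N = norm U"
  have N: "N > 0" using pos by (simp add: N_def)
  have le: "norm (U x) \<le> N * norm x" for x unfolding N_def by (rule norm_blinfun)
  assume "bounded_below (\<lambda>x. U (U x) - (norm U)\<^sup>2 *\<^sub>R x)"
  then obtain d where d: "d > 0" "\<And>x. d * norm x \<le> norm (U (U x) - N\<^sup>2 *\<^sub>R x)"
    by (auto simp: bounded_below_def N_def)
  \<comment> \<open>Any \<open>x\<close> with \<open>norm (U x) > r * norm x\<close> violates the
    lower bound \<open>d\<close>; \<open>max\<close> covers the case of large
    \<open>d\<close>.\<close>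
  define r where "r = sqrt (max 0 (N\<^sup>2 - d\<^sup>2 / N\<^sup>2))"
  have r: "0 \<le> r" "r < N"
    using N d(1) by (auto simp: r_def intro!: real_less_lsqrt simp: power2_eq_square)
  have rr: "r\<^sup>2 \<ge> N\<^sup>2 - d\<^sup>2 / N\<^sup>2" by (simp add: r_def)
  obtain x where x: "norm (U x) > r * norm x"
  proof (rule ccontr)
    assume "\<not> thesis"
    then have "norm (U x) \<le> r * norm x" for x using that by (meson not_le)
    then have "N \<le> r" unfolding N_def by (rule norm_blinfun_bound[OF r(1)])
    then show False using r by simp
  qed
  have x2: "r\<^sup>2 * (norm x)\<^sup>2 < (norm (U x))\<^sup>2"
    unfolding power_mult_distrib[symmetric] by (rule power_strict_mono[OF x]) (use r in auto)
  have ip: "inner (U (U x)) x = (norm (U x))\<^sup>2"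
    unfolding power2_norm_eq_inner Re_cinner[symmetric] U ..
  have "(norm (U (U x)))\<^sup>2 \<le> (N * norm (U x))\<^sup>2" by (rule power_mono[OF le]) simp
  moreover have "(norm (U (U x) - N\<^sup>2 *\<^sub>R x))\<^sup>2 =
      (norm (U (U x)))\<^sup>2 - 2 * N\<^sup>2 * inner (U (U x)) x + N\<^sup>2 * N\<^sup>2 * (norm x)\<^sup>2"
    unfolding power2_norm_eq_inner
    by (simp add: inner_diff_left inner_diff_right inner_commute[of x "U (U x)"] algebra_simps)
  ultimately have "(norm (U (U x) - N\<^sup>2 *\<^sub>R x))\<^sup>2 \<le>
      N\<^sup>2 * (norm (U x))\<^sup>2 - 2 * N\<^sup>2 * inner (U (U x)) x + N\<^sup>2 * N\<^sup>2 * (norm x)\<^sup>2"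
    by (simp add: power_mult_distrib)
  also have "\<dots> = N\<^sup>2 * (N\<^sup>2 * (norm x)\<^sup>2 - (norm (U x))\<^sup>2)"
    unfolding ip by (simp add: algebra_simps)
  also have "\<dots> < N\<^sup>2 * (N\<^sup>2 * (norm x)\<^sup>2 - r\<^sup>2 * (norm x)\<^sup>2)"
    using N x2 by simp
  also have "\<dots> \<le> N\<^sup>2 * ((d\<^sup>2 / N\<^sup>2) * (norm x)\<^sup>2)"
    unfolding left_diff_distrib[symmetric] using rr by (intro mult_left_mono mult_right_mono) auto
  also have "\<dots> = (d * norm x)\<^sup>2" using N by (simp add: power_mult_distrib)
  finally have "norm (U (U x) - N\<^sup>2 *\<^sub>R x) < d * norm x"
    by (rule power2_less_imp_less) (use d(1) in auto)
  then show False using d(2)[of x] by simp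
qed

lemma poly_map_poly_of_real:
  "poly (map_poly complex_of_real P) (complex_of_real t) = complex_of_real (poly P t)"
  by (induction P) (simp_all add: map_poly_pCons)

text \<open>
  For \<open>U = p(T)\<close> the operator \<open>U\<^sup>2 - (norm U)\<^sup>2\<close> is not bounded below; hence neither is some factor
  \<open>T - z\<close>, where \<open>z\<close> is a complex root of \<open>p\<^sup>2 - (norm U)\<^sup>2\<close>.
\<close>

lemma spectrum_attains_norm:
  fixes T :: "'h::complex_hilbert_space \<Rightarrow>\<^sub>L 'h"
  assumes T: "self_adjoint_between m M T" and pos: "norm (poly_op p T) > 0"
    and ne: "p * p \<noteq> [:(norm (poly_op p T))\<^sup>2:]"
  shows "\<exists>t. complex_of_real t \<in> spectrum T \<and> \<bar>poly p t\<bar> = norm (poly_op p T)"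
proof -
  let ?U = "poly_op p T"
  define P where "P = p * p - [:(norm ?U)\<^sup>2:]"
  have PU: "cpoly_app (map_poly complex_of_real P) T x = ?U (?U x) - (norm ?U)\<^sup>2 *\<^sub>R x" for x
    unfolding cpoly_app_of_real P_def
    by (simp only: poly_op_diff poly_op_mult) (simp add: blinfun.diff_left poly_op_pCons_apply)
  have "\<not> bounded_below (cpoly_app (map_poly complex_of_real P) T)"
    using not_bounded_below_norm_square[OF self_adjoint_poly_op[OF T] pos] unfolding PU[abs_def] .
  moreover have "map_poly complex_of_real P \<noteq> 0"
    using ne by (auto simp: P_def map_poly_eq_0_iff)
  ultimately obtain z where z: "poly (map_poly complex_of_real P) z = 0"
      "\<not> bounded_below (\<lambda>x. T x - z *\<^sub>C x)"
    using root_not_bounded_below[of T "map_poly complex_of_real P"] T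
    by (auto simp: self_adjoint_between_def)
  have "Im z = 0" by (rule not_bounded_below_real[OF T z(2)])
  then obtain t where t: "z = complex_of_real t" by (metis complex_of_real_def complex_surj)
  have "poly P t = 0" using z(1) unfolding t by (simp add: poly_map_poly_of_real)
  then have "(poly p t)\<^sup>2 = (norm ?U)\<^sup>2" by (simp add: P_def power2_eq_square)
  then have "\<bar>poly p t\<bar> = norm ?U" by (metis abs_norm_cancel power2_eq_iff abs_minus)
  then show ?thesis using not_bounded_below_in_spectrum[OF z(2)] unfolding t by blast
qed

lemma norm_poly_op_le:
  fixes T :: "'h::complex_hilbert_space \<Rightarrow>\<^sub>L 'h"
  assumes T: "self_adjoint_between m M T" and B: "B \<ge> 0"
    and le: "\<And>t. m \<le> t \<Longrightarrow> t \<le> M \<Longrightarrow> complex_of_real t \<in> spectrum T \<Longrightarrow> \<bar>poly p t\<bar> \<le> B"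
  shows "norm (poly_op p T) \<le> B"
proof (cases "norm (poly_op p T) = 0")
  case True
  then show ?thesis using B by simp
next
  case False
  then have pos: "norm (poly_op p T) > 0" by simp
  have "\<exists>t. complex_of_real t \<in> spectrum T \<and> \<bar>poly p t\<bar> = norm (poly_op p T)"
  \<comment> \<open>When \<open>p * p\<close> is this constant, there is no nonzero polynomial left
    to factor. But then \<open>\<bar>p\<bar>\<close> equals the norm everywhere and any point of the
    spectrum serves: one is obtained from the polynomial \<open>t\<close>, or it is 0 if
    \<open>T = 0\<close>.\<close>
  proof (cases "p * p = [:(norm (poly_op p T))\<^sup>2:]")
    case True
    have val: "\<bar>poly p t\<bar> = norm (poly_op p T)" for t
    proof -
      have "(poly p t)\<^sup>2 = (norm (poly_op p T))\<^sup>2"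
        using arg_cong[OF True, of "\<lambda>q. poly q t"] by (simp add: power2_eq_square)
      then show ?thesis by (metis abs_norm_cancel power2_eq_iff abs_minus)
    qed
    show ?thesis
    proof (cases "T = 0")
      case True
      have "\<not> bounded_below (\<lambda>x. T x - 0 *\<^sub>C x)"
      proof
        assume "bounded_below (\<lambda>x. T x - 0 *\<^sub>C x)"
        then have "x = 0" for x :: 'h using True by (auto simp: bounded_below_def mult_le_0_iff)
        then have "poly_op p T = 0" by (intro blinfun_eqI) metis
        then show False using pos by simp
      qed
      from not_bounded_below_in_spectrum[OF this] show ?thesis
        using val by (intro exI[of _ 0]) auto
    next
      case False
      have X: "poly_op [:0, 1:] T = T" by (rule blinfun_eqI) (simp add: poly_op_pCons_apply)
      have "\<exists>t. complex_of_real t \<in> spectrum T \<and> \<bar>poly [:0, 1:] t\<bar> = norm (poly_op [:0, 1:] T)"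
        by (rule spectrum_attains_norm[OF T]) (use False in \<open>auto simp: X\<close>)
      then show ?thesis using val by blast
    qed
  qed (rule spectrum_attains_norm[OF T pos])
  then show ?thesis using le real_spectrum_between[OF T] by metis
qed

section \<open>Continuous functional calculus, square root and logarithm\<close>

lemma real_polynomial_approx:
  fixes \<phi> :: "real \<Rightarrow> real"
  assumes "continuous_on {m..M} \<phi>" "e > 0"
  obtains p where "\<And>t. m \<le> t \<Longrightarrow> t \<le> M \<Longrightarrow> \<bar>poly p t - \<phi> t\<bar> < e"
proof -
  obtain g where g: "real_polynomial_function g" "\<And>x. x \<in> {m..M} \<Longrightarrow> \<bar>\<phi> x - g x\<bar> < e"
    using Stone_Weierstrass_real_polynomial_function[OF compact_Icc assms] by blast
  then obtain a n where an: "g = (\<lambda>x. \<Sum>i\<le>n. a i * x ^ i)"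
    by (auto simp: real_polynomial_function_iff_sum)
  have "poly (\<Sum>i\<le>n. monom (a i) i) t = g t" for t
    by (simp add: an poly_sum poly_monom)
  then show ?thesis using g(2) that[of "\<Sum>i\<le>n. monom (a i) i"] by (auto simp: abs_minus_commute)
qed

lemma uniform_polynomials:
  fixes \<phi> :: "real \<Rightarrow> real"
  assumes "continuous_on {m..M} \<phi>"
  obtains p where "uniform_limit {m..M} (\<lambda>k::nat. poly (p k)) \<phi> sequentially"
proof -
  have "\<exists>p. \<forall>t\<in>{m..M}. \<bar>poly p t - \<phi> t\<bar> < 1 / Suc k" for k
    using real_polynomial_approx[OF assms, of "1 / Suc k"] by (metis atLeastAtMost_iff of_nat_0_less_iff zero_less_Suc zero_less_divide_1_iff)
  then obtain p where p: "\<And>k t. t \<in> {m..M} \<Longrightarrow> \<bar>poly (p k) t - \<phi> t\<bar> < 1 / Suc k" by metis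
  have "uniform_limit {m..M} (\<lambda>k. poly (p k)) \<phi> sequentially"
  proof (rule uniform_limitI)
    fix e :: real assume "e > 0"
    then obtain N where N: "1 / Suc N < e" by (metis nat_approx_posE)
    have "dist (poly (p k) t) (\<phi> t) < e" if "k \<ge> N" "t \<in> {m..M}" for k t
    proof -
      have "1 / real (Suc k) \<le> 1 / Suc N" using that by (simp add: frac_le)
      then show ?thesis using p[OF that(2), of k] N by (simp add: dist_real_def)
    qed
    then show "\<forall>\<^sub>F k in sequentially. \<forall>t\<in>{m..M}. dist (poly (p k) t) (\<phi> t) < e"
      unfolding eventually_sequentially by blast
  qed
  then show ?thesis using that by blast
qed

text \<open>
  The definite description in \<open>func_calc\<close> is meaningful only if some sequence of polynomials converges
  to \<open>\<phi>\<close> on the spectrum and all such sequences yield the same limit.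
\<close>

lemma func_calc_tendsto:
  fixes T :: "'h::complex_hilbert_space \<Rightarrow>\<^sub>L 'h"
  assumes T: "self_adjoint_between m M T"
    and p: "uniform_limit {m..M} (\<lambda>k::nat. poly (p k)) \<phi> sequentially"
  shows "(\<lambda>k. poly_op (p k) T) \<longlonglongrightarrow> func_calc \<phi> T"
proof -
  let ?Sp = "{t. complex_of_real t \<in> spectrum T}"
  have sub: "?Sp \<subseteq> {m..M}" using real_spectrum_between[OF T] by auto
  have pS: "uniform_limit ?Sp (\<lambda>k. poly (p k)) \<phi> sequentially"
    using p sub by (rule uniform_limit_on_subset)
  \<comment> \<open>With \<open>r = p\<close> this is the Cauchy property; with general
    \<open>r\<close> it shows that the limit does not depend on the sequence.\<close>
  have close: "\<exists>N. \<forall>k\<ge>N. \<forall>l\<ge>N. norm (poly_op (r k) T - poly_op (p l) T) < e"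
    if r: "uniform_limit ?Sp (\<lambda>k::nat. poly (r k)) \<phi> sequentially" and e: "e > 0" for r e
  proof -
    obtain N1 where N1: "\<And>k t. k \<ge> N1 \<Longrightarrow> t \<in> ?Sp \<Longrightarrow> \<bar>poly (r k) t - \<phi> t\<bar> < e / 4"
      using uniform_limitD[OF r, of "e / 4"] e by (auto simp: eventually_sequentially dist_real_def)
    obtain N2 where N2: "\<And>k t. k \<ge> N2 \<Longrightarrow> t \<in> ?Sp \<Longrightarrow> \<bar>poly (p k) t - \<phi> t\<bar> < e / 4"
      using uniform_limitD[OF pS, of "e / 4"] e by (auto simp: eventually_sequentially dist_real_def)
    have "norm (poly_op (r k) T - poly_op (p l) T) < e" if "k \<ge> max N1 N2" "l \<ge> max N1 N2" for k l
    proof -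
      have "norm (poly_op (r k - p l) T) \<le> e / 2"
      proof (rule norm_poly_op_le[OF T])
        fix t assume "complex_of_real t \<in> spectrum T"
        then have "\<bar>poly (r k) t - \<phi> t\<bar> < e / 4" "\<bar>poly (p l) t - \<phi> t\<bar> < e / 4"
          using N1[of k t] N2[of l t] that by auto
        then show "\<bar>poly (r k - p l) t\<bar> \<le> e / 2"
          unfolding poly_diff by linarith
      qed (use e in simp)
      then show ?thesis using e by (simp add: poly_op_diff)
    qed
    then show ?thesis by blast
  qed
  have "Cauchy (\<lambda>k. poly_op (p k) T)"
    unfolding Cauchy_def dist_norm using close[OF pS] by blast
  then obtain S where S: "(\<lambda>k. poly_op (p k) T) \<longlonglongrightarrow> S"
    using Cauchy_convergent_iff convergent_def by blast
  have "func_calc \<phi> T = S"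
    unfolding func_calc_def
  proof (rule the_equality)
    show "\<forall>r. uniform_limit ?Sp (\<lambda>k. poly (r k)) \<phi> sequentially \<longrightarrow> (\<lambda>k. poly_op (r k) T) \<longlonglongrightarrow> S"
    proof (intro allI impI)
      fix r :: "nat \<Rightarrow> real poly" assume r: "uniform_limit ?Sp (\<lambda>k. poly (r k)) \<phi> sequentially"
      have "(\<lambda>k. poly_op (r k) T - poly_op (p k) T) \<longlonglongrightarrow> 0"
        unfolding LIMSEQ_iff diff_zero using close[OF r] by blast
      from tendsto_add[OF this S] show "(\<lambda>k. poly_op (r k) T) \<longlonglongrightarrow> S" by simp
    qed
    fix S' assume "\<forall>r. uniform_limit ?Sp (\<lambda>k. poly (r k)) \<phi> sequentially \<longrightarrow> (\<lambda>k. poly_op (r k) T) \<longlonglongrightarrow> S'"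
    then show "S' = S" using pS S LIMSEQ_unique by blast
  qed
  then show ?thesis using S by simp
qed

lemma bounded_operators_tendsto:
  assumes "\<And>k. X k \<in> bounded_operators" "X \<longlonglongrightarrow> S"
  shows "S \<in> bounded_operators"
  unfolding bounded_operators_def
proof safe
  fix c x
  have "(\<lambda>k. X k (c *\<^sub>C x)) \<longlonglongrightarrow> S (c *\<^sub>C x)" by (intro tendsto_intros assms)
  moreover have "(\<lambda>k. c *\<^sub>C X k x) \<longlonglongrightarrow> c *\<^sub>C S x"
    by (rule bounded_linear.tendsto[OF bounded_linear_scaleC]) (intro tendsto_intros assms)
  ultimately show "S (c *\<^sub>C x) = c *\<^sub>C S x"
    using assms(1) by (simp add: bounded_operators_def LIMSEQ_unique)
qed

lemma tendsto_cinner_left: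
  assumes "X \<longlonglongrightarrow> (x::'h::complex_hilbert_space)"
  shows "(\<lambda>k. cinner (X k) y) \<longlonglongrightarrow> cinner x y"
proof -
  have eq: "cinner z y = Complex (inner z y) (inner ((- \<i>) *\<^sub>C z) y)" for z
    by (rule complex_eqI) (simp_all add: cinner_scaleC_left flip: Re_cinner)
  show ?thesis
    unfolding eq
    by (intro tendsto_Complex tendsto_inner tendsto_const assms
        bounded_linear.tendsto[OF bounded_linear_scaleC])
qed

lemma tendsto_cinner_right:
  assumes "X \<longlonglongrightarrow> (x::'h::complex_hilbert_space)"
  shows "(\<lambda>k. cinner y (X k)) \<longlonglongrightarrow> cinner y x"
proof -
  have "(\<lambda>k. cnj (cinner (X k) y)) \<longlonglongrightarrow> cnj (cinner x y)"
    by (intro tendsto_cnj tendsto_cinner_left assms)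
  then show ?thesis by (simp flip: cinner_commute)
qed

lemma func_calc_sqrt:
  fixes T :: "'h::complex_hilbert_space \<Rightarrow>\<^sub>L 'h"
  assumes T: "self_adjoint_between c C T" and c: "0 < c" "c \<le> C"
  shows "self_adjoint_between (sqrt c) (sqrt C) (func_calc sqrt T)"
    and "func_calc sqrt T o\<^sub>L func_calc sqrt T = T"
proof -
  let ?R = "func_calc sqrt T"
  have "continuous_on {c..C} sqrt" by (intro continuous_intros)
  then obtain p where p: "uniform_limit {c..C} (\<lambda>k::nat. poly (p k)) sqrt sequentially"
    using uniform_polynomials by blast
  have R: "(\<lambda>k. poly_op (p k) T) \<longlonglongrightarrow> ?R" by (rule func_calc_tendsto[OF T p])
  have Rx: "(\<lambda>k. poly_op (p k) T x) \<longlonglongrightarrow> ?R x" for x by (intro tendsto_intros R)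
  have bo: "?R \<in> bounded_operators"
    by (rule bounded_operators_tendsto[OF _ R], rule bounded_operators_poly_op)
      (use T in \<open>simp add: self_adjoint_between_def\<close>)
  have sa: "cinner (?R x) y = cinner x (?R y)" for x y
    using tendsto_cinner_left[OF Rx, of x y] tendsto_cinner_right[OF Rx, of x y]
    by (simp add: self_adjoint_poly_op[OF T] LIMSEQ_unique)
  \<comment> \<open>\<open>a\<close> and \<open>b\<close> are midpoint and radius of
    \<open>[sqrt c, sqrt C]\<close>. Stated as the norm bound \<open>b\<close> for
    \<open>?R - a\<close>, the two-sided form bound passes from the polynomials to their
    limit.\<close>
  define a where "a = (sqrt c + sqrt C) / 2"
  define b where "b = (sqrt C - sqrt c) / 2"
  have b0: "b \<ge> 0" using c by (simp add: b_def)
  have nb: "norm (?R - a *\<^sub>R id_blinfun) \<le> b"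
  proof (rule field_le_epsilon)
    fix e :: real assume e: "e > 0"
    have lim: "(\<lambda>k. norm (poly_op (p k) T - a *\<^sub>R id_blinfun)) \<longlonglongrightarrow> norm (?R - a *\<^sub>R id_blinfun)"
      by (intro tendsto_intros R)
    have "\<forall>\<^sub>F k in sequentially. norm (poly_op (p k) T - a *\<^sub>R id_blinfun) \<le> b + e"
      using uniform_limitD[OF p e]
    proof eventually_elim
      case (elim k)
      have "poly_op (p k) T - a *\<^sub>R id_blinfun = poly_op (p k - [:a:]) T"
        unfolding poly_op_diff by (simp add: poly_op_pCons)
      moreover have "norm (poly_op (p k - [:a:]) T) \<le> b + e"
      proof (rule norm_poly_op_le[OF T])
        fix t assume t: "c \<le> t" "t \<le> C"
        have "sqrt c \<le> sqrt t" "sqrt t \<le> sqrt C" using t by auto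
        then have "\<bar>sqrt t - a\<bar> \<le> b" unfolding a_def b_def by (simp add: abs_if field_simps)
        then show "\<bar>poly (p k - [:a:]) t\<bar> \<le> b + e"
          using elim t by (force simp: dist_real_def)
      qed (use b0 e in simp)
      ultimately show ?case by simp
    qed
    then show "norm (?R - a *\<^sub>R id_blinfun) \<le> b + e"
      by (intro tendsto_upperbound[OF lim]) auto
  qed
  have "\<bar>inner (?R x) x - a * (norm x)\<^sup>2\<bar> \<le> b * (norm x)\<^sup>2" for x
  proof -
    have "inner (?R x) x - a * (norm x)\<^sup>2 = inner ((?R - a *\<^sub>R id_blinfun) x) x"
      by (simp add: blinfun.diff_left blinfun.scaleR_left inner_diff_left power2_norm_eq_inner)
    also have "\<bar>\<dots>\<bar> \<le> norm ((?R - a *\<^sub>R id_blinfun) x) * norm x" by (rule Cauchy_Schwarz_ineq2)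
    also have "\<dots> \<le> (b * norm x) * norm x"
      by (intro mult_right_mono order_trans[OF norm_blinfun] nb) auto
    finally show ?thesis by (simp add: power2_eq_square mult.assoc)
  qed
  moreover have "a - b = sqrt c" "a + b = sqrt C" by (simp_all add: a_def b_def field_simps)
  ultimately have "sqrt c * (norm x)\<^sup>2 \<le> inner (?R x) x \<and> inner (?R x) x \<le> sqrt C * (norm x)\<^sup>2" for x
    by (simp add: abs_le_iff algebra_simps flip: \<open>a - b = sqrt c\<close> \<open>a + b = sqrt C\<close>)
  then show "self_adjoint_between (sqrt c) (sqrt C) ?R"
    unfolding self_adjoint_between_def using bo sa by blast
  have "(\<lambda>k. poly_op (p k) T o\<^sub>L poly_op (p k) T) \<longlonglongrightarrow> (?R o\<^sub>L ?R)"
    by (rule bounded_bilinear.tendsto[OF bounded_bilinear_blinfun_compose R R])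
  moreover have "(\<lambda>k. poly_op (p k) T o\<^sub>L poly_op (p k) T) \<longlonglongrightarrow> T"
  proof (rule LIMSEQ_I)
    fix e :: real assume e: "e > 0"
    \<comment> \<open>Chosen so that \<open>\<bar>u - sqrt t\<bar> * \<bar>u + sqrt t\<bar>\<close>
      is at most \<open>d * (2 * (sqrt C + 1)) \<le> e / 2\<close>.\<close>
    define d where "d = min 1 (e / (4 * (sqrt C + 1)))"
    have C0: "sqrt C \<ge> 0" using c by simp
    have d: "d > 0" "d \<le> 1" "d * (2 * (sqrt C + 1)) \<le> e / 2"
    proof -
      have "d \<le> e / (4 * (sqrt C + 1))" by (simp add: d_def)
      then show "d * (2 * (sqrt C + 1)) \<le> e / 2" using C0 by (simp add: field_simps)
    qed (use e C0 in \<open>auto simp: d_def add_nonneg_pos\<close>)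
    obtain N where "\<forall>k\<ge>N. \<forall>t\<in>{c..C}. \<bar>poly (p k) t - sqrt t\<bar> < d"
      using uniform_limitD[OF p d(1)] unfolding eventually_sequentially dist_real_def by blast
    then have N: "\<bar>poly (p k) t - sqrt t\<bar> < d" if "k \<ge> N" "c \<le> t" "t \<le> C" for k t
      using that by simp
    have "norm ((poly_op (p k) T o\<^sub>L poly_op (p k) T) - T) < e" if k: "k \<ge> N" for k
    proof -
      have X: "poly_op [:0, 1:] T = T" by (rule blinfun_eqI) (simp add: poly_op_pCons_apply)
      have "norm (poly_op (p k * p k - [:0, 1:]) T) \<le> e / 2"
      proof (rule norm_poly_op_le[OF T])
        fix t assume t: "c \<le> t" "t \<le> C"
        define u where "u = poly (p k) t"
        have u: "\<bar>u - sqrt t\<bar> \<le> d" using N[OF k t] by (simp add: u_def)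
        have st: "0 \<le> sqrt t" "sqrt t \<le> sqrt C" "t = sqrt t * sqrt t" using t c by auto
        have "\<bar>u * u - t\<bar> = \<bar>u - sqrt t\<bar> * \<bar>u + sqrt t\<bar>"
          unfolding abs_mult[symmetric] by (subst st(3)) (simp only: algebra_simps)
        also have "\<dots> \<le> d * (2 * (sqrt C + 1))"
        proof (rule mult_mono)
          have "\<bar>x + a\<bar> \<le> 2 * (b + 1)" if "\<bar>x - a\<bar> \<le> d" "0 \<le> a" "a \<le> b" for x a b
            using that d(2) by (simp add: abs_le_iff)
          from this[OF u st(1,2)] show "\<bar>u + sqrt t\<bar> \<le> 2 * (sqrt C + 1)" .
        qed (use u d(1) in auto)
        finally show "\<bar>poly (p k * p k - [:0, 1:]) t\<bar> \<le> e / 2"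
          using d(3) by (simp add: u_def)
      qed (use e in simp)
      then show ?thesis using e unfolding poly_op_diff poly_op_mult X by simp
    qed
    then show "\<exists>N. \<forall>k\<ge>N. norm ((poly_op (p k) T o\<^sub>L poly_op (p k) T) - T) < e" by blast
  qed
  ultimately show "?R o\<^sub>L ?R = T" by (rule LIMSEQ_unique)
qed

text \<open>The two nested calculi are compared as functions of the one operator
  \<open>func_calc sqrt T\<close>: on its spectrum \<open>q(T)\<close> becomes
  \<open>q(s^2)\<close>, and \<open>ln (s^2) = 2 ln s\<close>.\<close>

lemma norm_poly_op_diff_log_le:
  fixes T :: "'h::complex_hilbert_space \<Rightarrow>\<^sub>L 'h"
  assumes T: "self_adjoint_between c C T" and c: "0 < c" "c \<le> C"
    and q: "\<And>t. c \<le> t \<Longrightarrow> t \<le> C \<Longrightarrow> \<bar>poly q t - ln t\<bar> \<le> e" and e: "e \<ge> 0"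
  shows "norm (poly_op q T - 2 *\<^sub>R func_calc ln (func_calc sqrt T)) \<le> e"
proof -
  let ?R = "func_calc sqrt T"
  note R = func_calc_sqrt[OF T c]
  have cc: "0 < sqrt c" using c by simp
  have "continuous_on {sqrt c..sqrt C} ln" using cc by (intro continuous_intros) auto
  then obtain p where p: "uniform_limit {sqrt c..sqrt C} (\<lambda>k::nat. poly (p k)) ln sequentially"
    using uniform_polynomials by blast
  have L: "(\<lambda>k. poly_op (p k) ?R) \<longlonglongrightarrow> func_calc ln ?R" by (rule func_calc_tendsto[OF R(1) p])
  have qT: "poly_op q T = poly_op (pcompose q [:0, 0, 1:]) ?R"
  proof -
    have "poly_op [:0, 0, 1:] U = U o\<^sub>L U" for U :: "'h \<Rightarrow>\<^sub>L 'h"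
      by (rule blinfun_eqI) (simp add: poly_op_pCons_apply)
    from this[of ?R] have "poly_op [:0, 0, 1:] ?R = T" unfolding R(2) .
    then show ?thesis by (simp add: poly_op_pcompose)
  qed
  show ?thesis
  proof (rule field_le_epsilon)
    fix d :: real assume d: "d > 0"
    have lim: "(\<lambda>k. norm (poly_op q T - 2 *\<^sub>R poly_op (p k) ?R)) \<longlonglongrightarrow>
        norm (poly_op q T - 2 *\<^sub>R func_calc ln ?R)"
      by (intro tendsto_intros L)
    have "\<forall>\<^sub>F k in sequentially. norm (poly_op q T - 2 *\<^sub>R poly_op (p k) ?R) \<le> e + d"
      using uniform_limitD[OF p half_gt_zero[OF d]]
    proof eventually_elim
      case (elim k)
      have "poly_op q T - 2 *\<^sub>R poly_op (p k) ?R = poly_op (pcompose q [:0, 0, 1:] - smult 2 (p k)) ?R"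
        by (simp add: poly_op_diff poly_op_smult qT)
      moreover have "norm (poly_op (pcompose q [:0, 0, 1:] - smult 2 (p k)) ?R) \<le> e + d"
      proof (rule norm_poly_op_le[OF R(1)])
        fix s assume s: "sqrt c \<le> s" "s \<le> sqrt C"
        have s0: "s > 0" using s cc by linarith
        have "sqrt c * sqrt c \<le> s * s"
          by (rule mult_mono) (use s s0 cc in linarith)+
        moreover have "s * s \<le> sqrt C * sqrt C"
          by (rule mult_mono) (use s s0 cc in linarith)+
        ultimately have "c \<le> s * s" "s * s \<le> C" using c by simp_all
        then have "\<bar>poly q (s * s) - ln (s * s)\<bar> \<le> e" by (rule q)
        moreover have "ln (s * s) = 2 * ln s" using s0 by (simp add: ln_mult)
        moreover have "\<bar>poly (p k) s - ln s\<bar> < d / 2" using elim s by (auto simp: dist_real_def)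
        ultimately show "\<bar>poly (pcompose q [:0, 0, 1:] - smult 2 (p k)) s\<bar> \<le> e + d"
          by (simp add: poly_pcompose) (smt (verit) field_sum_of_halves)
      qed (use e d in simp)
      ultimately show ?case by simp
    qed
    then show "norm (poly_op q T - 2 *\<^sub>R func_calc ln ?R) \<le> e + d"
      by (intro tendsto_upperbound[OF lim]) auto
  qed
qed

section \<open>Group ring operators\<close>

lemma ell2_eqI: "(\<And>i. Rep_ell2 x i = Rep_ell2 y i) \<Longrightarrow> x = y"
  by (simp add: Rep_ell2_inject[symmetric] fun_eq_iff)

lemma Rep_ell2_sum: "Rep_ell2 (\<Sum>j\<in>A. x j) i = (\<Sum>j\<in>A. Rep_ell2 (x j) i)"
  by (induction A rule: infinite_finite_induct) (auto simp: zero_ell2.rep_eq plus_ell2.rep_eq)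

section \<open>Integral group ring elements as operators\<close>

definition int_op :: "('g::group_add \<Rightarrow>\<^sub>0 int) \<Rightarrow> 'g ell2 \<Rightarrow>\<^sub>L 'g ell2" where
  "int_op p = left_regular (Poly_Mapping.map of_int p)"

lemma lookup_map_of_int: "Poly_Mapping.lookup (Poly_Mapping.map of_int p) g = of_int (Poly_Mapping.lookup p g)"
  by (simp add: Poly_Mapping.map.rep_eq when_def)

lemma keys_map_of_int: "Poly_Mapping.keys (Poly_Mapping.map of_int p :: _ \<Rightarrow>\<^sub>0 complex) = Poly_Mapping.keys p"
  by (auto simp: in_keys_iff lookup_map_of_int)

lemma int_op_apply_superset:
  assumes "finite A" "Poly_Mapping.keys p \<subseteq> A"
  shows "int_op p x = (\<Sum>g\<in>A. complex_of_int (Poly_Mapping.lookup p g) *\<^sub>C translate g x)"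
proof -
  have "int_op p x = (\<Sum>g\<in>Poly_Mapping.keys p. complex_of_int (Poly_Mapping.lookup p g) *\<^sub>C translate g x)"
    unfolding int_op_def left_regular.rep_eq keys_map_of_int lookup_map_of_int ..
  also have "\<dots> = (\<Sum>g\<in>A. complex_of_int (Poly_Mapping.lookup p g) *\<^sub>C translate g x)"
    by (rule sum.mono_neutral_left) (use assms in \<open>auto simp: in_keys_iff\<close>)
  finally show ?thesis .
qed

lemma int_op_coord: "Rep_ell2 (int_op p x) h =
    (\<Sum>g\<in>Poly_Mapping.keys p. complex_of_int (Poly_Mapping.lookup p g) * Rep_ell2 x (- g + h))"
  by (simp add: int_op_apply_superset[OF finite_keys order_refl] Rep_ell2_sum scaleC_ell2.rep_eq translate.rep_eq)

lemma integral_op_apply: "integral_op f x = (\<chi> k. \<Sum>l\<in>UNIV. int_op (f $ k $ l) (x $ l))"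
  by (simp add: integral_op_def op_of_matrix_apply int_op_def)

lemma integral_op_coord: "Rep_ell2 (integral_op f x $ k) h =
    (\<Sum>l\<in>UNIV. \<Sum>g\<in>Poly_Mapping.keys (f $ k $ l).
      complex_of_int (Poly_Mapping.lookup (f $ k $ l) g) * Rep_ell2 (x $ l) (- g + h))"
  by (simp add: integral_op_apply Rep_ell2_sum int_op_coord)

lemma vec_ell2_eqI:
  fixes x y :: "('g ell2)^'n"
  shows "(\<And>k h. Rep_ell2 (x $ k) h = Rep_ell2 (y $ k) h) \<Longrightarrow> x = y"
  by (auto simp: Finite_Cartesian_Product.vec_eq_iff intro!: ell2_eqI)

lemma integral_op_bounded: "integral_op f \<in> bounded_operators"
  unfolding bounded_operators_def
proof safe
  fix c x
  show "integral_op f (c *\<^sub>C x) = c *\<^sub>C integral_op f x"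
    by (rule vec_ell2_eqI)
      (simp add: integral_op_coord scaleC_vec_def scaleC_ell2.rep_eq sum_distrib_left mult.left_commute)
qed

lemma int_op_add: "int_op (p + q) = int_op p + int_op q"
proof (rule blinfun_eqI)
  fix x
  let ?A = "Poly_Mapping.keys p \<union> Poly_Mapping.keys q"
  have "Poly_Mapping.keys (p + q) \<subseteq> ?A" by (rule Poly_Mapping.keys_add)
  then show "int_op (p + q) x = (int_op p + int_op q) x"
    using int_op_apply_superset[of ?A p x] int_op_apply_superset[of ?A q x] int_op_apply_superset[of ?A "p + q" x]
    by (simp add: blinfun.add_left lookup_add scaleC_add_left sum.distrib)
qed

lemma int_op_0 [simp]: "int_op 0 = 0"
  by (rule blinfun_eqI) (simp add: int_op_apply_superset[of "{}"])

lemma int_op_sum: "int_op (\<Sum>i\<in>A. p i) = (\<Sum>i\<in>A. int_op (p i))"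
  by (induction A rule: infinite_finite_induct) (auto simp: int_op_add)

lemma translate_add: "translate g (translate h x) = translate (g + h) x"
  by (rule ell2_eqI) (simp add: translate.rep_eq minus_add add.assoc[symmetric])

lemma translate_0 [simp]: "translate 0 x = x"
  by (rule ell2_eqI) (simp add: translate.rep_eq)

lemma translate_scaleC: "translate g (c *\<^sub>C x) = c *\<^sub>C translate g x"
  by transfer simp

lemma int_op_single: "int_op (Poly_Mapping.single g c) x = complex_of_int c *\<^sub>C translate g x"
  by (simp add: int_op_apply_superset[of "{g}"])

lemma poly_mapping_eq_sum_single:
  "p = (\<Sum>g\<in>Poly_Mapping.keys p. Poly_Mapping.single g (Poly_Mapping.lookup p g))"
  by (rule poly_mapping_eqI) (auto simp: lookup_sum lookup_single when_def in_keys_iff)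

text \<open>Both sides are biadditive in \<open>p\<close> and \<open>q\<close>, which reduces the
  claim to multiples of single group elements.\<close>

lemma int_op_mult:
  fixes p q :: "'g::group_add \<Rightarrow>\<^sub>0 int"
  shows "int_op (p * q) = int_op p o\<^sub>L int_op q"
proof (rule blinfun_eqI)
  fix x :: "'g ell2"
  let ?s = Poly_Mapping.single and ?l = Poly_Mapping.lookup
  have single: "int_op (?s g c * ?s h d) x = int_op (?s g c) (int_op (?s h d) x)" for g h c d
    by (simp add: mult_single int_op_single translate_scaleC translate_add scaleC_scaleC)
  have "int_op (p * q) x =
      int_op ((\<Sum>g\<in>Poly_Mapping.keys p. ?s g (?l p g)) * (\<Sum>h\<in>Poly_Mapping.keys q. ?s h (?l q h))) x"
    by (simp flip: poly_mapping_eq_sum_single)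
  also have "\<dots> = int_op (\<Sum>g\<in>Poly_Mapping.keys p. ?s g (?l p g)) (int_op (\<Sum>h\<in>Poly_Mapping.keys q. ?s h (?l q h)) x)"
    unfolding sum_product int_op_sum blinfun.sum_left blinfun.sum_right single
    by (rule sum.swap)
  also have "\<dots> = (int_op p o\<^sub>L int_op q) x"
    by (simp flip: poly_mapping_eq_sum_single)
  finally show "int_op (p * q) x = (int_op p o\<^sub>L int_op q) x" .
qed

lemma int_op_1: "int_op (1 :: 'g::group_add \<Rightarrow>\<^sub>0 int) = id_blinfun"
proof (rule blinfun_eqI)
  show "int_op (1 :: 'g \<Rightarrow>\<^sub>0 int) x = id_blinfun x" for x
    by (simp add: int_op_single flip: single_one)
qed

lemma integral_op_mult: "integral_op (f ** g) = integral_op f o\<^sub>L integral_op g"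
proof (rule blinfun_eqI)
  fix x
  have "(\<Sum>l\<in>UNIV. int_op (\<Sum>m\<in>UNIV. f $ k $ m * g $ m $ l) (x $ l)) =
      (\<Sum>m\<in>UNIV. int_op (f $ k $ m) (\<Sum>l\<in>UNIV. int_op (g $ m $ l) (x $ l)))" for k
    unfolding int_op_sum int_op_mult blinfun.sum_left blinfun.sum_right
    by (subst sum.swap) simp
  then show "integral_op (f ** g) x = (integral_op f o\<^sub>L integral_op g) x"
    by (simp add: integral_op_apply matrix_matrix_mult_def)
qed

lemma integral_op_1: "integral_op (mat 1) = id_blinfun"
proof (rule blinfun_eqI)
  fix x :: "('a ell2)^'b"
  have "(\<Sum>l\<in>UNIV. int_op (if k = l then 1 else 0) (x $ l)) = (\<Sum>l\<in>UNIV. if l = k then x $ k else 0)" for k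
    by (rule sum.cong) (auto simp: int_op_1)
  then show "integral_op (mat 1) x = id_blinfun x"
    by (simp add: integral_op_apply Finite_Cartesian_Product.mat_def Finite_Cartesian_Product.vec_eq_iff)
qed

lemma sum_keys_delta:
  fixes p :: "'g::group_add \<Rightarrow>\<^sub>0 int"
  shows "(\<Sum>g\<in>Poly_Mapping.keys p. complex_of_int (Poly_Mapping.lookup p g) * (if - g + h = 0 then 1 else 0)) =
    complex_of_int (Poly_Mapping.lookup p h)"
proof -
  have "- g + h = 0 \<longleftrightarrow> g = h" for g by (metis add_diff_cancel_left' diff_add_cancel left_minus minus_unique neg_eq_iff_add_eq_0)
  then have "(\<Sum>g\<in>Poly_Mapping.keys p. complex_of_int (Poly_Mapping.lookup p g) * (if - g + h = 0 then 1 else 0)) =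
      (\<Sum>g\<in>Poly_Mapping.keys p. if g = h then complex_of_int (Poly_Mapping.lookup p h) else 0)"
    by (intro sum.cong) auto
  then show ?thesis by (simp add: in_keys_iff)
qed

lemma integral_op_axis_delta:
  "Rep_ell2 (integral_op f (axis l (delta 0)) $ k) h = complex_of_int (Poly_Mapping.lookup (f $ k $ l) h)"
proof -
  have l: "Rep_ell2 (axis l (delta (0::'a)) $ l) g = (if g = 0 then 1 else 0)" for g
    by (simp add: axis_def delta.rep_eq)
  have off: "Rep_ell2 (axis l (delta (0::'a)) $ m) g = 0" if "m \<noteq> l" for m g
    using that by (simp add: axis_def zero_ell2.rep_eq)
  have "Rep_ell2 (integral_op f (axis l (delta 0)) $ k) h = (\<Sum>m\<in>UNIV. if m = l then
      (\<Sum>g\<in>Poly_Mapping.keys (f $ k $ l). complex_of_int (Poly_Mapping.lookup (f $ k $ l) g) * (if - g + h = 0 then 1 else 0)) else 0)"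
    unfolding integral_op_coord
  proof (rule sum.cong)
    fix m :: 'b
    show "(\<Sum>g\<in>Poly_Mapping.keys (f $ k $ m). complex_of_int (Poly_Mapping.lookup (f $ k $ m) g) *
        Rep_ell2 (axis l (delta 0) $ m) (- g + h)) = (if m = l then
      (\<Sum>g\<in>Poly_Mapping.keys (f $ k $ l). complex_of_int (Poly_Mapping.lookup (f $ k $ l) g) * (if - g + h = 0 then 1 else 0)) else 0)"
    proof (cases "m = l")
      case True
      then show ?thesis unfolding True l by simp
    next
      case False
      then show ?thesis unfolding off[OF False] by simp
    qed
  qed simp
  then show ?thesis unfolding sum_keys_delta by simp
qed

lemma integral_op_eqD:
  assumes "\<And>l. integral_op f (axis l (delta 0)) = integral_op g (axis l (delta 0))"
  shows "f = g"
proof -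
  have "Poly_Mapping.lookup (f $ k $ l) h = Poly_Mapping.lookup (g $ k $ l) h" for k l h
    using integral_op_axis_delta[of f l k h] integral_op_axis_delta[of g l k h] assms[of l]
    by (metis of_int_eq_iff)
  then show ?thesis by (simp add: Finite_Cartesian_Product.vec_eq_iff poly_mapping_eqI)
qed

section \<open>Adjoints and inverses over the group ring\<close>

text \<open>The involution of the matrix ring over the group ring: transpose and invert group
  elements. Integers are their own conjugates.\<close>

definition adj_matrix :: "('g::group_add \<Rightarrow>\<^sub>0 int)^'n^'n \<Rightarrow> ('g \<Rightarrow>\<^sub>0 int)^'n^'n" where
  "adj_matrix f = (\<chi> l k. Poly_Mapping.map_key uminus (f $ k $ l))"

lemma lookup_map_key_uminus: "Poly_Mapping.lookup (Poly_Mapping.map_key uminus p) g = Poly_Mapping.lookup p (- g :: 'g::group_add)"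
  by (simp add: map_key.rep_eq)

lemma sum_keys_map_key_uminus:
  "(\<Sum>g\<in>Poly_Mapping.keys (Poly_Mapping.map_key uminus p). F g (Poly_Mapping.lookup (Poly_Mapping.map_key uminus p) g)) =
   (\<Sum>g\<in>Poly_Mapping.keys p. F (- g :: 'g::group_add) (Poly_Mapping.lookup p g))"
  by (rule sum.reindex_bij_witness[of _ uminus uminus]) (auto simp: in_keys_iff lookup_map_key_uminus)

lemma cinner_sum_left: "cinner (\<Sum>j\<in>A. x j) (y::'h::complex_hilbert_space) = (\<Sum>j\<in>A. cinner (x j) y)"
proof (induction A rule: infinite_finite_induct)
  case empty
  show ?case using cinner_add_left[of 0 0 y] by simp
next
  case (infinite A)
  then show ?case using cinner_add_left[of 0 0 y] by simp
qed (simp add: cinner_add_left)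

lemma cinner_sum_right: "cinner (y::'h::complex_hilbert_space) (\<Sum>j\<in>A. x j) = (\<Sum>j\<in>A. cinner y (x j))"
  by (subst cinner_commute) (simp add: cinner_sum_left flip: cinner_commute)

lemma cinner_translate: "cinner (translate g x) y = cinner x (translate (- g) y)"
  unfolding cinner_ell2.rep_eq translate.rep_eq
proof -
  have bij: "bij (\<lambda>h. - g + h)"
    by (rule bij_betw_byWitness[where f' = "\<lambda>h. g + h"]) (auto simp: add.assoc[symmetric])
  have "(\<Sum>\<^sub>\<infinity>h. Rep_ell2 x h * cnj (Rep_ell2 y (- (- g) + h))) =
      (\<Sum>\<^sub>\<infinity>h. Rep_ell2 x (- g + h) * cnj (Rep_ell2 y (- (- g) + (- g + h))))"
    by (rule infsum_reindex_bij_betw[OF bij, symmetric])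
  then show "(\<Sum>\<^sub>\<infinity>h. Rep_ell2 x (- g + h) * cnj (Rep_ell2 y h)) =
      (\<Sum>\<^sub>\<infinity>h. Rep_ell2 x h * cnj (Rep_ell2 y (- (- g) + h)))"
    by (simp flip: add.assoc)
qed

lemma cinner_int_op: "cinner (int_op p x) y = cinner x (int_op (Poly_Mapping.map_key uminus p) y)"
proof -
  show ?thesis
    unfolding int_op_apply_superset[OF finite_keys order_refl] cinner_sum_left cinner_sum_right
      sum_keys_map_key_uminus[of "\<lambda>g c. complex_of_int c *\<^sub>C translate g y" p]
    by (simp add: cinner_scaleC_left cinner_scaleC_right cinner_translate)
qed

lemma cinner_integral_op: "cinner (integral_op f x) y = cinner x (integral_op (adj_matrix f) y)"
proof -
  have "cinner (integral_op f x) y =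
      (\<Sum>k\<in>UNIV. \<Sum>l\<in>UNIV. cinner (x $ l) (int_op (Poly_Mapping.map_key uminus (f $ k $ l)) (y $ k)))"
    by (simp add: cinner_vec_def integral_op_apply cinner_sum_left cinner_int_op)
  also have "\<dots> = cinner x (integral_op (adj_matrix f) y)"
    by (subst sum.swap) (simp add: cinner_vec_def integral_op_apply cinner_sum_right adj_matrix_def)
  finally show ?thesis .
qed

lemma cinner_integral_op': "cinner (integral_op (adj_matrix f) x) y = cinner x (integral_op f y)"
  by (metis cinner_integral_op cinner_commute)

lemma cinner_right_eqI:
  assumes "\<And>z. cinner z x = cinner z (y::'h::complex_hilbert_space)"
  shows "x = y"
proof -
  have "inner z x = inner z y" for z using assms[of z] by (metis Re_cinner)
  then show ?thesis by (meson vector_eq_ldot)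
qed

lemma hilbert_adjoint_integral_op: "hilbert_adjoint (integral_op f) = integral_op (adj_matrix f)"
  unfolding hilbert_adjoint_def
proof (rule the_equality)
  show "integral_op (adj_matrix f) \<in> bounded_operators \<and>
      (\<forall>x y. cinner (integral_op f x) y = cinner x (integral_op (adj_matrix f) y))"
    using integral_op_bounded cinner_integral_op by blast
  fix S assume "S \<in> bounded_operators \<and> (\<forall>x y. cinner (integral_op f x) y = cinner x (S y))"
  then have "cinner x (S y) = cinner x (integral_op (adj_matrix f) y)" for x y
    by (simp flip: cinner_integral_op)
  then show "S = integral_op (adj_matrix f)" by (intro blinfun_eqI cinner_right_eqI) simp
qed

lemma finite_ell2_ge_1: "finite {i. 1 \<le> cmod (Rep_ell2 x i)}"
proof (rule ccontr)
  assume inf: "infinite {i. 1 \<le> cmod (Rep_ell2 x i)}"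
  obtain N :: nat where N: "(norm x)\<^sup>2 < real N" using reals_Archimedean2 by blast
  obtain F where F: "F \<subseteq> {i. 1 \<le> cmod (Rep_ell2 x i)}" "finite F" "card F = N"
    using infinite_arbitrarily_large[OF inf] by blast
  have "real N = (\<Sum>i\<in>F. 1)" using F by simp
  also have "\<dots> \<le> (\<Sum>i\<in>F. (cmod (Rep_ell2 x i))\<^sup>2)"
    by (rule sum_mono) (use F(1) in \<open>auto simp: one_le_power\<close>)
  also have "\<dots> \<le> (norm x)\<^sup>2" by (rule ell2_partial_sum_le[OF F(2)])
  finally show False using N by simp
qed

lemma integer_ell2_poly_mapping:
  assumes "\<And>h. Rep_ell2 x h \<in> \<int>"
  obtains p :: "'g \<Rightarrow>\<^sub>0 int" where "\<And>h. Rep_ell2 x h = complex_of_int (Poly_Mapping.lookup p h)"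
proof -
  have "\<exists>q. \<forall>h. Rep_ell2 x h = complex_of_int (q h)"
    using assms by (intro choice) (auto elim: Ints_cases)
  then obtain q where q: "\<And>h. Rep_ell2 x h = complex_of_int (q h)" by blast
  have "1 \<le> cmod (Rep_ell2 x h)" if "q h \<noteq> 0" for h
  proof -
    have "1 \<le> \<bar>q h\<bar>" using that by linarith
    then show ?thesis unfolding q norm_of_int by (metis of_int_1_le_iff of_int_abs)
  qed
  then have "finite {h. q h \<noteq> 0}"
    by (intro finite_subset[OF _ finite_ell2_ge_1[of x]]) auto
  then have "Poly_Mapping.lookup (Abs_poly_mapping q) = q" by simp
  then show ?thesis using q that by metis
qed

text \<open>\<open>S\<close> plays the inverse of \<open>f* f\<close>. Its integral columns form a
  matrix \<open>x\<close> over the group ring with \<open>f* (f x) = 1\<close>. Taking adjoints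
  makes \<open>G\<close>, the adjoint of \<open>f x\<close>, a left inverse of \<open>f\<close>;
  since \<open>f\<close> is invertible as an operator, \<open>G\<close> is a right inverse as
  well.\<close>

lemma invertible_of_integer_inverse:
  fixes f :: "('g::group_add \<Rightarrow>\<^sub>0 int)^'n^'n"
  assumes F: "S0 o\<^sub>L integral_op f = id_blinfun" "integral_op f o\<^sub>L S0 = id_blinfun"
    and S: "\<And>y. integral_op (adj_matrix f) (integral_op f (S y)) = y"
    and int: "\<And>l k h. Rep_ell2 (S (axis l (delta 0)) $ k) h \<in> \<int>"
  shows "invertible f"
proof -
  have "\<exists>p. \<forall>h. Rep_ell2 (S (axis l (delta 0)) $ k) h = complex_of_int (Poly_Mapping.lookup p h)" for k l
    by (rule integer_ell2_poly_mapping[OF int[of l k]]) blast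
  note ex = this
  define X where "X k l = (SOME p. \<forall>h. Rep_ell2 (S (axis l (delta 0)) $ k) h = complex_of_int (Poly_Mapping.lookup p h))" for k l
  have X: "Rep_ell2 (S (axis l (delta 0)) $ k) h = complex_of_int (Poly_Mapping.lookup (X k l) h)" for k l h
    using someI_ex[OF ex[of l k]] unfolding X_def by blast
  define x where "x = (\<chi> k l. X k l)"
  have Sx: "integral_op x (axis l (delta 0)) = S (axis l (delta 0))" for l
    by (rule vec_ell2_eqI) (simp add: integral_op_axis_delta X x_def)
  have "adj_matrix f ** (f ** x) = mat 1"
    by (rule integral_op_eqD) (simp add: integral_op_mult integral_op_1 Sx S)
  then have op1: "integral_op (adj_matrix f) (integral_op (f ** x) v) = v" for v
    by (metis blinfun_apply_blinfun_compose id_blinfun.rep_eq integral_op_1 integral_op_mult)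
  define G where "G = adj_matrix (f ** x)"
  have GF: "integral_op G (integral_op f u) = u" for u
  proof (rule cinner_right_eqI)
    fix z
    have "cinner z (integral_op G (integral_op f u)) = cinner (integral_op (f ** x) z) (integral_op f u)"
      unfolding G_def by (rule cinner_integral_op[symmetric])
    also have "\<dots> = cinner (integral_op (adj_matrix f) (integral_op (f ** x) z)) u"
      by (rule cinner_integral_op'[symmetric])
    finally show "cinner z (integral_op G (integral_op f u)) = cinner z u" unfolding op1 .
  qed
  have FS: "integral_op f (S0 y) = y" for y
    using F(2) by (metis blinfun_apply_blinfun_compose id_blinfun.rep_eq)
  have FG: "integral_op f (integral_op G y) = y" for y
    using GF[of "S0 y"] FS by metis
  have "G ** f = mat 1" "f ** G = mat 1"
    by (rule integral_op_eqD; simp add: integral_op_mult integral_op_1 GF FG)+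
  then show ?thesis unfolding invertible_def by blast
qed

section \<open>Convolution of finitely supported functions\<close>

text \<open>The operator of \<open>f\<close> on plain real functions. In this form every translation
  by \<open>g\<close> is visible, so that a model can imitate it by
  \<open>\<sigma> g\<close>.\<close>

definition act :: "('g::group_add \<Rightarrow>\<^sub>0 int)^'n^'n \<Rightarrow> ('n \<times> 'g \<Rightarrow> real) \<Rightarrow> 'n \<times> 'g \<Rightarrow> real" where
  "act f w = (\<lambda>(k,h). \<Sum>l\<in>UNIV. \<Sum>g\<in>Poly_Mapping.keys (f $ k $ l).
     real_of_int (Poly_Mapping.lookup (f $ k $ l) g) * w (l, - g + h))"

text \<open>The operator of the adjoint, written with the coefficients of \<open>f\<close> itself to
  match the transposed matrix of a model.\<close>

definition act_adj :: "('g::group_add \<Rightarrow>\<^sub>0 int)^'n^'n \<Rightarrow> ('n \<times> 'g \<Rightarrow> real) \<Rightarrow> 'n \<times> 'g \<Rightarrow> real" where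
  "act_adj f w = (\<lambda>(l,h). \<Sum>k\<in>UNIV. \<Sum>g\<in>Poly_Mapping.keys (f $ k $ l).
     real_of_int (Poly_Mapping.lookup (f $ k $ l) g) * w (k, g + h))"

lemma finite_support_act:
  fixes f :: "('g::group_add \<Rightarrow>\<^sub>0 int)^'n^'n"
  assumes "finite {i. w i \<noteq> 0}"
  shows "finite {i. act f w i \<noteq> 0}"
proof (rule finite_subset)
  let ?Q = "\<Union>k\<in>UNIV. \<Union>l\<in>UNIV. Poly_Mapping.keys (f $ k $ l)"
  show "{i. act f w i \<noteq> 0} \<subseteq> UNIV \<times> (\<lambda>(g,h). g + h) ` (?Q \<times> snd ` {i. w i \<noteq> 0})"
  proof safe
    fix k h assume "act f w (k,h) \<noteq> 0"
    then obtain l g where "g \<in> Poly_Mapping.keys (f $ k $ l)" "w (l, - g + h) \<noteq> 0"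
      unfolding act_def by (auto elim!: sum.not_neutral_contains_not_neutral)
    then show "h \<in> (\<lambda>(g,h). g + h) ` (?Q \<times> snd ` {i. w i \<noteq> 0})"
      by (intro image_eqI[of _ _ "(g, - g + h)"]) (force simp flip: add.assoc)+
  qed simp
  show "finite ((UNIV :: 'n set) \<times> (\<lambda>(g,h). g + h) ` (?Q \<times> snd ` {i. w i \<noteq> 0}))"
    using assms by auto
qed

lemma act_adj_eq:
  fixes f :: "('g::group_add \<Rightarrow>\<^sub>0 int)^'n^'n"
  shows "act_adj f w = act (adj_matrix f) w"
proof
  fix i :: "'n \<times> 'g"
  obtain l h where i: "i = (l,h)" by (cases i)
  have eq: "(\<Sum>g\<in>Poly_Mapping.keys (f $ k $ l). real_of_int (Poly_Mapping.lookup (f $ k $ l) g) * w (k, g + h)) =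
      (\<Sum>g\<in>Poly_Mapping.keys (adj_matrix f $ l $ k).
        real_of_int (Poly_Mapping.lookup (adj_matrix f $ l $ k) g) * w (k, - g + h))" for k
    using sum_keys_map_key_uminus[of "\<lambda>g c. real_of_int c * w (k, - g + h)" "f $ k $ l"]
    by (simp add: adj_matrix_def)
  show "act_adj f w i = act (adj_matrix f) w i"
    unfolding i act_adj_def act_def prod.case eq ..
qed

lemma finite_support_act_adj: "finite {i. w i \<noteq> 0} \<Longrightarrow> finite {i. act_adj f w i \<noteq> 0}"
  unfolding act_adj_eq by (rule finite_support_act)

text \<open>\<open>Abs_ell2\<close> is specified only on square-summable functions, whence the
  finite supports assumed below.\<close>

definition ell2_embed :: "('n \<times> 'g \<Rightarrow> real) \<Rightarrow> ('g ell2)^'n" where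
  "ell2_embed w = (\<chi> k. Abs_ell2 (\<lambda>h. complex_of_real (w (k,h))))"

lemma ell2_embed_coord:
  assumes "finite {i. w i \<noteq> 0}"
  shows "Rep_ell2 (ell2_embed w $ k) h = complex_of_real (w (k,h))"
proof -
  have "finite {h. w (k,h) \<noteq> 0}"
    by (rule finite_subset[OF _ finite_imageI[OF assms, of snd]]) (auto simp: image_iff)
  then have "(\<lambda>h. (cmod (complex_of_real (w (k,h))))\<^sup>2) summable_on UNIV"
    by (intro finite_nonzero_values_imp_summable_on) simp
  then show ?thesis by (simp add: ell2_embed_def Abs_ell2_inverse)
qed

lemma integral_op_ell2_embed:
  assumes w: "finite {i. w i \<noteq> 0}"
  shows "integral_op f (ell2_embed w) = ell2_embed (act f w)"
  by (rule vec_ell2_eqI, unfold integral_op_coord ell2_embed_coord[OF w] ell2_embed_coord[OF finite_support_act[OF w]])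
    (simp add: act_def)

lemma integral_op_adj_ell2_embed:
  assumes w: "finite {i. w i \<noteq> 0}"
  shows "integral_op (adj_matrix f) (ell2_embed w) = ell2_embed (act_adj f w)"
  unfolding act_adj_eq by (rule integral_op_ell2_embed[OF w])

lemma norm_ell2_embed:
  fixes w :: "'n::finite \<times> 'g \<Rightarrow> real"
  assumes w: "finite A" "{i. w i \<noteq> 0} \<subseteq> A"
  shows "(norm (ell2_embed w))\<^sup>2 = (\<Sum>i\<in>A. (w i)\<^sup>2)"
proof -
  have fin: "finite {i. w i \<noteq> 0}" using w finite_subset by blast
  define B where "B = snd ` A"
  have B: "finite B" using w by (simp add: B_def)
  have AB: "A \<subseteq> UNIV \<times> B" by (force simp: B_def)
  have "(norm (ell2_embed w))\<^sup>2 = (\<Sum>k\<in>UNIV. (norm (ell2_embed w $ k))\<^sup>2)"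
    unfolding norm_vec_def L2_set_def by (simp add: sum_nonneg)
  also have "\<dots> = (\<Sum>k\<in>UNIV. \<Sum>h\<in>B. (w (k,h))\<^sup>2)"
  proof (rule sum.cong)
    fix k :: 'n
    have "(norm (ell2_embed w $ k))\<^sup>2 = (\<Sum>\<^sub>\<infinity>h. (w (k,h))\<^sup>2)"
      unfolding norm_ell2_power2 ell2_embed_coord[OF fin] by simp
    also have "\<dots> = (\<Sum>\<^sub>\<infinity>h\<in>B. (w (k,h))\<^sup>2)"
      by (rule infsum_cong_neutral) (use w AB in auto)
    also have "\<dots> = (\<Sum>h\<in>B. (w (k,h))\<^sup>2)" using B by (rule infsum_finite)
    finally show "(norm (ell2_embed w $ k))\<^sup>2 = (\<Sum>h\<in>B. (w (k,h))\<^sup>2)" .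
  qed simp
  also have "\<dots> = (\<Sum>i\<in>UNIV \<times> B. (w i)\<^sup>2)" by (simp add: sum.cartesian_product)
  also have "\<dots> = (\<Sum>i\<in>A. (w i)\<^sup>2)"
    by (rule sum.mono_neutral_right) (use w AB B in auto)
  finally show ?thesis .
qed

lemma norm_delta: "norm (delta i) = 1"
proof -
  have "(norm (delta i))\<^sup>2 = (\<Sum>\<^sub>\<infinity>j. if j = i then 1 else 0)"
    unfolding norm_ell2_power2 delta.rep_eq by (intro infsum_cong) auto
  also have "\<dots> = (\<Sum>\<^sub>\<infinity>j\<in>{i}. if j = i then 1 else (0::real))"
    by (rule infsum_cong_neutral) auto
  also have "\<dots> = 1" by simp
  finally show ?thesis by (smt (verit) norm_ge_zero power2_eq_1_iff)
qed

lemma norm_axis: "norm (axis k x :: ('a::real_normed_vector)^'n) = norm x"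
proof -
  have "(\<Sum>j\<in>UNIV. (norm ((axis k x :: 'a^'n) $ j))\<^sup>2) = (\<Sum>j\<in>UNIV. if j = k then (norm x)\<^sup>2 else 0)"
    by (rule sum.cong) (auto simp: axis_def)
  then show ?thesis unfolding norm_vec_def L2_set_def by simp
qed

lemma cinner_delta: "cinner x (delta i) = Rep_ell2 x i"
proof -
  have "cinner x (delta i) = (\<Sum>\<^sub>\<infinity>j. if j = i then Rep_ell2 x i else 0)"
    unfolding cinner_ell2.rep_eq delta.rep_eq by (intro infsum_cong) auto
  also have "\<dots> = (\<Sum>\<^sub>\<infinity>j\<in>{i}. if j = i then Rep_ell2 x i else 0)"
    by (rule infsum_cong_neutral) auto
  finally show ?thesis by simp
qed

lemma Re_matrix_trace:
  "Re (matrix_trace U) = (\<Sum>j\<in>UNIV. inner (U (axis j (delta 0)) $ j) (delta 0))"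
  by (simp add: matrix_trace_def vN_trace_def matrix_entry_apply Re_cinner)

text \<open>The trace is a sum of vector states at unit vectors, each of them 1-Lipschitz in the
  operator norm.\<close>

lemma Re_matrix_trace_diff_le:
  fixes U V :: "('g::group_add ell2^'n) \<Rightarrow>\<^sub>L ('g ell2^'n)"
  shows "\<bar>Re (matrix_trace U) - Re (matrix_trace V)\<bar> \<le> real CARD('n) * norm (U - V)"
proof -
  have "\<bar>Re (matrix_trace U) - Re (matrix_trace V)\<bar> =
      \<bar>\<Sum>j\<in>UNIV. inner ((U - V) (axis j (delta 0)) $ j) (delta 0)\<bar>"
    by (simp add: Re_matrix_trace blinfun.diff_left inner_diff_left sum_subtractf)
  also have "\<dots> \<le> (\<Sum>j\<in>(UNIV::'n set). norm (U - V))"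
  proof (rule order_trans[OF sum_abs sum_mono])
    fix j :: 'n
    have "\<bar>inner ((U - V) (axis j (delta 0)) $ j) (delta 0)\<bar> \<le>
        norm ((U - V) (axis j (delta 0)) $ j) * norm (delta (0::'g))"
      by (rule Cauchy_Schwarz_ineq2)
    also have "\<dots> \<le> norm ((U - V) (axis j (delta 0)))"
      by (simp add: norm_delta Finite_Cartesian_Product.norm_nth_le)
    also have "\<dots> \<le> norm (U - V) * norm (axis j (delta (0::'g)) :: ('g ell2)^'n)" by (rule norm_blinfun)
    finally show "\<bar>inner ((U - V) (axis j (delta 0)) $ j) (delta 0)\<bar> \<le> norm (U - V)"
      by (simp add: norm_axis norm_delta)
  qed
  finally show ?thesis by simp
qed

definition laplacian :: "('g::group_add \<Rightarrow>\<^sub>0 int)^'n^'n \<Rightarrow> ('n \<times> 'g \<Rightarrow> real) \<Rightarrow> 'n \<times> 'g \<Rightarrow> real" where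
  "laplacian f w = act_adj f (act f w)"

lemma finite_support_laplacian: "finite {i. w i \<noteq> 0} \<Longrightarrow> finite {i. laplacian f w i \<noteq> 0}"
  unfolding laplacian_def by (intro finite_support_act_adj finite_support_act)

lemma laplacian_0 [simp]: "laplacian f (\<lambda>_. 0) = (\<lambda>_. 0)"
  by (auto simp: laplacian_def act_adj_def act_def fun_eq_iff)

lemma finite_support_add:
  "finite {i. w i \<noteq> (0::real)} \<Longrightarrow> finite {i. w' i \<noteq> 0} \<Longrightarrow> finite {i. a * w i + w' i \<noteq> 0}"
  by (rule finite_subset[of _ "{i. w i \<noteq> 0} \<union> {i. w' i \<noteq> 0}"]) auto

lemma finite_support_poly_app:
  "finite {i. w i \<noteq> 0} \<Longrightarrow> finite {i. poly_app p (laplacian f) w i \<noteq> 0}"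
proof (induction p)
  case (pCons a p)
  then show ?case
    by (simp add: poly_app_pCons finite_support_add finite_support_laplacian)
qed simp

lemma ell2_embed_add:
  assumes "finite {i. w i \<noteq> 0}" "finite {i. w' i \<noteq> 0}"
  shows "ell2_embed (\<lambda>i. a * w i + w' i) = a *\<^sub>R ell2_embed w + ell2_embed w'"
  by (rule vec_ell2_eqI)
    (simp add: ell2_embed_coord[OF finite_support_add[OF assms]] ell2_embed_coord[OF assms(1)]
      ell2_embed_coord[OF assms(2)] plus_ell2.rep_eq scaleR_ell2.rep_eq)

text \<open>The bridge from operators, where spectral estimates hold, to the explicit functions that
  the models copy.\<close>

lemma poly_op_ell2_embed:
  assumes w: "finite {i. w i \<noteq> 0}"
  shows "poly_op p (integral_op (adj_matrix f) o\<^sub>L integral_op f) (ell2_embed w) =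
    ell2_embed (poly_app p (laplacian f) w)"
proof (induction p)
  case 0
  have "ell2_embed (\<lambda>_. 0) = 0"
    by (rule vec_ell2_eqI) (simp add: ell2_embed_coord zero_ell2.rep_eq)
  then show ?case by simp
next
  case (pCons a p)
  note fin = finite_support_poly_app[OF w, of p f]
  have "integral_op (adj_matrix f) (integral_op f (ell2_embed (poly_app p (laplacian f) w))) =
      ell2_embed (laplacian f (poly_app p (laplacian f) w))"
    by (simp add: integral_op_ell2_embed[OF fin] integral_op_adj_ell2_embed[OF finite_support_act[OF fin]] laplacian_def)
  then show ?case
    by (simp add: poly_op_pCons_apply pCons.IH poly_app_pCons
        ell2_embed_add[OF w finite_support_laplacian[OF fin]])
qed

lemma sum_le_norm_ell2_embed:
  fixes w :: "'n::finite \<times> 'g \<Rightarrow> real"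
  assumes A: "finite A" and w: "finite {i. w i \<noteq> 0}"
  shows "(\<Sum>i\<in>A. (w i)\<^sup>2) \<le> (norm (ell2_embed w))\<^sup>2"
proof -
  have "(\<Sum>i\<in>A. (w i)\<^sup>2) \<le> (\<Sum>i\<in>A \<union> {i. w i \<noteq> 0}. (w i)\<^sup>2)"
    using assms by (intro sum_mono2) auto
  also have "\<dots> = (norm (ell2_embed w))\<^sup>2"
    by (rule norm_ell2_embed[symmetric]) (use assms in auto)
  finally show ?thesis .
qed

lemma finite_support_unit_at [simp]: "finite {i. unit_at j i \<noteq> 0}"
  by (rule finite_subset[of _ "{j}"]) (auto simp: unit_at_def)

lemma ell2_embed_unit_at: "ell2_embed (unit_at (l, h)) = axis l (delta h)"
proof (rule vec_ell2_eqI)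
  fix k g
  show "Rep_ell2 (ell2_embed (unit_at (l,h)) $ k) g = Rep_ell2 (axis l (delta h) $ k) g"
    unfolding ell2_embed_coord[OF finite_support_unit_at]
    by (cases "k = l") (auto simp: unit_at_def axis_def delta.rep_eq zero_ell2.rep_eq)
qed

lemma Re_matrix_trace_poly_op:
  "Re (matrix_trace (poly_op q (integral_op (adj_matrix f) o\<^sub>L integral_op f))) =
    (\<Sum>j\<in>UNIV. poly_app q (laplacian f) (unit_at (j, 0)) (j, 0))"
proof -
  have "Re (matrix_trace (poly_op q (integral_op (adj_matrix f) o\<^sub>L integral_op f))) =
      (\<Sum>j\<in>UNIV. Re (Rep_ell2 (ell2_embed (poly_app q (laplacian f) (unit_at (j, 0))) $ j) 0))"
    unfolding Re_matrix_trace Re_cinner[symmetric] cinner_delta ell2_embed_unit_at[symmetric]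
      poly_op_ell2_embed[OF finite_support_unit_at] ..
  then show ?thesis
    by (simp add: ell2_embed_coord[OF finite_support_poly_app[OF finite_support_unit_at]])
qed

section \<open>Truncation and spectral estimates on the group\<close>

text \<open>\<open>y\<close> is the restriction of \<open>x\<close> to \<open>F'\<close>. Allowing
  every finite \<open>F'\<close> above \<open>F\<close> leaves room to add a prescribed point
  later.\<close>

lemma ell2_tail_small:
  assumes "e > 0"
  obtains F where "finite F" "\<And>F' y. finite F' \<Longrightarrow> F \<subseteq> F' \<Longrightarrow>
    (\<And>i. Rep_ell2 y i = (if i \<in> F' then Rep_ell2 x i else 0)) \<Longrightarrow> (norm (x - y))\<^sup>2 \<le> e"
proof -
  let ?g = "\<lambda>i. (cmod (Rep_ell2 x i))\<^sup>2"
  have summ: "?g summable_on UNIV" using Rep_ell2[of x] by simp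
  have "(sum ?g \<longlongrightarrow> infsum ?g UNIV) (finite_subsets_at_top UNIV)" by (rule infsum_tendsto[OF summ])
  then have "\<forall>\<^sub>F F in finite_subsets_at_top UNIV. dist (sum ?g F) (infsum ?g UNIV) < e"
    using assms by (rule tendstoD)
  then obtain F where F: "finite F" "\<And>F'. finite F' \<Longrightarrow> F \<subseteq> F' \<Longrightarrow> dist (sum ?g F') (infsum ?g UNIV) < e"
    by (auto simp: eventually_finite_subsets_at_top)
  show ?thesis
  proof (rule that[OF F(1)])
    fix F' y assume F': "finite F'" "F \<subseteq> F'" and y: "\<And>i. Rep_ell2 y i = (if i \<in> F' then Rep_ell2 x i else 0)"
    have "(norm (x - y))\<^sup>2 = (\<Sum>\<^sub>\<infinity>i\<in>UNIV - F'. ?g i)"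
      unfolding norm_ell2_power2 minus_ell2.rep_eq y by (rule infsum_cong_neutral) auto
    also have "\<dots> = infsum ?g UNIV - infsum ?g F'"
      by (rule infsum_Diff) (use summ F'(1) in auto)
    also have "\<dots> = infsum ?g UNIV - sum ?g F'" using F'(1) by simp
    also have "\<dots> \<le> e" using F(2)[OF F'] by (auto simp: dist_real_def)
    finally show "(norm (x - y))\<^sup>2 \<le> e" .
  qed
qed

lemma vec_ell2_tail_small:
  fixes x :: "('g ell2)^'n"
  assumes e: "e > 0"
  obtains F where "finite F" "\<And>F' y. finite F' \<Longrightarrow> F \<subseteq> F' \<Longrightarrow>
    (\<And>k i. Rep_ell2 (y $ k) i = (if i \<in> F' then Rep_ell2 (x $ k) i else 0)) \<Longrightarrow> norm (x - y) \<le> e"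
proof -
  let ?d = "e\<^sup>2 / CARD('n)"
  have d: "?d > 0" using e by simp
  have "\<exists>F. finite F \<and> (\<forall>F' y. finite F' \<longrightarrow> F \<subseteq> F' \<longrightarrow>
      (\<forall>i. Rep_ell2 y i = (if i \<in> F' then Rep_ell2 (x $ k) i else 0)) \<longrightarrow> (norm (x $ k - y))\<^sup>2 \<le> ?d)" for k
    by (rule ell2_tail_small[OF d, of "x $ k"]) blast
  then obtain F where F: "\<And>k. finite (F k)" "\<And>k F' y. finite F' \<Longrightarrow> F k \<subseteq> F' \<Longrightarrow>
      (\<forall>i. Rep_ell2 y i = (if i \<in> F' then Rep_ell2 (x $ k) i else 0)) \<Longrightarrow> (norm (x $ k - y))\<^sup>2 \<le> ?d"
    by metis
  show ?thesis
  proof (rule that[of "\<Union>k. F k"])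
    show "finite (\<Union>k. F k)" using F(1) by simp
    fix F' and y :: "('g ell2)^'n"
    assume F': "finite F'" "(\<Union>k. F k) \<subseteq> F'"
      and y: "\<And>k i. Rep_ell2 (y $ k) i = (if i \<in> F' then Rep_ell2 (x $ k) i else 0)"
    have "(norm (x - y))\<^sup>2 = (\<Sum>k\<in>UNIV. (norm (x $ k - y $ k))\<^sup>2)"
      unfolding norm_vec_def L2_set_def by (simp add: sum_nonneg)
    also have "\<dots> \<le> (\<Sum>k\<in>(UNIV::'n set). ?d)"
      by (intro sum_mono F(2)[OF F'(1)]) (use F'(2) y in auto)
    also have "\<dots> = e\<^sup>2" by simp
    finally show "norm (x - y) \<le> e" by (rule power2_le_imp_le) (use e in simp)
  qed
qed

abbreviation laplacian_op :: "('g::group_add \<Rightarrow>\<^sub>0 int)^'n^'n \<Rightarrow> ('g ell2^'n) \<Rightarrow>\<^sub>L ('g ell2^'n)" where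
  "laplacian_op f \<equiv> integral_op (adj_matrix f) o\<^sub>L integral_op f"

text \<open>The lower bound comes from \<open>norm x \<le> norm S0 * norm (f x)\<close>. The upper
  bound stays free beyond \<open>C0\<close>, because the same \<open>C\<close> must later dominate
  the finite models too.\<close>

lemma laplacian_op_between:
  assumes S0: "S0 o\<^sub>L integral_op f = id_blinfun"
  obtains c C0 where "0 < c" "\<And>C. C0 \<le> C \<Longrightarrow> c \<le> C \<and> self_adjoint_between c C (laplacian_op f)"
proof -
  let ?F = "integral_op f"
  define s where "s = norm S0 + 1"
  define c where "c = 1 / s\<^sup>2"
  have s: "s > 0" unfolding s_def by (simp add: add_nonneg_pos)
  have below: "c * (norm x)\<^sup>2 \<le> (norm (?F x))\<^sup>2" for x
  proof -
    have "S0 (?F x) = x" using S0 by (metis blinfun_apply_blinfun_compose id_blinfun.rep_eq)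
    then have "norm x \<le> norm S0 * norm (?F x)" by (metis norm_blinfun)
    also have "\<dots> \<le> s * norm (?F x)" by (simp add: s_def mult_right_mono)
    finally have "(norm x)\<^sup>2 \<le> (s * norm (?F x))\<^sup>2" by (rule power_mono) simp
    then show ?thesis using s by (simp add: c_def power_mult_distrib field_simps)
  qed
  have above: "(norm (?F x))\<^sup>2 \<le> (norm ?F)\<^sup>2 * (norm x)\<^sup>2" for x
    unfolding power_mult_distrib[symmetric] by (rule power_mono[OF norm_blinfun]) simp
  have ip: "inner (laplacian_op f x) x = (norm (?F x))\<^sup>2" for x
    by (simp add: Re_cinner[symmetric] cinner_integral_op') (simp add: Re_cinner power2_norm_eq_inner)
  show ?thesis
  proof (rule that[of c "(norm ?F)\<^sup>2 + c"])
    show "0 < c" using s by (simp add: c_def)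
    fix C assume C: "(norm ?F)\<^sup>2 + c \<le> C"
    have "(norm ?F)\<^sup>2 * (norm x)\<^sup>2 \<le> C * (norm x)\<^sup>2" for x :: "'a ell2 ^ 'b"
      using C \<open>0 < c\<close> by (intro mult_right_mono) auto
    then have "c * (norm x)\<^sup>2 \<le> inner (laplacian_op f x) x \<and> inner (laplacian_op f x) x \<le> C * (norm x)\<^sup>2" for x
      unfolding ip using below[of x] above[of x] order_trans by blast
    moreover have "laplacian_op f \<in> bounded_operators"
      using integral_op_bounded[of f] integral_op_bounded[of "adj_matrix f"]
      by (simp add: bounded_operators_def)
    moreover have "cinner (laplacian_op f x) y = cinner x (laplacian_op f y)" for x y
      unfolding blinfun_apply_blinfun_compose cinner_integral_op' by (rule cinner_integral_op)
    ultimately have "self_adjoint_between c C (laplacian_op f)"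
      unfolding self_adjoint_between_def by blast
    moreover have "c \<le> C" using C by (smt (verit) zero_le_power2)
    ultimately show "c \<le> C \<and> self_adjoint_between c C (laplacian_op f)" by blast
  qed
qed

lemma ell2_coord_le_vec: "cmod (Rep_ell2 (x $ k) i) \<le> norm (x :: ('g ell2)^'n)"
  using ell2_coord_le[of "x $ k" i] Finite_Cartesian_Product.norm_nth_le[of x k] by linarith

lemma poly_app_coord_le:
  fixes f :: "('g::group_add \<Rightarrow>\<^sub>0 int)^'n^'n"
  assumes T: "self_adjoint_between c C (laplacian_op f)" and e: "e \<ge> 0"
    and q: "\<And>t. c \<le> t \<Longrightarrow> t \<le> C \<Longrightarrow> \<bar>poly q t\<bar> \<le> e"
  shows "\<bar>poly_app q (laplacian f) (unit_at (l, 0)) (l, 0)\<bar> \<le> e"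
proof -
  have "norm (poly_op q (laplacian_op f)) \<le> e"
    using norm_poly_op_le[OF T e] q by blast
  then have "norm (poly_op q (laplacian_op f) (axis l (delta 0))) \<le> e"
    using norm_blinfun[of "poly_op q (laplacian_op f)" "axis l (delta 0)"]
    by (simp add: norm_axis norm_delta)
  then have "norm (ell2_embed (poly_app q (laplacian f) (unit_at (l, 0)))) \<le> e"
    by (simp add: poly_op_ell2_embed flip: ell2_embed_unit_at)
  then have "cmod (complex_of_real (poly_app q (laplacian f) (unit_at (l, 0)) (l, 0))) \<le> e"
    unfolding ell2_embed_coord[OF finite_support_poly_app[OF finite_support_unit_at], symmetric]
    by (rule order_trans[OF ell2_coord_le_vec])
  then show ?thesis by simp
qed

text \<open>\<open>abs_op\<close> is the square root of \<open>laplacian_op f\<close>; hence the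
  logarithm of the latter carries twice the trace.\<close>

lemma trace_log_fk_det:
  fixes f :: "('g::group_add \<Rightarrow>\<^sub>0 int)^'n^'n"
  assumes T: "self_adjoint_between c C (laplacian_op f)" and c: "0 < c" "c \<le> C" and e: "e \<ge> 0"
    and q: "\<And>t. c \<le> t \<Longrightarrow> t \<le> C \<Longrightarrow> \<bar>poly q t - ln t\<bar> \<le> e"
  shows "\<bar>(\<Sum>j\<in>UNIV. poly_app q (laplacian f) (unit_at (j, 0)) (j, 0)) - 2 * ln (fk_det (integral_op f))\<bar> \<le>
    real CARD('n) * e"
proof -
  let ?L = "func_calc ln (func_calc sqrt (laplacian_op f))"
  have sc: "Re (matrix_trace (2 *\<^sub>R U)) = 2 * Re (matrix_trace U)" for U :: "('g ell2^'n) \<Rightarrow>\<^sub>L ('g ell2^'n)"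
    by (simp add: Re_matrix_trace blinfun.scaleR_left sum_distrib_left)
  have "\<bar>Re (matrix_trace (poly_op q (laplacian_op f))) - Re (matrix_trace (2 *\<^sub>R ?L))\<bar> \<le>
      real CARD('n) * norm (poly_op q (laplacian_op f) - 2 *\<^sub>R ?L)"
    by (rule Re_matrix_trace_diff_le)
  also have "\<dots> \<le> real CARD('n) * e"
    by (intro mult_left_mono norm_poly_op_diff_log_le[OF T c q e]) auto
  finally show ?thesis
    unfolding Re_matrix_trace_poly_op sc fk_det_def abs_op_def hilbert_adjoint_integral_op by simp
qed

lemma norm_poly_op_mult_le:
  fixes T :: "'h::complex_hilbert_space \<Rightarrow>\<^sub>L 'h"
  assumes T: "self_adjoint_between c C T" and e: "e \<ge> 0"
    and p: "\<And>t. c \<le> t \<Longrightarrow> t \<le> C \<Longrightarrow> \<bar>poly p t * t - 1\<bar> \<le> e"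
  shows "norm (poly_op p T (T x)) \<le> (1 + e) * norm x"
    and "norm (poly_op p T (T x) - x) \<le> e * norm x"
proof -
  have 1: "poly_op (pCons 0 p) T x = poly_op p T (T x)" for x
    by (simp add: poly_op_pCons_apply) (rule poly_op_commute)
  have "norm (poly_op (pCons 0 p) T) \<le> 1 + e"
  proof (rule norm_poly_op_le[OF T])
    fix t assume "c \<le> t" "t \<le> C"
    then show "\<bar>poly (pCons 0 p) t\<bar> \<le> 1 + e"
      using p[of t] by (simp add: mult.commute abs_le_iff)
  qed (use e in simp)
  then show "norm (poly_op p T (T x)) \<le> (1 + e) * norm x"
    unfolding 1[symmetric] by (rule order_trans[OF norm_blinfun mult_right_mono]) simp
  have 2: "poly_op (pCons 0 p - 1) T x = poly_op p T (T x) - x" for x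
  proof -
    have "poly_op 1 T x = x" by (simp add: poly_op_pCons_apply one_pCons)
    then show ?thesis by (simp add: poly_op_diff blinfun.diff_left 1)
  qed
  have "norm (poly_op (pCons 0 p - 1) T) \<le> e"
    by (rule norm_poly_op_le[OF T e]) (use p in \<open>simp add: mult.commute\<close>)
  then show "norm (poly_op p T (T x) - x) \<le> e * norm x"
    unfolding 2[symmetric] by (rule order_trans[OF norm_blinfun mult_right_mono]) simp
qed

lemma ell2_embed_laplacian:
  "finite {i. w i \<noteq> 0} \<Longrightarrow> ell2_embed (laplacian f w) = laplacian_op f (ell2_embed w)"
  by (simp add: laplacian_def integral_op_ell2_embed[of w f] integral_op_adj_ell2_embed[OF finite_support_act])

text \<open>Columns that are not replaced: \<open>p(a) a\<close> is nearly the identity. The finite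
  set \<open>B\<close> will be the part of the group that a model copies.\<close>

lemma poly_app_column_le:
  fixes f :: "('g::group_add \<Rightarrow>\<^sub>0 int)^'n^'n"
  assumes T: "self_adjoint_between c C (laplacian_op f)" and e: "e \<ge> 0"
    and p: "\<And>t. c \<le> t \<Longrightarrow> t \<le> C \<Longrightarrow> \<bar>poly p t * t - 1\<bar> \<le> e" and B: "finite B"
  shows "(\<Sum>i\<in>B. (poly_app p (laplacian f) (laplacian f (unit_at (l, h))) i)\<^sup>2) \<le> (1 + e)\<^sup>2"
proof -
  note fin = finite_support_laplacian[OF finite_support_unit_at, of f "(l,h)"]
  have "(\<Sum>i\<in>B. (poly_app p (laplacian f) (laplacian f (unit_at (l, h))) i)\<^sup>2) \<le>
      (norm (ell2_embed (poly_app p (laplacian f) (laplacian f (unit_at (l, h))))))\<^sup>2"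
    by (rule sum_le_norm_ell2_embed[OF B finite_support_poly_app[OF fin]])
  also have "\<dots> \<le> ((1 + e) * norm (axis l (delta h) :: ('g ell2)^'n))\<^sup>2"
    unfolding poly_op_ell2_embed[OF fin, symmetric] ell2_embed_laplacian[OF finite_support_unit_at]
      ell2_embed_unit_at
    by (intro power_mono norm_poly_op_mult_le[OF T e p]) auto
  finally show ?thesis by (simp add: norm_axis norm_delta)
qed

text \<open>Coercivity provides the inverse \<open>S\<close>. Its columns have real coordinates,
  being limits of \<open>r(a)\<close> applied to unit vectors for real polynomials \<open>r\<close>
  close to \<open>1/t\<close>. If all these coordinates were integers, \<open>f\<close> would be
  invertible over the group ring.\<close>

lemma noninteger_fundamental_solution:
  fixes f :: "('g::group_add \<Rightarrow>\<^sub>0 int)^'n^'n"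
  assumes GL: "integral_op f \<in> GL_vN" and ninv: "\<not> invertible f"
    and T: "self_adjoint_between c C (laplacian_op f)" and c: "0 < c" "c \<le> C"
  obtains x :: "('g ell2)^'n" and l k h and v :: real
  where "laplacian_op f x = axis l (delta 0)" "\<And>k h. Im (Rep_ell2 (x $ k) h) = 0"
    "Rep_ell2 (x $ k) h = complex_of_real v" "v \<notin> \<int>"
proof -
  let ?A = "laplacian_op f"
  have "\<And>x. c * (norm x)\<^sup>2 \<le> inner (?A x) x" using T by (simp add: self_adjoint_between_def)
  from coercive_invertible[OF c(1) this]
  obtain S where S: "S o\<^sub>L ?A = id_blinfun" "?A o\<^sub>L S = id_blinfun" by blast
  have "(?A o\<^sub>L S) y = y" for y unfolding S(2) by simp
  then have AS: "?A (S y) = y" for y by (simp only: blinfun_apply_blinfun_compose)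
  have real: "Im (Rep_ell2 (S (axis l (delta 0)) $ k) h) = 0" for l k h
  proof -
    let ?y = "axis l (delta 0) :: ('g ell2)^'n"
    have "\<bar>Im (Rep_ell2 (S ?y $ k) h)\<bar> \<le> 0 + e * norm (S ?y)" if e: "e > 0" for e
    proof -
      have "continuous_on {c..C} (\<lambda>t. 1 / t)" using c by (intro continuous_intros) auto
      moreover have "e / C > 0" using e c by simp
      ultimately obtain r where r: "\<And>t. c \<le> t \<Longrightarrow> t \<le> C \<Longrightarrow> \<bar>poly r t - 1 / t\<bar> < e / C"
        using real_polynomial_approx by blast
      have "\<bar>poly r t * t - 1\<bar> \<le> e" if "c \<le> t" "t \<le> C" for t
      proof -
        have t: "t > 0" using that c by simp
        have "poly r t * t - 1 = (poly r t - 1 / t) * t" using t by (simp add: field_simps)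
        then have "\<bar>poly r t * t - 1\<bar> = \<bar>poly r t - 1 / t\<bar> * t" using t by (simp add: abs_mult)
        also have "\<dots> \<le> (e / C) * C" using r[OF that] that t e c by (intro mult_mono) auto
        finally show ?thesis using c by simp
      qed
      then have "norm (poly_op r ?A (?A (S ?y)) - S ?y) \<le> e * norm (S ?y)"
        by (intro norm_poly_op_mult_le(2)[OF T]) (use e in auto)
      then have n: "norm (ell2_embed (poly_app r (laplacian f) (unit_at (l, 0))) - S ?y) \<le> e * norm (S ?y)"
        unfolding AS poly_op_ell2_embed[OF finite_support_unit_at, symmetric] ell2_embed_unit_at .
      have "\<bar>Im (Rep_ell2 (S ?y $ k) h)\<bar> =
          \<bar>Im (Rep_ell2 ((ell2_embed (poly_app r (laplacian f) (unit_at (l, 0))) - S ?y) $ k) h)\<bar>"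
        by (simp add: minus_ell2.rep_eq ell2_embed_coord[OF finite_support_poly_app[OF finite_support_unit_at]])
      also have "\<dots> \<le> norm (ell2_embed (poly_app r (laplacian f) (unit_at (l, 0))) - S ?y)"
        by (rule order_trans[OF abs_Im_le_cmod ell2_coord_le_vec])
      finally show ?thesis using n by simp
    qed
    then have bd: "\<bar>Im (Rep_ell2 (S ?y $ k) h)\<bar> \<le> e * norm (S ?y)" if "e > 0" for e
      using that by simp
    have "\<bar>Im (Rep_ell2 (S ?y $ k) h)\<bar> \<le> 0 + e" if e: "e > 0" for e
    proof -
      have "e / (norm (S ?y) + 1) * norm (S ?y) \<le> e"
        using e by (simp add: field_simps add_pos_nonneg)
      moreover have "e / (norm (S ?y) + 1) > 0" using e by (simp add: add_nonneg_pos)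
      ultimately show ?thesis using bd[of "e / (norm (S ?y) + 1)"] by linarith
    qed
    then have "\<bar>Im (Rep_ell2 (S ?y $ k) h)\<bar> \<le> 0" by (rule field_le_epsilon)
    then show ?thesis by simp
  qed
  obtain S0 where S0: "S0 o\<^sub>L integral_op f = id_blinfun" "integral_op f o\<^sub>L S0 = id_blinfun"
    using GL by (auto simp: GL_vN_def)
  have "\<exists>l k h. Rep_ell2 (S (axis l (delta 0)) $ k) h \<notin> \<int>"
  proof (rule ccontr)
    assume "\<nexists>l k h. Rep_ell2 (S (axis l (delta 0)) $ k) h \<notin> \<int>"
    then have int: "Rep_ell2 (S (axis l (delta 0)) $ k) h \<in> \<int>" for l k h by blast
    have "invertible f"
      by (rule invertible_of_integer_inverse[OF S0 AS[unfolded blinfun_apply_blinfun_compose] int])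
    then show False using ninv by simp
  qed
  then obtain l k h where lkh: "Rep_ell2 (S (axis l (delta 0)) $ k) h \<notin> \<int>" by blast
  define v where "v = Re (Rep_ell2 (S (axis l (delta 0)) $ k) h)"
  have v: "Rep_ell2 (S (axis l (delta 0)) $ k) h = complex_of_real v"
    by (rule complex_eqI) (use real in \<open>auto simp: v_def\<close>)
  have "v \<notin> \<int>" using lkh unfolding v by simp
  then show ?thesis using that[of "S (axis l (delta 0))" l k h v] AS real v by blast
qed

text \<open>\<open>h b\<close> truncates the solution \<open>x\<close> and moves only its coordinate
  \<open>v\<close> at \<open>(k, \<gamma>)\<close> to an integer, rounded down or up according to
  \<open>b\<close>. Both versions stay at distance less than 1 from \<open>x\<close>, and this is
  what shortens the replaced columns.\<close>

lemma integer_at_point_approximate_solution: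
  fixes f :: "('g::group_add \<Rightarrow>\<^sub>0 int)^'n^'n"
  assumes GL: "integral_op f \<in> GL_vN" and ninv: "\<not> invertible f"
    and T: "self_adjoint_between c C (laplacian_op f)" and c: "0 < c" "c \<le> C"
  obtains \<kappa> :: real and l k :: 'n and \<gamma> :: 'g and F :: "'g set" and h :: "bool \<Rightarrow> 'n \<times> 'g \<Rightarrow> real"
  where "0 < \<kappa>" "\<kappa> \<le> 1" "finite F" "\<gamma> \<in> F" "\<And>b k g. g \<notin> F \<Longrightarrow> h b (k, g) = 0"
    "\<And>b. h b (k, \<gamma>) \<in> \<int>" "h True (k, \<gamma>) \<noteq> h False (k, \<gamma>)"
    "\<And>b p e B. (\<And>t. c \<le> t \<Longrightarrow> t \<le> C \<Longrightarrow> \<bar>poly p t * t - 1\<bar> \<le> e) \<Longrightarrow> 0 \<le> e \<Longrightarrow> finite B \<Longrightarrow>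
      (\<Sum>i\<in>B. (poly_app p (laplacian f) (\<lambda>i. unit_at (l, 0) i - laplacian f (h b) i) i)\<^sup>2) \<le>
      (1 + e)\<^sup>2 * (1 - \<kappa>)"
proof -
  obtain x :: "('g ell2)^'n" and l k \<gamma> and v :: real
    where x: "laplacian_op f x = axis l (delta 0)" "\<And>k h. Im (Rep_ell2 (x $ k) h) = 0"
    and v: "Rep_ell2 (x $ k) \<gamma> = complex_of_real v" "v \<notin> \<int>"
    using noninteger_fundamental_solution[OF GL ninv T c] by blast
  \<comment> \<open>The larger of the distances from \<open>v\<close> to its two neighbouring
    integers; it is below 1 because \<open>v\<close> is not an integer.\<close>
  define m where "m = max (frac v) (1 - frac v)"
  have m: "0 \<le> m" "m < 1" using v(2) frac_lt_1[of v] frac_ge_0[of v] frac_eq_0_iff[of v]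
    by (auto simp: m_def max_def)
  define K where "K b = real_of_int (if b then \<lfloor>v\<rfloor> else \<lfloor>v\<rfloor> + 1)" for b
  have K: "\<bar>v - K b\<bar> \<le> m" for b unfolding K_def m_def frac_def by (cases b) auto
  \<comment> \<open>The tail may use half of the margin \<open>1 - m\<close>, which leaves the total
    distance \<open>(1 + m) / 2 < 1\<close>.\<close>
  obtain F0 where F0: "finite F0" "\<And>F' y. finite F' \<Longrightarrow> F0 \<subseteq> F' \<Longrightarrow>
    (\<And>k i. Rep_ell2 (y $ k) i = (if i \<in> F' then Rep_ell2 (x $ k) i else 0)) \<Longrightarrow> norm (x - y) \<le> (1 - m) / 2"
    using vec_ell2_tail_small[of "(1 - m) / 2" x] m by (metis diff_gt_0_iff_gt half_gt_zero)
  define F where "F = insert \<gamma> F0"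
  have F: "finite F" "F0 \<subseteq> F" using F0 by (auto simp: F_def)
  define w where "w = (\<lambda>(k,g). if g \<in> F then Re (Rep_ell2 (x $ k) g) else 0)"
  have wfin: "finite {i. w i \<noteq> 0}"
    by (rule finite_subset[of _ "UNIV \<times> F"]) (use F in \<open>auto simp: w_def split: if_splits\<close>)
  have xw: "norm (x - ell2_embed w) \<le> (1 - m) / 2"
    by (rule F0(2)[OF F], unfold ell2_embed_coord[OF wfin])
      (use x(2) in \<open>auto simp: w_def complex_eq_iff\<close>)
  define h where "h b = (\<lambda>i. (K b - v) * unit_at (k, \<gamma>) i + w i)" for b
  have hfin: "finite {i. h b i \<noteq> 0}" for b
    unfolding h_def by (rule finite_support_add[OF finite_support_unit_at wfin])
  have wk: "w (k,\<gamma>) = v" using v(1) by (simp add: w_def F_def)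
  have hk: "h b (k,\<gamma>) = K b" for b by (simp add: h_def wk unit_at_def)
  have xh: "norm (x - ell2_embed (h b)) \<le> (1 + m) / 2" for b
  proof -
    have "x - ell2_embed (h b) = (x - ell2_embed w) - (K b - v) *\<^sub>R axis k (delta \<gamma>)"
      unfolding h_def ell2_embed_add[OF finite_support_unit_at wfin] ell2_embed_unit_at by simp
    then have "norm (x - ell2_embed (h b)) \<le> norm (x - ell2_embed w) + norm ((K b - v) *\<^sub>R axis k (delta \<gamma>))"
      using norm_triangle_ineq4 by metis
    also have "\<dots> \<le> (1 - m) / 2 + m"
      by (rule add_mono) (use xw K[of b] in \<open>simp_all add: norm_axis norm_delta abs_minus_commute\<close>)
    finally show ?thesis by (simp add: field_simps)
  qed
  define \<kappa> where "\<kappa> = 1 - ((1 + m) / 2)\<^sup>2"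
  have \<kappa>: "0 < \<kappa>" "\<kappa> \<le> 1"
    using m power_strict_mono[of "(1 + m) / 2" 1 2] by (auto simp: \<kappa>_def)
  show ?thesis
  proof (rule that[OF \<kappa> F(1)])
    show "\<gamma> \<in> F" by (simp add: F_def)
    show "h b (k', g) = 0" if "g \<notin> F" for b k' g
      using that \<open>\<gamma> \<in> F\<close> by (auto simp: h_def w_def unit_at_def)
    show "h b (k, \<gamma>) \<in> \<int>" for b unfolding hk K_def by simp
    show "h True (k, \<gamma>) \<noteq> h False (k, \<gamma>)" unfolding hk K_def by simp
    fix b :: bool and p :: "real poly" and e :: real and B :: "('n \<times> 'g) set"
    assume p: "\<And>t. c \<le> t \<Longrightarrow> t \<le> C \<Longrightarrow> \<bar>poly p t * t - 1\<bar> \<le> e" and e: "0 \<le> e" and B: "finite B"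
    let ?z = "\<lambda>i. unit_at (l, 0) i - laplacian f (h b) i"
    have z: "?z = (\<lambda>i. (- 1) * laplacian f (h b) i + unit_at (l, 0) i)" by auto
    note fins = finite_support_laplacian[OF hfin[of b], of f] finite_support_unit_at[of "(l,0)"]
    have zfin: "finite {i. ?z i \<noteq> 0}" by (rule finite_subset[OF _ finite_UnI[OF fins]]) auto
    \<comment> \<open>As \<open>a x\<close> is the unit vector, \<open>?z\<close> is
      \<open>a (x - h)\<close>, and \<open>p(a)\<close> brings it back to nearly
      \<open>x - h\<close>.\<close>
    have ez: "ell2_embed ?z = laplacian_op f (x - ell2_embed (h b))"
      unfolding z ell2_embed_add[OF fins] ell2_embed_laplacian[OF hfin] ell2_embed_unit_at x(1)[symmetric]
      by (simp add: blinfun.diff_right)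
    have "(\<Sum>i\<in>B. (poly_app p (laplacian f) ?z i)\<^sup>2) \<le> (norm (ell2_embed (poly_app p (laplacian f) ?z)))\<^sup>2"
      by (rule sum_le_norm_ell2_embed[OF B finite_support_poly_app[OF zfin]])
    also have "\<dots> \<le> ((1 + e) * norm (x - ell2_embed (h b)))\<^sup>2"
      unfolding poly_op_ell2_embed[OF zfin, symmetric] ez
      by (intro power_mono norm_poly_op_mult_le[OF T e p]) auto
    also have "\<dots> \<le> ((1 + e) * ((1 + m) / 2))\<^sup>2"
      using xh[of b] e by (intro power_mono mult_left_mono) auto
    also have "\<dots> = (1 + e)\<^sup>2 * (1 - \<kappa>)" unfolding \<kappa>_def power_mult_distrib by simp
    finally show "(\<Sum>i\<in>B. (poly_app p (laplacian f) ?z i)\<^sup>2) \<le> (1 + e)\<^sup>2 * (1 - \<kappa>)" .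
  qed
qed

section \<open>Permutation models\<close>

lemma weighted_sum_square_le:
  fixes a v :: "'a \<Rightarrow> real"
  assumes "finite I"
  shows "(\<Sum>i\<in>I. a i * v i)\<^sup>2 \<le> (\<Sum>i\<in>I. \<bar>a i\<bar>) * (\<Sum>i\<in>I. \<bar>a i\<bar> * (v i)\<^sup>2)"
proof -
  have "(\<Sum>i\<in>I. a i * v i)\<^sup>2 \<le> (\<Sum>i\<in>I. sqrt \<bar>a i\<bar> * (sqrt \<bar>a i\<bar> * \<bar>v i\<bar>))\<^sup>2"
  proof (rule power2_le_iff_abs_le[THEN iffD2])
    show "0 \<le> (\<Sum>i\<in>I. sqrt \<bar>a i\<bar> * (sqrt \<bar>a i\<bar> * \<bar>v i\<bar>))" by (intro sum_nonneg) auto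
    show "\<bar>\<Sum>i\<in>I. a i * v i\<bar> \<le> (\<Sum>i\<in>I. sqrt \<bar>a i\<bar> * (sqrt \<bar>a i\<bar> * \<bar>v i\<bar>))"
      by (rule order_trans[OF sum_abs]) (auto simp: abs_mult mult.assoc[symmetric])
  qed
  also have "\<dots> \<le> (\<Sum>i\<in>I. (sqrt \<bar>a i\<bar>)\<^sup>2) * (\<Sum>i\<in>I. (sqrt \<bar>a i\<bar> * \<bar>v i\<bar>)\<^sup>2)"
    by (rule Cauchy_Schwarz_ineq_sum)
  finally show ?thesis by (simp add: power_mult_distrib)
qed

text \<open>Row and column sums of a model are bounded by the coefficients of \<open>f\<close>
  alone, so this test gives norm bounds uniform in the number of points.\<close>

lemma schur_test:
  fixes a :: "'a \<Rightarrow> 'b \<Rightarrow> real"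
  assumes I: "finite I" "finite J" and L: "L \<ge> 0"
    and row: "\<And>i. i \<in> I \<Longrightarrow> (\<Sum>j\<in>J. \<bar>a i j\<bar>) \<le> L"
    and col: "\<And>j. j \<in> J \<Longrightarrow> (\<Sum>i\<in>I. \<bar>a i j\<bar>) \<le> L"
  shows "(\<Sum>i\<in>I. (\<Sum>j\<in>J. a i j * v j)\<^sup>2) \<le> L\<^sup>2 * (\<Sum>j\<in>J. (v j)\<^sup>2)"
proof -
  have "(\<Sum>i\<in>I. (\<Sum>j\<in>J. a i j * v j)\<^sup>2) \<le> (\<Sum>i\<in>I. L * (\<Sum>j\<in>J. \<bar>a i j\<bar> * (v j)\<^sup>2))"
    by (intro sum_mono order_trans[OF weighted_sum_square_le[OF I(2)]] mult_right_mono row sum_nonneg) auto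
  also have "\<dots> = L * (\<Sum>j\<in>J. (\<Sum>i\<in>I. \<bar>a i j\<bar>) * (v j)\<^sup>2)"
    by (simp add: sum_distrib_left sum_distrib_right) (rule sum.swap)
  also have "\<dots> \<le> L * (\<Sum>j\<in>J. L * (v j)\<^sup>2)"
    using L col by (intro mult_left_mono sum_mono mult_right_mono) auto
  finally show ?thesis by (simp add: sum_distrib_left power2_eq_square mult.assoc)
qed

definition coeff_norm :: "('g::group_add \<Rightarrow>\<^sub>0 int)^'n^'n \<Rightarrow> real" where
  "coeff_norm f = (\<Sum>k\<in>UNIV. \<Sum>l\<in>UNIV. \<Sum>q\<in>Poly_Mapping.keys (f $ k $ l).
     \<bar>real_of_int (Poly_Mapping.lookup (f $ k $ l) q)\<bar>)"

definition coeff_supp :: "('g::group_add \<Rightarrow>\<^sub>0 int)^'n^'n \<Rightarrow> 'g set" where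
  "coeff_supp f = (\<Union>k\<in>UNIV. \<Union>l\<in>UNIV. Poly_Mapping.keys (f $ k $ l))"

lemma finite_coeff_supp [simp]: "finite (coeff_supp f)"
  by (simp add: coeff_supp_def)

lemma keys_coeff_supp: "q \<in> Poly_Mapping.keys (f $ k $ l) \<Longrightarrow> q \<in> coeff_supp f"
  by (auto simp: coeff_supp_def)

text \<open>The polynomial with absolute values as coefficients, evaluated at \<open>C\<close>. It
  bounds \<open>p(T)\<close> by the norm of \<open>T\<close> alone and hence also covers the points
  where the model does not resemble the group.\<close>

definition poly_bound :: "real \<Rightarrow> real poly \<Rightarrow> real" where
  "poly_bound C p = fold_coeffs (\<lambda>a b. \<bar>a\<bar> + C * b) p 0"

lemma poly_bound_0 [simp]: "poly_bound C 0 = 0"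
  by (simp add: poly_bound_def)

lemma poly_bound_pCons: "poly_bound C (pCons a p) = \<bar>a\<bar> + C * poly_bound C p"
  by (cases "a = 0 \<and> p = 0") (auto simp: poly_bound_def)

lemma poly_bound_nonneg: "0 \<le> C \<Longrightarrow> 0 \<le> poly_bound C p"
  by (induction p) (auto simp: poly_bound_pCons)

text \<open>Translates by support elements and by their inverses, so that one set serves both
  \<open>f\<close> and its adjoint.\<close>

definition expand :: "('g::group_add \<Rightarrow>\<^sub>0 int)^'n^'n \<Rightarrow> 'g set \<Rightarrow> 'g set" where
  "expand f X = X \<union> (\<Union>q\<in>coeff_supp f. (\<lambda>g. q + g) ` X) \<union> (\<Union>q\<in>coeff_supp f. (\<lambda>g. - q + g) ` X)"

lemma finite_expand: "finite X \<Longrightarrow> finite (expand f X)"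
  by (simp add: expand_def)

definition supported :: "'g set \<Rightarrow> ('n \<times> 'g \<Rightarrow> real) \<Rightarrow> bool" where
  "supported X w \<longleftrightarrow> (\<forall>k g. g \<notin> X \<longrightarrow> w (k, g) = 0)"

lemma supported_mono: "supported X w \<Longrightarrow> X \<subseteq> Y \<Longrightarrow> supported Y w"
  by (auto simp: supported_def)

lemma supported_act: "supported X w \<Longrightarrow> supported (expand f X) (act f w)"
  unfolding supported_def act_def expand_def prod.case
proof (intro allI impI sum.neutral ballI)
  fix k h l g
  assume w: "\<forall>k g. g \<notin> X \<longrightarrow> w (k, g) = 0"
    and h: "h \<notin> X \<union> (\<Union>q\<in>coeff_supp f. (\<lambda>g. q + g) ` X) \<union> (\<Union>q\<in>coeff_supp f. (\<lambda>g. - q + g) ` X)"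
    and g: "g \<in> Poly_Mapping.keys (f $ k $ l)"
  have "h = g + (- g + h)" by (simp flip: add.assoc)
  then have "- g + h \<notin> X" using h keys_coeff_supp[OF g] by blast
  then show "real_of_int (Poly_Mapping.lookup (f $ k $ l) g) * w (l, - g + h) = 0" using w by simp
qed

lemma expand_adj_matrix: "expand (adj_matrix f) X = expand f X"
proof -
  have "coeff_supp (adj_matrix f) = uminus ` coeff_supp f"
  proof
    show "coeff_supp (adj_matrix f) \<subseteq> uminus ` coeff_supp f"
    proof
      fix q assume "q \<in> coeff_supp (adj_matrix f)"
      then have "- q \<in> coeff_supp f"
        by (auto simp: coeff_supp_def adj_matrix_def in_keys_iff lookup_map_key_uminus)
      then show "q \<in> uminus ` coeff_supp f" by (metis image_eqI minus_minus)
    qed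
    show "uminus ` coeff_supp f \<subseteq> coeff_supp (adj_matrix f)"
      by (auto simp: coeff_supp_def adj_matrix_def in_keys_iff lookup_map_key_uminus) blast
  qed
  then show ?thesis unfolding expand_def by auto
qed

lemma supported_act_adj: "supported X w \<Longrightarrow> supported (expand f X) (act_adj f w)"
  unfolding act_adj_eq expand_adj_matrix[of f, symmetric] by (rule supported_act)

lemma supported_laplacian: "supported X w \<Longrightarrow> supported (expand f (expand f X)) (laplacian f w)"
  unfolding laplacian_def by (intro supported_act_adj supported_act)

definition nbhd :: "('g::group_add \<Rightarrow>\<^sub>0 int)^'n^'n \<Rightarrow> nat \<Rightarrow> 'g set \<Rightarrow> 'g set" where
  "nbhd f m X = (expand f ^^ m) X"

lemma nbhd_0 [simp]: "nbhd f 0 X = X" and nbhd_Suc: "nbhd f (Suc m) X = expand f (nbhd f m X)"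
  by (simp_all add: nbhd_def)

lemma finite_nbhd: "finite X \<Longrightarrow> finite (nbhd f m X)"
  by (induction m) (simp_all add: nbhd_Suc finite_expand)

lemma nbhd_mono: "m \<le> m' \<Longrightarrow> nbhd f m X \<subseteq> nbhd f m' X"
  by (rule lift_Suc_mono_le[of "\<lambda>m. nbhd f m X"]) (auto simp: nbhd_Suc expand_def)

section \<open>Finite models\<close>

text \<open>The maps \<open>\<sigma> g\<close> are arbitrary permutations here. Multiplicativity is
  asked for pointwise, through \<open>good\<close>.\<close>

locale permutation_model =
  fixes f :: "('g::group_add \<Rightarrow>\<^sub>0 int)^'n^'n" and d :: nat and \<sigma> :: "'g \<Rightarrow> nat \<Rightarrow> nat"
  assumes perm: "\<And>g. \<sigma> g permutes {1..d}"
begin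

definition I :: "('n \<times> nat) set" where "I = UNIV \<times> {1..d}"

lemma finite_I [simp]: "finite I" by (simp add: I_def)

lemma card_I: "card I = CARD('n) * d" by (simp add: I_def card_cartesian_product)

lemma sum_I: "(\<Sum>i\<in>I. u i) = (\<Sum>k\<in>UNIV. \<Sum>i\<in>{1..d}. u (k, i))"
  unfolding I_def by (simp add: sum.cartesian_product)

lemma \<sigma>_mem [simp]: "\<sigma> g s \<in> {1..d} \<longleftrightarrow> s \<in> {1..d}"
  using perm[of g] by (rule permutes_in_image)

lemma \<sigma>_inj: "\<sigma> g s = \<sigma> g t \<longleftrightarrow> s = t"
  using permutes_inj[OF perm[of g]] by (auto dest: injD)

text \<open>The matrix of \<open>f\<close> with the translation by \<open>q\<close> replaced by the
  permutation matrix of \<open>\<sigma> q\<close>.\<close>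

definition model_kernel :: "'n \<times> nat \<Rightarrow> 'n \<times> nat \<Rightarrow> real" where
  "model_kernel = (\<lambda>(k,i) (l,j). \<Sum>q\<in>Poly_Mapping.keys (f $ k $ l).
     real_of_int (Poly_Mapping.lookup (f $ k $ l) q) * (if \<sigma> q j = i then 1 else 0))"

definition model_app :: "('n \<times> nat \<Rightarrow> real) \<Rightarrow> 'n \<times> nat \<Rightarrow> real" where
  "model_app v i = (\<Sum>j\<in>I. model_kernel i j * v j)"

definition model_adj :: "('n \<times> nat \<Rightarrow> real) \<Rightarrow> 'n \<times> nat \<Rightarrow> real" where
  "model_adj v j = (\<Sum>i\<in>I. model_kernel i j * v i)"

text \<open>The transpose of the model of \<open>f\<close> times that model, rather than the model
  of \<open>f* f\<close>: this is symmetric and positive semidefinite for every choice of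
  \<open>\<sigma>\<close>.\<close>

definition lap_kernel :: "'n \<times> nat \<Rightarrow> 'n \<times> nat \<Rightarrow> real" where
  "lap_kernel i j = (\<Sum>m\<in>I. model_kernel m i * model_kernel m j)"

definition model_lap :: "('n \<times> nat \<Rightarrow> real) \<Rightarrow> 'n \<times> nat \<Rightarrow> real" where
  "model_lap = ker_app I lap_kernel"

lemma model_lap_eq: "i \<in> I \<Longrightarrow> model_lap v i = model_adj (model_app v) i"
proof -
  assume "i \<in> I"
  then have "model_lap v i = (\<Sum>j\<in>I. \<Sum>m\<in>I. model_kernel m i * (model_kernel m j * v j))"
    by (simp add: model_lap_def ker_app_def lap_kernel_def sum_distrib_right mult.assoc)
  also have "\<dots> = model_adj (model_app v) i"
    unfolding model_adj_def model_app_def sum_distrib_left by (rule sum.swap)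
  finally show ?thesis .
qed

lemma model_kernel_Ints: "model_kernel i j \<in> \<int>"
  unfolding model_kernel_def by (auto split: prod.split intro!: Ints_sum)

lemma lap_kernel_Ints: "lap_kernel i j \<in> \<int>"
  unfolding lap_kernel_def by (intro Ints_sum Ints_mult model_kernel_Ints)

lemma lap_kernel_sym: "lap_kernel i j = lap_kernel j i"
  by (simp add: lap_kernel_def mult.commute)

lemma sum_single_point: "(\<Sum>i\<in>{1..d}. if \<sigma> q s = i then 1 else (0::real)) \<le> 1"
  "(\<Sum>s\<in>{1..d}. if \<sigma> q s = i then 1 else (0::real)) \<le> 1"
proof -
  show "(\<Sum>i\<in>{1..d}. if \<sigma> q s = i then 1 else (0::real)) \<le> 1" by simp
  have "(\<Sum>s\<in>{1..d}. if \<sigma> q s = i then 1 else (0::real)) = real (card ({1..d} \<inter> {s. \<sigma> q s = i}))"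
    by (simp add: sum.If_cases)
  moreover have "card ({1..d} \<inter> {s. \<sigma> q s = i}) \<le> Suc 0"
    using \<sigma>_inj[of q] by (subst card_le_Suc0_iff_eq) auto
  ultimately show "(\<Sum>s\<in>{1..d}. if \<sigma> q s = i then 1 else (0::real)) \<le> 1" by simp
qed

lemma abs_model_kernel_le: "\<bar>model_kernel (k,i) (l,j)\<bar> \<le> (\<Sum>q\<in>Poly_Mapping.keys (f $ k $ l).
     \<bar>real_of_int (Poly_Mapping.lookup (f $ k $ l) q)\<bar> * (if \<sigma> q j = i then 1 else 0))"
  unfolding model_kernel_def prod.case by (rule order_trans[OF sum_abs]) (simp add: abs_mult)

lemma coeff_norm_nonneg: "0 \<le> coeff_norm f"
  unfolding coeff_norm_def by (intro sum_nonneg) auto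

lemma row_sum_le: "(\<Sum>j\<in>I. \<bar>model_kernel i j\<bar>) \<le> coeff_norm f"
proof -
  obtain k s where i: "i = (k,s)" by (cases i)
  have "(\<Sum>j\<in>I. \<bar>model_kernel i j\<bar>) \<le> (\<Sum>l\<in>UNIV. \<Sum>j\<in>{1..d}. \<Sum>q\<in>Poly_Mapping.keys (f $ k $ l).
      \<bar>real_of_int (Poly_Mapping.lookup (f $ k $ l) q)\<bar> * (if \<sigma> q j = s then 1 else 0))"
    unfolding sum_I i by (intro sum_mono abs_model_kernel_le)
  also have "\<dots> = (\<Sum>l\<in>UNIV. \<Sum>q\<in>Poly_Mapping.keys (f $ k $ l).
      \<bar>real_of_int (Poly_Mapping.lookup (f $ k $ l) q)\<bar> * (\<Sum>j\<in>{1..d}. if \<sigma> q j = s then 1 else 0))"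
    unfolding sum_distrib_left by (intro sum.cong refl sum.swap)
  also have "\<dots> \<le> (\<Sum>l\<in>UNIV. \<Sum>q\<in>Poly_Mapping.keys (f $ k $ l).
      \<bar>real_of_int (Poly_Mapping.lookup (f $ k $ l) q)\<bar> * 1)"
    by (intro sum_mono mult_left_mono sum_single_point) auto
  also have "\<dots> \<le> coeff_norm f"
    unfolding coeff_norm_def mult_1_right
    by (rule member_le_sum[where f = "\<lambda>k. \<Sum>l\<in>UNIV. \<Sum>q\<in>Poly_Mapping.keys (f $ k $ l).
      \<bar>real_of_int (Poly_Mapping.lookup (f $ k $ l) q)\<bar>"]) (auto intro!: sum_nonneg)
  finally show ?thesis .
qed

lemma col_sum_le: "(\<Sum>i\<in>I. \<bar>model_kernel i j\<bar>) \<le> coeff_norm f"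
proof -
  obtain l s where j: "j = (l,s)" by (cases j)
  have "(\<Sum>i\<in>I. \<bar>model_kernel i j\<bar>) \<le> (\<Sum>k\<in>UNIV. \<Sum>i\<in>{1..d}. \<Sum>q\<in>Poly_Mapping.keys (f $ k $ l).
      \<bar>real_of_int (Poly_Mapping.lookup (f $ k $ l) q)\<bar> * (if \<sigma> q s = i then 1 else 0))"
    unfolding sum_I j by (intro sum_mono abs_model_kernel_le)
  also have "\<dots> = (\<Sum>k\<in>UNIV. \<Sum>q\<in>Poly_Mapping.keys (f $ k $ l).
      \<bar>real_of_int (Poly_Mapping.lookup (f $ k $ l) q)\<bar> * (\<Sum>i\<in>{1..d}. if \<sigma> q s = i then 1 else 0))"
    unfolding sum_distrib_left by (intro sum.cong refl sum.swap)
  also have "\<dots> \<le> (\<Sum>k\<in>UNIV. \<Sum>q\<in>Poly_Mapping.keys (f $ k $ l).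
      \<bar>real_of_int (Poly_Mapping.lookup (f $ k $ l) q)\<bar> * 1)"
    by (intro sum_mono mult_left_mono sum_single_point) auto
  also have "\<dots> \<le> coeff_norm f"
    unfolding coeff_norm_def mult_1_right
    by (intro sum_mono member_le_sum[where f = "\<lambda>l. \<Sum>q\<in>Poly_Mapping.keys (f $ _ $ l).
      \<bar>real_of_int (Poly_Mapping.lookup (f $ _ $ l) q)\<bar>"]) (auto intro!: sum_nonneg)
  finally show ?thesis .
qed

lemma model_app_norm: "(\<Sum>i\<in>I. (model_app v i)\<^sup>2) \<le> (coeff_norm f)\<^sup>2 * (\<Sum>i\<in>I. (v i)\<^sup>2)"
  unfolding model_app_def
  by (rule schur_test) (simp_all add: coeff_norm_nonneg row_sum_le col_sum_le)

lemma model_adj_norm: "(\<Sum>i\<in>I. (model_adj v i)\<^sup>2) \<le> (coeff_norm f)\<^sup>2 * (\<Sum>i\<in>I. (v i)\<^sup>2)"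
  unfolding model_adj_def
  by (rule schur_test[where a = "\<lambda>j i. model_kernel i j"]) (simp_all add: coeff_norm_nonneg row_sum_le col_sum_le)

lemma model_lap_quadratic: "(\<Sum>i\<in>I. v i * model_lap v i) = (\<Sum>i\<in>I. (model_app v i)\<^sup>2)"
proof -
  have "(\<Sum>i\<in>I. v i * model_lap v i) = (\<Sum>i\<in>I. \<Sum>m\<in>I. v i * (model_kernel m i * model_app v m))"
    by (simp add: model_lap_eq model_adj_def sum_distrib_left)
  also have "\<dots> = (\<Sum>m\<in>I. \<Sum>i\<in>I. (model_kernel m i * v i) * model_app v m)"
    by (subst sum.swap) (simp add: ac_simps)
  also have "\<dots> = (\<Sum>m\<in>I. (model_app v m)\<^sup>2)"
    by (simp add: sum_distrib_right[symmetric] model_app_def[symmetric] power2_eq_square)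
  finally show ?thesis .
qed

lemma model_lap_norm: "(\<Sum>i\<in>I. (model_lap v i)\<^sup>2) \<le> ((coeff_norm f)\<^sup>2)\<^sup>2 * (\<Sum>i\<in>I. (v i)\<^sup>2)"
proof -
  have "(\<Sum>i\<in>I. (model_lap v i)\<^sup>2) = (\<Sum>i\<in>I. (model_adj (model_app v) i)\<^sup>2)"
    by (simp add: model_lap_eq)
  also have "\<dots> \<le> (coeff_norm f)\<^sup>2 * ((coeff_norm f)\<^sup>2 * (\<Sum>i\<in>I. (v i)\<^sup>2))"
    by (rule order_trans[OF model_adj_norm mult_left_mono[OF model_app_norm]]) simp
  finally show ?thesis by (simp add: power2_eq_square mult.assoc)
qed

lemma model_lap_cong: "(\<And>i. i \<in> I \<Longrightarrow> v i = w i) \<Longrightarrow> model_lap v = model_lap w"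
  unfolding model_lap_def ker_app_def by (intro ext) auto

lemma poly_app_model_cong:
  assumes "\<And>i. i \<in> I \<Longrightarrow> v i = w i" "i \<in> I"
  shows "poly_app p model_lap v i = poly_app p model_lap w i"
  using assms(2)
proof (induction p arbitrary: i)
  case (pCons a p)
  have "model_lap (poly_app p model_lap v) = model_lap (poly_app p model_lap w)"
    by (rule model_lap_cong) (rule pCons.IH)
  then show ?case using pCons.prems assms(1) by (simp add: poly_app_pCons model_lap_def)
qed simp

end

context permutation_model
begin

lemma model_lap_L2: "L2_set (model_lap v) I \<le> (coeff_norm f)\<^sup>2 * L2_set v I"
proof -
  have "L2_set (model_lap v) I \<le> sqrt (((coeff_norm f)\<^sup>2)\<^sup>2 * (\<Sum>i\<in>I. (v i)\<^sup>2))"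
    unfolding L2_set_def by (intro real_sqrt_le_mono model_lap_norm)
  then show ?thesis
    by (simp only: real_sqrt_mult real_sqrt_abs abs_power2 L2_set_def)
qed

lemma L2_set_scale: "L2_set (\<lambda>i. a * v i) A = \<bar>a\<bar> * L2_set v A"
  by (simp add: L2_set_def power_mult_distrib sum_distrib_left[symmetric] real_sqrt_mult)

lemma poly_app_L2: "L2_set (poly_app p model_lap v) I \<le> poly_bound ((coeff_norm f)\<^sup>2) p * L2_set v I"
proof (induction p)
  case 0
  show ?case by (simp add: L2_set_def)
next
  case (pCons a p)
  have "L2_set (poly_app (pCons a p) model_lap v) I =
      L2_set (\<lambda>i. a * v i + model_lap (poly_app p model_lap v) i) I"
    by (subst poly_app_pCons) (simp_all add: model_lap_def)
  also have "\<dots> \<le> L2_set (\<lambda>i. a * v i) I + L2_set (model_lap (poly_app p model_lap v)) I"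
    by (rule L2_set_triangle_ineq)
  also have "\<dots> \<le> \<bar>a\<bar> * L2_set v I + (coeff_norm f)\<^sup>2 * (poly_bound ((coeff_norm f)\<^sup>2) p * L2_set v I)"
    unfolding L2_set_scale
    by (intro add_left_mono order_trans[OF model_lap_L2] mult_left_mono pCons.IH) simp
  finally show ?case by (simp add: poly_bound_pCons algebra_simps)
qed

section \<open>Transport from the group to a model\<close>

text \<open>Pushforward of \<open>w\<close> along \<open>g \<mapsto> \<sigma> g s\<close>. Summing
  over the fibres keeps it additive on finitely supported functions even where this map is not
  injective.\<close>

definition loc :: "nat \<Rightarrow> ('n \<times> 'g \<Rightarrow> real) \<Rightarrow> 'n \<times> nat \<Rightarrow> real" where
  "loc s w = (\<lambda>(k,i). \<Sum>g\<in>{g. w (k,g) \<noteq> 0 \<and> \<sigma> g s = i}. w (k,g))"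

lemma loc_eq:
  assumes "finite D" "supported D w"
  shows "loc s w (k,i) = (\<Sum>g\<in>D. if \<sigma> g s = i then w (k,g) else 0)"
proof -
  have "(\<Sum>g\<in>D. if \<sigma> g s = i then w (k,g) else 0) = (\<Sum>g\<in>{g\<in>D. \<sigma> g s = i}. w (k,g))"
    using assms(1) by (simp add: sum.inter_filter)
  also have "\<dots> = (\<Sum>g\<in>{g. w (k,g) \<noteq> 0 \<and> \<sigma> g s = i}. w (k,g))"
    by (rule sum.mono_neutral_right) (use assms in \<open>auto simp: supported_def\<close>)
  finally show ?thesis by (simp add: loc_def)
qed

text \<open>The last two equations serve \<open>f\<close> and its adjoint respectively; the second
  takes the place of a relation between \<open>\<sigma> (- q)\<close> and the inverse of
  \<open>\<sigma> q\<close>.\<close>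

definition good :: "'g set \<Rightarrow> nat \<Rightarrow> bool" where
  "good D s \<longleftrightarrow> s \<in> {1..d} \<and> inj_on (\<lambda>g. \<sigma> g s) D \<and> \<sigma> 0 s = s \<and>
     (\<forall>q\<in>coeff_supp f. \<forall>g\<in>D. \<sigma> (q + g) s = \<sigma> q (\<sigma> g s) \<and> \<sigma> g s = \<sigma> q (\<sigma> (- q + g) s))"

lemma good_antimono: "good D s \<Longrightarrow> D' \<subseteq> D \<Longrightarrow> good D' s"
  unfolding good_def by (meson inj_on_subset subsetD)

text \<open>At a good point \<open>\<sigma> q (\<sigma> g s) = \<sigma> (q + g) s\<close>; the
  substitution \<open>h = q + g\<close> then turns the model sum into the transported
  convolution.\<close>

lemma model_app_loc:
  assumes X: "finite X" "supported X w" and s: "good X s" and i: "i \<in> I"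
  shows "model_app (loc s w) i = loc s (act f w) i"
proof -
  obtain k t where kt: "i = (k,t)" by (cases i)
  have s1: "s \<in> {1..d}" using s by (simp add: good_def)
  let ?c = "\<lambda>l q. real_of_int (Poly_Mapping.lookup (f $ k $ l) q)"
  have "model_app (loc s w) i = (\<Sum>l\<in>UNIV. \<Sum>j\<in>{1..d}. \<Sum>q\<in>Poly_Mapping.keys (f $ k $ l). \<Sum>g\<in>X.
      ?c l q * (if \<sigma> q j = t then 1 else 0) * (if \<sigma> g s = j then w (l,g) else 0))"
    unfolding model_app_def sum_I kt model_kernel_def prod.case loc_eq[OF X]
    by (simp only: sum_distrib_right sum_distrib_left)
      (intro sum.cong refl sum.swap)
  also have "\<dots> = (\<Sum>l\<in>UNIV. \<Sum>q\<in>Poly_Mapping.keys (f $ k $ l). \<Sum>g\<in>X. \<Sum>j\<in>{1..d}.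
      ?c l q * (if \<sigma> q j = t then 1 else 0) * (if \<sigma> g s = j then w (l,g) else 0))"
    by (subst sum.swap[of _ _ "{1..d}"], subst (2) sum.swap) (rule refl)
  also have "\<dots> = (\<Sum>l\<in>UNIV. \<Sum>q\<in>Poly_Mapping.keys (f $ k $ l). \<Sum>g\<in>X.
      ?c l q * (if \<sigma> (q + g) s = t then w (l,g) else 0))"
  proof (intro sum.cong refl)
    fix l q g assume q: "q \<in> Poly_Mapping.keys (f $ k $ l)" and g: "g \<in> X"
    have e: "\<sigma> (q + g) s = \<sigma> q (\<sigma> g s)" using s g keys_coeff_supp[OF q] by (simp add: good_def)
    have "(\<Sum>j\<in>{1..d}. ?c l q * (if \<sigma> q j = t then 1 else 0) * (if \<sigma> g s = j then w (l,g) else 0)) =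
        (\<Sum>j\<in>{1..d}. if \<sigma> g s = j then ?c l q * (if \<sigma> q (\<sigma> g s) = t then w (l,g) else 0) else 0)"
      by (intro sum.cong) auto
    then show "(\<Sum>j\<in>{1..d}. ?c l q * (if \<sigma> q j = t then 1 else 0) * (if \<sigma> g s = j then w (l,g) else 0)) =
        ?c l q * (if \<sigma> (q + g) s = t then w (l,g) else 0)"
      using s1 by (simp only: sum.delta' finite_atLeastAtMost \<sigma>_mem if_True e)
  qed
  also have "\<dots> = (\<Sum>l\<in>UNIV. \<Sum>q\<in>Poly_Mapping.keys (f $ k $ l). \<Sum>h\<in>expand f X.
      ?c l q * (if \<sigma> h s = t then w (l, - q + h) else 0))"
  proof (rule sum.cong[OF refl], rule sum.cong[OF refl])
    fix l q assume q: "q \<in> Poly_Mapping.keys (f $ k $ l)"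
    have "(\<Sum>g\<in>X. ?c l q * (if \<sigma> (q + g) s = t then w (l,g) else 0)) =
        (\<Sum>h\<in>(\<lambda>g. q + g) ` X. ?c l q * (if \<sigma> h s = t then w (l, - q + h) else 0))"
      by (subst sum.reindex) (auto simp: inj_on_def intro!: sum.cong)
    also have "\<dots> = (\<Sum>h\<in>expand f X. ?c l q * (if \<sigma> h s = t then w (l, - q + h) else 0))"
    proof (rule sum.mono_neutral_left)
      show "(\<lambda>g. q + g) ` X \<subseteq> expand f X" using keys_coeff_supp[OF q] by (auto simp: expand_def)
      show "\<forall>h\<in>expand f X - (\<lambda>g. q + g) ` X. ?c l q * (if \<sigma> h s = t then w (l, - q + h) else 0) = 0"
      proof
        fix h assume h: "h \<in> expand f X - (\<lambda>g. q + g) ` X"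
        have "h = q + (- q + h)" by (simp flip: add.assoc)
        then have "- q + h \<notin> X" using h by blast
        then show "?c l q * (if \<sigma> h s = t then w (l, - q + h) else 0) = 0"
          using X(2) by (simp add: supported_def)
      qed
    qed (simp add: finite_expand X)
    finally show "(\<Sum>g\<in>X. ?c l q * (if \<sigma> (q + g) s = t then w (l,g) else 0)) =
      (\<Sum>h\<in>expand f X. ?c l q * (if \<sigma> h s = t then w (l, - q + h) else 0))" .
  qed
  also have "\<dots> = (\<Sum>h\<in>expand f X. \<Sum>l\<in>UNIV. \<Sum>q\<in>Poly_Mapping.keys (f $ k $ l).
      ?c l q * (if \<sigma> h s = t then w (l, - q + h) else 0))"
    by (subst sum.swap[of _ _ "expand f X"], subst (2) sum.swap) (rule refl)
  also have "\<dots> = loc s (act f w) i"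
    unfolding kt loc_eq[OF finite_expand[OF X(1)] supported_act[OF X(2)]]
    by (intro sum.cong) (auto simp: act_def)
  finally show ?thesis .
qed

lemma model_adj_loc:
  assumes X: "finite X" "supported X w" and s: "good X s" and i: "i \<in> I"
  shows "model_adj (loc s w) i = loc s (act_adj f w) i"
proof -
  obtain l t where lt: "i = (l,t)" by (cases i)
  have t1: "t \<in> {1..d}" using i by (simp add: lt I_def)
  let ?c = "\<lambda>k q. real_of_int (Poly_Mapping.lookup (f $ k $ l) q)"
  have "model_adj (loc s w) i = (\<Sum>k\<in>UNIV. \<Sum>j\<in>{1..d}. \<Sum>q\<in>Poly_Mapping.keys (f $ k $ l).
      ?c k q * (if \<sigma> q t = j then 1 else 0) * loc s w (k,j))"
    unfolding model_adj_def sum_I lt model_kernel_def prod.case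
    by (simp only: sum_distrib_right)
  also have "\<dots> = (\<Sum>k\<in>UNIV. \<Sum>q\<in>Poly_Mapping.keys (f $ k $ l). \<Sum>j\<in>{1..d}.
      ?c k q * (if \<sigma> q t = j then 1 else 0) * loc s w (k,j))"
    by (intro sum.cong refl sum.swap)
  also have "\<dots> = (\<Sum>k\<in>UNIV. \<Sum>q\<in>Poly_Mapping.keys (f $ k $ l). ?c k q * loc s w (k, \<sigma> q t))"
  proof (intro sum.cong refl)
    fix k q
    have "(\<Sum>j\<in>{1..d}. ?c k q * (if \<sigma> q t = j then 1 else 0) * loc s w (k,j)) =
        (\<Sum>j\<in>{1..d}. if \<sigma> q t = j then ?c k q * loc s w (k, \<sigma> q t) else 0)"
      by (intro sum.cong) auto
    then show "(\<Sum>j\<in>{1..d}. ?c k q * (if \<sigma> q t = j then 1 else 0) * loc s w (k,j)) = ?c k q * loc s w (k, \<sigma> q t)"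
      using t1 by (simp only: sum.delta' finite_atLeastAtMost \<sigma>_mem if_True)
  qed
  also have "\<dots> = (\<Sum>k\<in>UNIV. \<Sum>q\<in>Poly_Mapping.keys (f $ k $ l). \<Sum>g\<in>X.
      ?c k q * (if \<sigma> (- q + g) s = t then w (k,g) else 0))"
    unfolding loc_eq[OF X] sum_distrib_left
  proof (intro sum.cong refl)
    fix k q g assume q: "q \<in> Poly_Mapping.keys (f $ k $ l)" and g: "g \<in> X"
    \<comment> \<open>Injectivity of \<open>\<sigma> q\<close> turns the transposed matrix entry
      into a condition on \<open>- q + g\<close>.\<close>
    have "\<sigma> g s = \<sigma> q (\<sigma> (- q + g) s)" using s g keys_coeff_supp[OF q] by (simp add: good_def)
    then have "\<sigma> g s = \<sigma> q t \<longleftrightarrow> \<sigma> (- q + g) s = t" using \<sigma>_inj[of q] by metis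
    then show "?c k q * (if \<sigma> g s = \<sigma> q t then w (k,g) else 0) =
        ?c k q * (if \<sigma> (- q + g) s = t then w (k,g) else 0)" by simp
  qed
  also have "\<dots> = (\<Sum>k\<in>UNIV. \<Sum>q\<in>Poly_Mapping.keys (f $ k $ l). \<Sum>h\<in>expand f X.
      ?c k q * (if \<sigma> h s = t then w (k, q + h) else 0))"
  proof (rule sum.cong[OF refl], rule sum.cong[OF refl])
    fix k q assume q: "q \<in> Poly_Mapping.keys (f $ k $ l)"
    have "(\<Sum>g\<in>X. ?c k q * (if \<sigma> (- q + g) s = t then w (k,g) else 0)) =
        (\<Sum>h\<in>(\<lambda>g. - q + g) ` X. ?c k q * (if \<sigma> h s = t then w (k, q + h) else 0))"
      by (subst sum.reindex) (auto simp: inj_on_def intro!: sum.cong)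
    also have "\<dots> = (\<Sum>h\<in>expand f X. ?c k q * (if \<sigma> h s = t then w (k, q + h) else 0))"
    proof (rule sum.mono_neutral_left)
      show "(\<lambda>g. - q + g) ` X \<subseteq> expand f X" using keys_coeff_supp[OF q] by (auto simp: expand_def)
      show "\<forall>h\<in>expand f X - (\<lambda>g. - q + g) ` X. ?c k q * (if \<sigma> h s = t then w (k, q + h) else 0) = 0"
      proof
        fix h assume h: "h \<in> expand f X - (\<lambda>g. - q + g) ` X"
        have "h = - q + (q + h)" by (simp flip: add.assoc)
        then have "q + h \<notin> X" using h by blast
        then show "?c k q * (if \<sigma> h s = t then w (k, q + h) else 0) = 0"
          using X(2) by (simp add: supported_def)
      qed
    qed (simp add: finite_expand X)
    finally show "(\<Sum>g\<in>X. ?c k q * (if \<sigma> (- q + g) s = t then w (k,g) else 0)) =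
      (\<Sum>h\<in>expand f X. ?c k q * (if \<sigma> h s = t then w (k, q + h) else 0))" .
  qed
  also have "\<dots> = (\<Sum>h\<in>expand f X. \<Sum>k\<in>UNIV. \<Sum>q\<in>Poly_Mapping.keys (f $ k $ l).
      ?c k q * (if \<sigma> h s = t then w (k, q + h) else 0))"
    by (subst sum.swap[of _ _ "expand f X"], subst (2) sum.swap) (rule refl)
  also have "\<dots> = loc s (act_adj f w) i"
    unfolding lt loc_eq[OF finite_expand[OF X(1)] supported_act_adj[OF X(2)]]
    by (intro sum.cong) (auto simp: act_adj_def)
  finally show ?thesis .
qed

lemma model_lap_loc:
  assumes X: "finite X" "supported X w" and s: "good (expand f X) s" and i: "i \<in> I"
  shows "model_lap (loc s w) i = loc s (laplacian f w) i"
proof -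
  have "good X s" by (rule good_antimono[OF s]) (auto simp: expand_def)
  then have "model_adj (model_app (loc s w)) i = model_adj (loc s (act f w)) i"
    unfolding model_adj_def using model_app_loc[OF X] by (intro sum.cong) auto
  also have "\<dots> = loc s (laplacian f w) i"
    unfolding laplacian_def
    by (rule model_adj_loc[OF finite_expand[OF X(1)] supported_act[OF X(2)] s i])
  finally show ?thesis using i by (simp add: model_lap_eq)
qed

text \<open>Each degree costs one Laplacian, that is, two expansions.\<close>

lemma poly_app_loc:
  assumes X: "finite X" "supported X w"
  shows "degree p \<le> m \<Longrightarrow> good (nbhd f (2 * m) X) s \<Longrightarrow>
    supported (nbhd f (2 * m) X) (poly_app p (laplacian f) w) \<and>
    (\<forall>i\<in>I. poly_app p model_lap (loc s w) i = loc s (poly_app p (laplacian f) w) i)"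
proof (induction p arbitrary: m)
  case 0
  show ?case by (auto simp: supported_def loc_def)
next
  case (pCons a p)
  have ml0: "model_lap (\<lambda>_. 0) = (\<lambda>_. 0)" by (simp add: model_lap_def)
  have Xm: "X \<subseteq> nbhd f (2 * m) X" using nbhd_mono[of 0 "2 * m" f X] by simp
  define w' where "w' = poly_app p (laplacian f) w"
  have 1: "supported (nbhd f (2 * m) X) (laplacian f w') \<and>
      (\<forall>i\<in>I. model_lap (poly_app p model_lap (loc s w)) i = loc s (laplacian f w') i)"
  \<comment> \<open>For \<open>p = 0\<close> the bound \<open>m\<close> may itself be 0; otherwise
    \<open>pCons\<close> raises the degree and \<open>m\<close> is a successor.\<close>
  proof (cases "p = 0")
    case True
    then show ?thesis by (auto simp: w'_def ml0 supported_def loc_def)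
  next
    case False
    then obtain m' where m': "m = Suc m'" "degree p \<le> m'"
      using pCons.prems(1) by (cases m) auto
    have nb: "nbhd f (2 * m) X = expand f (expand f (nbhd f (2 * m') X))"
      by (simp add: m' nbhd_Suc)
    have g: "good (expand f (nbhd f (2 * m') X)) s"
      by (rule good_antimono[OF pCons.prems(2)]) (auto simp: nb expand_def)
    then have g': "good (nbhd f (2 * m') X) s"
      by (rule good_antimono) (auto simp: expand_def)
    note IH = pCons.IH[OF m'(2) g', folded w'_def]
    have "model_lap (poly_app p model_lap (loc s w)) = model_lap (loc s w')"
      by (rule model_lap_cong) (use IH in auto)
    then show ?thesis
      using model_lap_loc[OF finite_nbhd[OF X(1)] conjunct1[OF IH] g] supported_laplacian[OF conjunct1[OF IH]]
      by (simp add: nb)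
  qed
  let ?D = "nbhd f (2 * m) X"
  have D: "finite ?D" by (rule finite_nbhd[OF X(1)])
  have wD: "supported ?D w" by (rule supported_mono[OF X(2) Xm])
  have pe: "poly_app (pCons a p) (laplacian f) w = (\<lambda>i. a * w i + laplacian f w' i)"
    by (simp add: poly_app_pCons w'_def)
  have sD: "supported ?D (\<lambda>i. a * w i + laplacian f w' i)"
    using wD 1 by (simp add: supported_def)
  have "loc s (\<lambda>i. a * w i + laplacian f w' i) i = a * loc s w i + loc s (laplacian f w') i" for i
  proof -
    obtain k t where i: "i = (k,t)" by (cases i)
    have "loc s (\<lambda>i. a * w i + laplacian f w' i) (k,t) =
        (\<Sum>g\<in>?D. if \<sigma> g s = t then a * w (k,g) + laplacian f w' (k,g) else 0)"
      by (rule loc_eq[OF D sD])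
    also have "\<dots> = (\<Sum>g\<in>?D. a * (if \<sigma> g s = t then w (k,g) else 0) +
        (if \<sigma> g s = t then laplacian f w' (k,g) else 0))"
      by (rule sum.cong) auto
    also have "\<dots> = a * loc s w (k,t) + loc s (laplacian f w') (k,t)"
      by (simp only: sum.distrib sum_distrib_left[symmetric] loc_eq[OF D wD] loc_eq[OF D conjunct1[OF 1]])
    finally show ?thesis unfolding i .
  qed
  then show ?case
    unfolding pe using 1 sD by (simp add: poly_app_pCons ml0)
qed

lemma sum_loc_square_le:
  assumes D: "finite D" "supported D w" and s: "inj_on (\<lambda>g. \<sigma> g s) D"
  shows "(\<Sum>i\<in>I. (loc s w i)\<^sup>2) \<le> (\<Sum>i\<in>UNIV \<times> D. (w i)\<^sup>2)"
proof -
  have "(\<Sum>t\<in>{1..d}. (loc s w (k,t))\<^sup>2) \<le> (\<Sum>g\<in>D. (w (k,g))\<^sup>2)" for k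
  proof -
    have "(\<Sum>t\<in>{1..d}. (loc s w (k,t))\<^sup>2) \<le> (\<Sum>t\<in>{1..d} \<union> (\<lambda>g. \<sigma> g s) ` D. (loc s w (k,t))\<^sup>2)"
      using D by (intro sum_mono2) auto
    also have "\<dots> = (\<Sum>t\<in>(\<lambda>g. \<sigma> g s) ` D. (loc s w (k,t))\<^sup>2)"
    proof (rule sum.mono_neutral_right)
      show "\<forall>t\<in>{1..d} \<union> (\<lambda>g. \<sigma> g s) ` D - (\<lambda>g. \<sigma> g s) ` D. (loc s w (k, t))\<^sup>2 = 0"
        unfolding loc_eq[OF D] by (auto intro!: sum.neutral)
    qed (use D in auto)
    also have "\<dots> = (\<Sum>g\<in>D. (loc s w (k, \<sigma> g s))\<^sup>2)" by (simp add: sum.reindex[OF s])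
    also have "\<dots> = (\<Sum>g\<in>D. (w (k,g))\<^sup>2)"
    proof (rule sum.cong)
      fix g assume g: "g \<in> D"
      have "loc s w (k, \<sigma> g s) = (\<Sum>g'\<in>D. if g' = g then w (k,g) else 0)"
        unfolding loc_eq[OF D] using s g by (intro sum.cong) (auto dest: inj_onD)
      then show "(loc s w (k, \<sigma> g s))\<^sup>2 = (w (k,g))\<^sup>2" using D g by simp
    qed simp
    finally show ?thesis .
  qed
  then have "(\<Sum>i\<in>I. (loc s w i)\<^sup>2) \<le> (\<Sum>k\<in>UNIV. \<Sum>g\<in>D. (w (k,g))\<^sup>2)"
    unfolding sum_I by (rule sum_mono)
  then show ?thesis by (simp add: sum.cartesian_product)
qed

lemma loc_at:
  assumes D: "finite D" "supported D w" and s: "inj_on (\<lambda>g. \<sigma> g s) D" and g: "g \<in> D"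
  shows "loc s w (k, \<sigma> g s) = w (k, g)"
proof -
  have "loc s w (k, \<sigma> g s) = (\<Sum>g'\<in>D. if g' = g then w (k,g) else 0)"
    unfolding loc_eq[OF D] using s g by (intro sum.cong) (auto dest: inj_onD)
  then show ?thesis using D g by simp
qed

lemma loc_unit_at:
  assumes "\<sigma> 0 s = s"
  shows "loc s (unit_at (k, 0)) = unit_at (k, s)"
proof
  fix i :: "'n \<times> nat"
  obtain l t where i: "i = (l,t)" by (cases i)
  have "supported {0} (unit_at (k, 0 :: 'g))" by (auto simp: supported_def unit_at_def)
  from loc_eq[OF _ this] show "loc s (unit_at (k, 0)) i = unit_at (k, s) i"
    using assms by (auto simp: i unit_at_def)
qed

end

context permutation_model
begin

section \<open>Separated points, traces and column estimates\<close>

text \<open>Take a maximal separated set. Every \<open>i\<close> in \<open>G\<close> then satisfies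
  \<open>\<sigma> g i = \<sigma> g' s\<close> for some \<open>s\<close> in \<open>S\<close> and
  \<open>g\<close>, \<open>g'\<close> in \<open>F\<close>, and is determined by this triple.\<close>

lemma exists_separated_subset:
  assumes G: "G \<subseteq> {1..d}" and F: "finite F" "F \<noteq> {}"
  obtains S where "S \<subseteq> G"
    "\<And>s s'. s \<in> S \<Longrightarrow> s' \<in> S \<Longrightarrow> s \<noteq> s' \<Longrightarrow> (\<lambda>g. \<sigma> g s) ` F \<inter> (\<lambda>g. \<sigma> g s') ` F = {}"
    "card G \<le> card S * (card F)\<^sup>2"
proof -
  define sep where "sep S \<longleftrightarrow> S \<subseteq> G \<and> (\<forall>s\<in>S. \<forall>s'\<in>S. s \<noteq> s' \<longrightarrow> (\<lambda>g. \<sigma> g s) ` F \<inter> (\<lambda>g. \<sigma> g s') ` F = {})" for S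
  have finG: "finite G" using G finite_subset by blast
  have "finite (Collect sep)" by (rule finite_subset[of _ "Pow G"]) (use finG in \<open>auto simp: sep_def\<close>)
  moreover have "sep {}" by (simp add: sep_def)
  ultimately obtain S where S: "sep S" "\<And>S'. sep S' \<Longrightarrow> S \<subseteq> S' \<Longrightarrow> S' = S"
    using finite_has_maximal[of "Collect sep"] by auto
  have SG: "S \<subseteq> G" using S(1) by (simp add: sep_def)
  have finS: "finite S" using SG finG finite_subset by blast
  have "G \<subseteq> (\<lambda>(s,g,g'). inv_into {1..d} (\<sigma> g) (\<sigma> g' s)) ` (S \<times> F \<times> F)"
  proof
    fix i assume i: "i \<in> G"
    then have i1: "i \<in> {1..d}" using G by blast
    obtain s g g' where *: "s \<in> S" "g \<in> F" "g' \<in> F" "\<sigma> g i = \<sigma> g' s"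
    proof (cases "i \<in> S")
      case True
      then show ?thesis using F(2) that by blast
    next
      case False
      then have "\<not> sep (insert i S)" using S(2)[of "insert i S"] by blast
      then show ?thesis using S(1) i that unfolding sep_def by (smt (verit) disjoint_iff imageE insert_iff insert_subset)
    qed
    have "inj_on (\<sigma> g) {1..d}" using \<sigma>_inj[of g] by (auto simp: inj_on_def)
    then have "i = inv_into {1..d} (\<sigma> g) (\<sigma> g' s)" using i1 *(4) by (metis inv_into_f_f)
    then show "i \<in> (\<lambda>(s,g,g'). inv_into {1..d} (\<sigma> g) (\<sigma> g' s)) ` (S \<times> F \<times> F)"
      using *(1-3) by (intro image_eqI[of _ _ "(s,g,g')"]) auto
  qed
  then have "card G \<le> card (S \<times> F \<times> F)"
    using finS F(1) by (meson card_image_le card_mono finite_SigmaI finite_imageI order_trans)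
  then have "card G \<le> card S * (card F)\<^sup>2" by (simp add: card_cartesian_product power2_eq_square)
  then show ?thesis using that[of S] S(1) unfolding sep_def by blast
qed

text \<open>At good points the diagonal entries agree exactly with those on the group; elsewhere
  \<open>poly_bound\<close> bounds them.\<close>

lemma model_trace_close:
  assumes q: "degree q \<le> m" and Y: "finite Y" "0 \<in> Y"
    and G: "G = {s \<in> {1..d}. good (nbhd f (2 * m) Y) s}"
  shows "\<bar>(\<Sum>i\<in>I. poly_app q model_lap (unit_at i) i) -
      real (card G) * (\<Sum>k\<in>UNIV. poly_app q (laplacian f) (unit_at (k, 0)) (k, 0))\<bar> \<le>
    real CARD('n) * real (d - card G) * poly_bound ((coeff_norm f)\<^sup>2) q"
proof -
  let ?\<tau> = "\<Sum>k\<in>UNIV. poly_app q (laplacian f) (unit_at (k, 0)) (k, 0)"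
  let ?b = "poly_bound ((coeff_norm f)\<^sup>2) q"
  let ?e = "\<lambda>i. poly_app q model_lap (unit_at i) i"
  have Gd: "G \<subseteq> {1..d}" using G by auto
  have fG: "finite G" using Gd finite_subset by blast
  have good: "?e (k, s) = poly_app q (laplacian f) (unit_at (k, 0)) (k, 0)" if s: "s \<in> G" for k s
  proof -
    have gs: "good (nbhd f (2 * m) Y) s" using s G by simp
    then have s0: "\<sigma> 0 s = s" "s \<in> {1..d}" "inj_on (\<lambda>g. \<sigma> g s) (nbhd f (2 * m) Y)" by (auto simp: good_def)
    have "supported Y (unit_at (k, 0 :: 'g))" using Y(2) by (auto simp: supported_def unit_at_def)
    note pl = poly_app_loc[OF Y(1) this q gs]
    have "?e (k, s) = loc s (poly_app q (laplacian f) (unit_at (k, 0))) (k, s)"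
      using conjunct2[OF pl] s0(2) by (simp add: loc_unit_at[of s, OF s0(1)] I_def)
    also have "\<dots> = loc s (poly_app q (laplacian f) (unit_at (k, 0))) (k, \<sigma> 0 s)" by (simp add: s0)
    also have "\<dots> = poly_app q (laplacian f) (unit_at (k, 0)) (k, 0)"
      by (rule loc_at[OF finite_nbhd[OF Y(1)] conjunct1[OF pl] s0(3)])
        (use nbhd_mono[of 0 "2 * m" f Y] Y(2) in auto)
    finally show ?thesis .
  qed
  have bd: "\<bar>?e i\<bar> \<le> ?b" if i: "i \<in> I" for i
  proof -
    have "\<bar>?e i\<bar> \<le> L2_set (poly_app q model_lap (unit_at i)) I"
      using member_le_L2_set[OF finite_I i, of "\<lambda>i'. \<bar>poly_app q model_lap (unit_at i) i'\<bar>"]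
      by (simp add: L2_set_def)
    also have "\<dots> \<le> ?b * L2_set (unit_at i) I" by (rule poly_app_L2)
    also have "L2_set (unit_at i) I = 1"
    proof -
      have "(\<Sum>j\<in>I. (unit_at i j)\<^sup>2) = (\<Sum>j\<in>I. if j = i then 1 else 0)"
        by (rule sum.cong) (auto simp: unit_at_def)
      then show ?thesis using i by (simp add: L2_set_def)
    qed
    finally show ?thesis by simp
  qed
  have "(\<Sum>i\<in>I. ?e i) = (\<Sum>k\<in>UNIV. \<Sum>s\<in>G. ?e (k,s)) + (\<Sum>k\<in>UNIV. \<Sum>s\<in>{1..d}-G. ?e (k,s))"
    unfolding sum_I by (simp only: sum.subset_diff[OF Gd finite_atLeastAtMost] sum.distrib add.commute)
  also have "(\<Sum>k\<in>UNIV. \<Sum>s\<in>G. ?e (k,s)) = real (card G) * ?\<tau>"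
    by (simp add: good sum_distrib_left)
  finally have "(\<Sum>i\<in>I. ?e i) - real (card G) * ?\<tau> = (\<Sum>k\<in>UNIV. \<Sum>s\<in>{1..d}-G. ?e (k,s))" by simp
  also have "\<bar>\<dots>\<bar> \<le> (\<Sum>k\<in>(UNIV::'n set). \<Sum>s\<in>{1..d}-G. ?b)"
    by (intro order_trans[OF sum_abs] sum_mono order_trans[OF sum_abs] bd) (auto simp: I_def)
  also have "\<dots> = real CARD('n) * real (d - card G) * ?b"
    using Gd fG by (simp add: card_Diff_subset)
  finally show ?thesis .
qed

lemma column_norm_le:
  "(\<Sum>i\<in>I. (poly_app p model_lap u i)\<^sup>2) \<le> (poly_bound ((coeff_norm f)\<^sup>2) p * L2_set u I)\<^sup>2"
proof -
  have "(\<Sum>i\<in>I. (poly_app p model_lap u i)\<^sup>2) = (L2_set (poly_app p model_lap u) I)\<^sup>2"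
    by (simp add: L2_set_def sum_nonneg)
  also have "\<dots> \<le> (poly_bound ((coeff_norm f)\<^sup>2) p * L2_set u I)\<^sup>2"
    by (intro power_mono poly_app_L2 L2_set_nonneg)
  finally show ?thesis .
qed

lemma L2_set_restrict_le: "L2_set (\<lambda>i. if i \<in> J then v i else 0) I \<le> L2_set v I"
  unfolding L2_set_def by (intro real_sqrt_le_mono sum_mono) auto

lemma L2_set_unit_at_le: "L2_set (unit_at j) I \<le> 1"
proof -
  have "(\<Sum>i\<in>I. (unit_at j i)\<^sup>2) = (\<Sum>i\<in>I. if i = j then 1 else 0)"
    by (rule sum.cong) (auto simp: unit_at_def)
  also have "\<dots> \<le> 1" by simp
  finally show ?thesis by (simp add: L2_set_def)
qed

lemma L2_set_perturbed_le:
  "L2_set (\<lambda>i. model_lap v i + (if i \<in> J then v i else 0)) I \<le> ((coeff_norm f)\<^sup>2 + 1) * L2_set v I"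
proof -
  have "L2_set (\<lambda>i. model_lap v i + (if i \<in> J then v i else 0)) I \<le>
      L2_set (model_lap v) I + L2_set (\<lambda>i. if i \<in> J then v i else 0) I"
    by (rule L2_set_triangle_ineq)
  also have "\<dots> \<le> (coeff_norm f)\<^sup>2 * L2_set v I + L2_set v I"
    by (intro add_mono model_lap_L2 L2_set_restrict_le)
  finally show ?thesis by (simp add: algebra_simps)
qed

text \<open>\<open>integral_perturbation_trace_bound\<close> is applied with the unit vectors at
  \<open>(l, s)\<close> as integral vectors and the transported \<open>h b\<close> as coefficients.
  Columns that copy their counterparts on the group cost \<open>a\<close> or \<open>a'\<close>; each
  of the others costs \<open>W\<close>.\<close>

lemma model_inequality:
  fixes h :: "bool \<Rightarrow> 'n \<times> 'g \<Rightarrow> real"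
  assumes C: "(coeff_norm f)\<^sup>2 \<le> C"
    and pq: "\<And>x. 0 \<le> x \<Longrightarrow> x \<le> C \<Longrightarrow> exp (poly q x) \<le> poly p x"
    and F: "finite F" "\<gamma> \<in> F" and hF: "\<And>b. supported F (h b)"
    and hint: "\<And>b. h b (k, \<gamma>) \<in> \<int>" and hne: "h True (k, \<gamma>) \<noteq> h False (k, \<gamma>)"
    and p: "degree p \<le> m"
    and G: "G = {s \<in> {1..d}. good (nbhd f (2 * m) (expand f (expand f (insert 0 F)))) s}"
    and a: "\<And>l B. finite B \<Longrightarrow> (\<Sum>i\<in>B. (poly_app p (laplacian f) (laplacian f (unit_at (l, 0))) i)\<^sup>2) \<le> a"
    and a': "\<And>b B. finite B \<Longrightarrow>
      (\<Sum>i\<in>B. (poly_app p (laplacian f) (\<lambda>i. unit_at (l, 0) i - laplacian f (h b) i) i)\<^sup>2) \<le> a'"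
    and S: "S \<subseteq> G"
    and sep: "\<And>s s'. s \<in> S \<Longrightarrow> s' \<in> S \<Longrightarrow> s \<noteq> s' \<Longrightarrow> (\<lambda>g. \<sigma> g s) ` F \<inter> (\<lambda>g. \<sigma> g s') ` F = {}"
    and H: "\<And>b. (\<Sum>i\<in>UNIV \<times> F. (h b i)\<^sup>2) \<le> H\<^sup>2" "0 \<le> H"
    and W: "W = (poly_bound ((coeff_norm f)\<^sup>2) p * (1 + ((coeff_norm f)\<^sup>2 + 1) * (1 + H)))\<^sup>2"
  obtains j :: nat where
    "\<And>r. (\<And>x. 0 \<le> x \<Longrightarrow> x \<le> C \<Longrightarrow> 0 \<le> poly r x) \<Longrightarrow> 1 \<le> poly r 0 \<Longrightarrow>
      real j \<le> (\<Sum>i\<in>I. poly_app r model_lap (unit_at i) i)"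
    "2 * (\<Sum>i\<in>I. poly_app q model_lap (unit_at i) i) \<le>
      (real (card I) - real (card S)) * a + real (card S) * a' +
      W * (2 * real j + real CARD('n) * real (d - card G)) - real (card I)"
proof -
  let ?Y = "insert 0 F" and ?X = "expand f (expand f (insert 0 F))"
  let ?D = "nbhd f (2 * m) ?X"
  have Y: "finite ?Y" "finite ?X" "finite ?D" using F by (auto intro!: finite_expand finite_nbhd)
  have YX: "?Y \<subseteq> ?X" "?X \<subseteq> ?D" using nbhd_mono[of 0 "2 * m" f ?X] by (auto simp: expand_def)
  have Gd: "G \<subseteq> {1..d}" and finG: "finite G" using G by auto
  have finS: "finite S" using S finG finite_subset by blast
  have goodS: "good ?D s" "good ?Y s" "\<sigma> 0 s = s" "s \<in> {1..d}" "inj_on (\<lambda>g. \<sigma> g s) F" "inj_on (\<lambda>g. \<sigma> g s) ?D"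
    if "s \<in> G" for s
  proof -
    show 1: "good ?D s" using that G by simp
    show "good ?Y s" by (rule good_antimono[OF 1]) (use YX in blast)
    show "\<sigma> 0 s = s" "s \<in> {1..d}" "inj_on (\<lambda>g. \<sigma> g s) ?D" using 1 by (auto simp: good_def)
    then show "inj_on (\<lambda>g. \<sigma> g s) F" using YX by (meson inj_on_subset subset_insertI subset_trans)
  qed
  \<comment> \<open>The column replaced on behalf of \<open>s\<close> sits where the coefficient is
    the integer \<open>h b (k, \<gamma>)\<close>, not at \<open>s\<close>.\<close>
  define pt where "pt s = (k, \<sigma> \<gamma> s)" for s
  have pt_inj: "inj_on pt S" by (auto simp: inj_on_def pt_def \<sigma>_inj)
  define T where "T = pt ` S"
  define sof where "sof = inv_into S pt"
  have sof: "sof (pt s) = s" if "s \<in> S" for s using that pt_inj by (simp add: sof_def)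
  have ptI: "pt s \<in> I" if "s \<in> S" for s using goodS(4)[of s] S that \<sigma>_mem[of \<gamma> s] unfolding pt_def I_def by blast
  have TI: "T \<subseteq> I" using ptI by (auto simp: T_def)
  have locF: "loc s (h b) (l',\<sigma> g s) = h b (l', g)" if "s \<in> S" "g \<in> F" for s b l' g
    by (rule loc_at[OF F(1) hF]) (use goodS(5) S that in auto)
  have loc0: "loc s (h b) (l', t) = 0" if "t \<notin> (\<lambda>g. \<sigma> g s) ` F" for s b l' t
    unfolding loc_eq[OF F(1) hF] using that by (intro sum.neutral) auto
  have locpt: "loc s (h b) (pt s) = h b (k, \<gamma>)" if "s \<in> S" for s b
    unfolding pt_def by (rule locF[OF that F(2)])
  have loc_other: "loc s (h b) (pt s') = 0" if "s \<in> S" "s' \<in> S" "s \<noteq> s'" for s s' b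
    unfolding pt_def by (rule loc0) (use sep[OF that] F(2) in blast)
  obtain J b where J: "J \<subseteq> I"
    and Jr: "\<And>r. (\<And>x. 0 \<le> x \<Longrightarrow> x \<le> C \<Longrightarrow> 0 \<le> poly r x) \<Longrightarrow> 1 \<le> poly r 0 \<Longrightarrow>
      real (card J) \<le> (\<Sum>i\<in>I. poly_app r model_lap (unit_at i) i)"
    and main: "2 * (\<Sum>i\<in>I. poly_app q model_lap (unit_at i) i) \<le>
      (\<Sum>j\<in>I. \<Sum>i\<in>I. (poly_app p model_lap (if j \<in> T
        then (\<lambda>i. unit_at (l, sof j) i - (model_lap (loc (sof j) (h (b j))) i +
          (if i \<in> J then loc (sof j) (h (b j)) i else 0)))
        else (\<lambda>i. model_lap (unit_at j) i + (if i \<in> J then unit_at j i else 0))) i)\<^sup>2) - real (card I)"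
  proof (rule integral_perturbation_trace_bound[of I lap_kernel C T "\<lambda>t. unit_at (l, sof t)"
        "\<lambda>b t. loc (sof t) (h b)" q p, folded model_lap_def])
    show "0 \<le> (\<Sum>i\<in>I. v i * model_lap v i)" for v
      unfolding model_lap_quadratic by (intro sum_nonneg) auto
    show "(\<Sum>i\<in>I. v i * model_lap v i) \<le> C * (\<Sum>i\<in>I. (v i)\<^sup>2)" for v
      unfolding model_lap_quadratic
      by (rule order_trans[OF model_app_norm mult_right_mono[OF C]]) (auto intro!: sum_nonneg)
    show "unit_at (l, sof t) i \<in> \<int>" for t i by (simp add: unit_at_def)
    show "loc (sof t) (h b) t \<in> \<int>" if "t \<in> T" for t b
      using that hint by (auto simp: T_def sof locpt)
    show "loc (sof t) (h True) t \<noteq> loc (sof t) (h False) t" if "t \<in> T" for t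
      using that hne by (auto simp: T_def sof locpt)
    show "loc (sof t) (h b) t' = 0" if "t \<in> T" "t' \<in> T" "t' \<noteq> t" for t t' b
      using that by (auto simp: T_def sof intro!: loc_other)
  qed (use TI pq that in \<open>auto simp: lap_kernel_Ints intro: lap_kernel_sym\<close>)
  define u where "u j = (if j \<in> T
        then (\<lambda>i. unit_at (l, sof j) i - (model_lap (loc (sof j) (h (b j))) i +
          (if i \<in> J then loc (sof j) (h (b j)) i else 0)))
        else (\<lambda>i. model_lap (unit_at j) i + (if i \<in> J then unit_at j i else 0)))" for j
  define col where "col j = (\<Sum>i\<in>I. (poly_app p model_lap (u j) i)\<^sup>2)" for j
  define c1 where "c1 = (coeff_norm f)\<^sup>2 + 1"
  have c1: "c1 \<ge> 1" by (simp add: c1_def)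
  define pb where "pb = poly_bound ((coeff_norm f)\<^sup>2) p"
  have pb: "pb \<ge> 0" by (simp add: pb_def poly_bound_nonneg)
  have finJ: "finite J" using J finite_subset finite_I by blast
  have W0: "W \<ge> 0" by (simp add: W)
  \<comment> \<open>This pays for the columns at bad points and for those disturbed by
    \<open>J\<close>.\<close>
  have crude: "col j \<le> W" if "L2_set (u j) I \<le> 1 + c1 * (1 + H)" for j
  proof -
    have "col j \<le> (pb * L2_set (u j) I)\<^sup>2" unfolding col_def pb_def by (rule column_norm_le)
    also have "\<dots> \<le> (pb * (1 + c1 * (1 + H)))\<^sup>2"
      by (intro power_mono mult_left_mono that) (auto simp: pb)
    finally show ?thesis by (simp add: W c1_def pb_def)
  qed
  have crude_off: "col j \<le> W" if "j \<notin> T" for j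
  proof (rule crude)
    have "L2_set (u j) I \<le> c1 * L2_set (unit_at j) I"
      using that L2_set_perturbed_le[of "unit_at j" J] by (simp add: u_def c1_def)
    also have "\<dots> \<le> c1 * 1" using c1 by (intro mult_left_mono L2_set_unit_at_le) auto
    also have "\<dots> \<le> 1 + c1 * (1 + H)" using c1 H(2) by (simp add: distrib_left)
    finally show "L2_set (u j) I \<le> 1 + c1 * (1 + H)" .
  qed
  have crude_on: "col (pt s) \<le> W" if s: "s \<in> S" for s
  proof (rule crude)
    let ?v = "loc s (h (b (pt s)))"
    let ?w = "\<lambda>i. model_lap ?v i + (if i \<in> J then ?v i else 0)"
    have "L2_set ?v I \<le> sqrt (\<Sum>i\<in>UNIV \<times> F. (h (b (pt s)) i)\<^sup>2)"
      unfolding L2_set_def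
      by (intro real_sqrt_le_mono sum_loc_square_le F(1) hF goodS(5)) (use S s in blast)
    also have "\<dots> \<le> H" by (rule real_le_lsqrt) (use H sum_nonneg in auto)
    finally have v: "L2_set ?v I \<le> H" .
    have up: "u (pt s) = (\<lambda>i. unit_at (l, s) i + (- 1) * ?w i)"
      using s by (auto simp: u_def T_def sof)
    have "L2_set (u (pt s)) I \<le> L2_set (unit_at (l, s)) I + L2_set (\<lambda>i. (- 1) * ?w i) I"
      unfolding up by (rule L2_set_triangle_ineq)
    also have "L2_set (\<lambda>i. (- 1) * ?w i) I = L2_set ?w I" unfolding L2_set_scale by simp
    also have "L2_set (unit_at (l, s)) I + L2_set ?w I \<le> 1 + c1 * H"
      unfolding c1_def
      by (intro add_mono L2_set_unit_at_le order_trans[OF L2_set_perturbed_le] mult_left_mono v) simp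
    also have "\<dots> \<le> 1 + c1 * (1 + H)" using c1 by (simp add: distrib_left)
    finally show "L2_set (u (pt s)) I \<le> 1 + c1 * (1 + H)" .
  qed
  have unitY: "supported ?Y (unit_at (l', 0 :: 'g))" for l' by (auto simp: supported_def unit_at_def)
  have hY: "supported ?Y (h b)" for b by (rule supported_mono[OF hF]) auto
  have Ys: "good (expand f ?Y) s" if "s \<in> G" for s
    by (rule good_antimono[OF goodS(1)[OF that]]) (use YX(2) in \<open>auto simp: expand_def\<close>)
  \<comment> \<open>The perturbation is diagonal, so an unreplaced column meets \<open>J\<close>
    only at its own index.\<close>
  have fine_off: "col (l',s) \<le> a" if s: "s \<in> G" and nT: "(l',s) \<notin> T" and nJ: "(l',s) \<notin> J" for l' s
  proof -
    let ?w = "laplacian f (unit_at (l', 0))"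
    have w: "supported ?X ?w" by (rule supported_laplacian[OF unitY])
    note pl = poly_app_loc[OF Y(2) w p goodS(1)[OF s]]
    have "u (l',s) i = loc s ?w i" if i: "i \<in> I" for i
    proof -
      have "i \<in> J \<Longrightarrow> unit_at (l',s) i = 0" using nJ by (auto simp: unit_at_def)
      then have "u (l',s) i = model_lap (loc s (unit_at (l', 0))) i"
        using nT by (auto simp: u_def loc_unit_at[OF goodS(3)[OF s]])
      also have "\<dots> = loc s ?w i" by (rule model_lap_loc[OF Y(1) unitY Ys[OF s] i])
      finally show ?thesis .
    qed
    then have "col (l',s) = (\<Sum>i\<in>I. (poly_app p model_lap (loc s ?w) i)\<^sup>2)"
      unfolding col_def by (intro sum.cong refl arg_cong[where f = "\<lambda>x. x\<^sup>2"] poly_app_model_cong)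
    also have "\<dots> = (\<Sum>i\<in>I. (loc s (poly_app p (laplacian f) ?w) i)\<^sup>2)" using conjunct2[OF pl] by simp
    also have "\<dots> \<le> (\<Sum>i\<in>UNIV \<times> ?D. (poly_app p (laplacian f) ?w i)\<^sup>2)"
      by (rule sum_loc_square_le[OF Y(3) conjunct1[OF pl] goodS(6)[OF s]])
    also have "\<dots> \<le> a" by (rule a) (use Y(3) in simp)
    finally show ?thesis .
  qed
  \<comment> \<open>A replaced column combines columns from the whole patch of \<open>s\<close>, all
    of which must avoid \<open>J\<close>.\<close>
  have fine_on: "col (pt s) \<le> a'" if s: "s \<in> S" and nJ: "J \<inter> (UNIV \<times> (\<lambda>g. \<sigma> g s) ` F) = {}" for s
  proof -
    have sG: "s \<in> G" using s S by blast
    let ?\<beta> = "b (pt s)"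
    let ?w = "\<lambda>i. unit_at (l, 0) i - laplacian f (h ?\<beta>) i"
    have w: "supported ?X ?w"
      using supported_laplacian[OF hY, of f ?\<beta>] supported_mono[OF unitY YX(1)] by (simp add: supported_def)
    note pl = poly_app_loc[OF Y(2) w p goodS(1)[OF sG]]
    have "u (pt s) i = loc s ?w i" if i: "i \<in> I" for i
    proof -
      obtain l' t where lt: "i = (l',t)" by (cases i)
      have "i \<in> J \<Longrightarrow> loc s (h ?\<beta>) i = 0" unfolding lt by (rule loc0) (use nJ in auto)
      then have "u (pt s) i = loc s (unit_at (l, 0)) i - model_lap (loc s (h ?\<beta>)) i"
        using s by (auto simp: u_def T_def sof loc_unit_at[OF goodS(3)[OF sG]])
      also have "model_lap (loc s (h ?\<beta>)) i = loc s (laplacian f (h ?\<beta>)) i"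
        by (rule model_lap_loc[OF Y(1) hY Ys[OF sG] i])
      also have "loc s (unit_at (l, 0)) i - loc s (laplacian f (h ?\<beta>)) i = loc s ?w i"
        unfolding lt loc_eq[OF Y(2) w] loc_eq[OF Y(2) supported_mono[OF unitY YX(1)]]
          loc_eq[OF Y(2) supported_laplacian[OF hY]] sum_subtractf[symmetric]
        by (intro sum.cong) auto
      finally show ?thesis .
    qed
    then have "col (pt s) = (\<Sum>i\<in>I. (poly_app p model_lap (loc s ?w) i)\<^sup>2)"
      unfolding col_def by (intro sum.cong refl arg_cong[where f = "\<lambda>x. x\<^sup>2"] poly_app_model_cong)
    also have "\<dots> = (\<Sum>i\<in>I. (loc s (poly_app p (laplacian f) ?w) i)\<^sup>2)" using conjunct2[OF pl] by simp
    also have "\<dots> \<le> (\<Sum>i\<in>UNIV \<times> ?D. (poly_app p (laplacian f) ?w i)\<^sup>2)"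
      by (rule sum_loc_square_le[OF Y(3) conjunct1[OF pl] goodS(6)[OF sG]])
    also have "\<dots> \<le> a'" by (rule a') (use Y(3) in simp)
    finally show ?thesis .
  qed
  have "0 \<le> a" by (rule order_trans[OF sum_nonneg a[where l = k, OF finite.emptyI]]) (erule emptyE)
  moreover have "0 \<le> a'" by (rule order_trans[OF sum_nonneg a'[where b = True, OF finite.emptyI]]) (erule emptyE)
  ultimately have a0: "0 \<le> a" "0 \<le> a'" .
  define S1 where "S1 = {s \<in> S. J \<inter> (UNIV \<times> (\<lambda>g. \<sigma> g s) ` F) \<noteq> {}}"
  \<comment> \<open>Patches of different points are disjoint, so an element of \<open>J\<close>
    spoils at most one of them.\<close>
  have cardS1: "card S1 \<le> card J"
  proof -
    define pick where "pick s = (SOME j. j \<in> J \<inter> (UNIV \<times> (\<lambda>g. \<sigma> g s) ` F))" for s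
    have pick: "pick s \<in> J \<inter> (UNIV \<times> (\<lambda>g. \<sigma> g s) ` F)" if "s \<in> S1" for s
      unfolding pick_def by (rule someI_ex) (use that in \<open>auto simp: S1_def\<close>)
    have "inj_on pick S1"
    proof (rule inj_onI, rule ccontr)
      fix s s' assume ss: "s \<in> S1" "s' \<in> S1" "pick s = pick s'" "s \<noteq> s'"
      then have "(\<lambda>g. \<sigma> g s) ` F \<inter> (\<lambda>g. \<sigma> g s') ` F = {}" by (intro sep) (auto simp: S1_def)
      then show False using pick[OF ss(1)] pick[OF ss(2)] ss(3) by auto
    qed
    then show ?thesis using pick finJ by (intro card_inj_on_le[of pick]) auto
  qed
  have sumT: "(\<Sum>j\<in>T. col j) \<le> real (card S) * a' + W * real (card J)"
  proof -
    have "(\<Sum>j\<in>T. col j) = (\<Sum>s\<in>S. col (pt s))" unfolding T_def by (simp add: sum.reindex[OF pt_inj])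
    also have "\<dots> \<le> (\<Sum>s\<in>S. a' + (if s \<in> S1 then W else 0))"
    proof (rule sum_mono)
      fix s assume s: "s \<in> S"
      show "col (pt s) \<le> a' + (if s \<in> S1 then W else 0)"
        using crude_on[OF s] fine_on[OF s] s a0 by (auto simp: S1_def)
    qed
    also have "\<dots> = real (card S) * a' + W * real (card S1)"
    proof -
      have "S1 \<subseteq> S" by (auto simp: S1_def)
      then have "S \<inter> S1 = S1" by blast
      then show ?thesis using finS by (simp add: sum.distrib sum.If_cases)
    qed
    also have "\<dots> \<le> real (card S) * a' + W * real (card J)"
      using cardS1 W0 by (intro add_left_mono mult_left_mono) auto
    finally show ?thesis .
  qed
  have cardT: "card T = card S" unfolding T_def by (rule card_image[OF pt_inj])
  have sumI: "(\<Sum>j\<in>I - T. col j) \<le> (real (card I) - real (card S)) * a +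
      W * (real (card J) + real CARD('n) * real (d - card G))"
  proof -
    let ?B = "(UNIV :: 'n set) \<times> ({1..d} - G)"
    have "(\<Sum>j\<in>I - T. col j) \<le> (\<Sum>j\<in>I - T. a + (if j \<in> J \<union> ?B then W else 0))"
    proof (rule sum_mono)
      fix j assume j: "j \<in> I - T"
      obtain l' s where ls: "j = (l',s)" by (cases j)
      show "col j \<le> a + (if j \<in> J \<union> ?B then W else 0)"
        using crude_off[of j] fine_off[of s l'] j a0 by (auto simp: ls I_def)
    qed
    also have "\<dots> = real (card (I - T)) * a + W * real (card ((I - T) \<inter> (J \<union> ?B)))"
      by (simp add: sum.distrib sum.If_cases Un_def)
    also have "real (card (I - T)) = real (card I) - real (card S)"
      using TI finite_I by (simp add: card_Diff_subset finite_subset[OF TI] cardT card_mono of_nat_diff flip: cardT)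
    also have "card ((I - T) \<inter> (J \<union> ?B)) \<le> card (J \<union> ?B)"
      by (rule card_mono) (use finJ in auto)
    also have "card (J \<union> ?B) \<le> card J + card ?B" by (rule card_Un_le)
    also have "card ?B = CARD('n) * (d - card G)"
      using Gd finG by (simp add: card_cartesian_product card_Diff_subset)
    finally show ?thesis using W0 by (simp add: mult_left_mono)
  qed
  have "(\<Sum>j\<in>I. col j) = (\<Sum>j\<in>I - T. col j) + (\<Sum>j\<in>T. col j)"
    by (rule sum.subset_diff[OF TI finite_I])
  \<comment> \<open>\<open>J\<close> is charged twice, once among the replaced columns and once
    among the others.\<close>
  then have total: "(\<Sum>j\<in>I. col j) \<le> (real (card I) - real (card S)) * a + real (card S) * a' +
      W * (2 * real (card J) + real CARD('n) * real (d - card G))"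
    using sumT sumI by (simp add: algebra_simps)
  show ?thesis
  proof (rule that[of "card J"])
    show "real (card J) \<le> (\<Sum>i\<in>I. poly_app r model_lap (unit_at i) i)"
      if "\<And>x. 0 \<le> x \<Longrightarrow> x \<le> C \<Longrightarrow> 0 \<le> poly r x" "1 \<le> poly r 0" for r
      by (rule Jr[OF that])
    show "2 * (\<Sum>i\<in>I. poly_app q model_lap (unit_at i) i) \<le>
      (real (card I) - real (card S)) * a + real (card S) * a' +
      W * (2 * real (card J) + real CARD('n) * real (d - card G)) - real (card I)"
      using main total unfolding col_def u_def by linarith
  qed
qed

end

section \<open>Fuglede-Kadison determinants\<close>

text \<open>\<open>good\<close> follows from finitely many conditions, each of which fails on a
  vanishing proportion of points. Injectivity is one of them: if
  \<open>\<sigma> g s = \<sigma> h s\<close>, multiplicativity makes \<open>s\<close> a fixed point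
  of \<open>- h + g\<close>. The pair \<open>(0, 0)\<close> yields
  \<open>\<sigma> 0 s = s\<close>.\<close>

lemma sofic_good_points:
  fixes f :: "('g::group_add \<Rightarrow>\<^sub>0 int)^'n^'n" and D :: "'g set"
  assumes sof: "sofic_approximation d \<sigma>" and D: "finite D" and e: "e > 0"
  obtains i where "permutation_model (d i) (\<sigma> i)" "1 \<le> d i"
    "real (d i - card {s \<in> {1..d i}. permutation_model.good f (d i) (\<sigma> i) D s}) \<le> e * real (d i)"
proof -
  have d1: "1 \<le> d i" and perm: "\<sigma> i g permutes {1..d i}" for i g
    using sof by (auto simp: sofic_approximation_def)
  have pm: "permutation_model (d i) (\<sigma> i)" for i by unfold_locales (rule perm)
  define Bm where "Bm p i = {j \<in> {1..d i}. \<sigma> i (fst p + snd p) j \<noteq> \<sigma> i (fst p) (\<sigma> i (snd p) j)}" for p i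
  define Bf where "Bf u i = {j \<in> {1..d i}. \<sigma> i u j = j}" for u i
  have small: "\<forall>\<^sub>F i in sequentially. real (card ({1..d i} - A i)) \<le> \<epsilon> * real (d i)"
    if lim: "(\<lambda>i. measure (uniform_count_measure {1..d i}) (A i)) \<longlonglongrightarrow> 1"
      and sub: "\<And>i. A i \<subseteq> {1..d i}" and \<epsilon>: "\<epsilon> > 0" for A :: "nat \<Rightarrow> nat set" and \<epsilon>
    using tendstoD[OF lim \<epsilon>]
  proof eventually_elim
    case (elim i)
    have "measure (uniform_count_measure {1..d i}) (A i) = real (card (A i)) / real (d i)"
      using measure_uniform_count_measure[of "{1..d i}" "A i"] sub[of i] by simp
    then have "1 - real (card (A i)) / real (d i) < \<epsilon>" using elim by (simp add: dist_real_def)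
    then have "real (d i) - real (card (A i)) \<le> \<epsilon> * real (d i)"
      using d1[of i] by (simp add: field_simps)
    moreover have "card ({1..d i} - A i) = d i - card (A i)"
      using card_Diff_subset[OF finite_subset[OF sub finite_atLeastAtMost] sub[of i]] by simp
    moreover have "card (A i) \<le> d i" using card_mono[OF finite_atLeastAtMost sub[of i]] by simp
    ultimately show ?case by (simp add: of_nat_diff)
  qed
  define P where "P = {(0,0)} \<union> (coeff_supp f \<times> D) \<union> (\<lambda>(q,g). (q, - q + g)) ` (coeff_supp f \<times> D) \<union>
    (\<lambda>(h,g). (h, - h + g)) ` (D \<times> D)"
  define U where "U = (\<lambda>(h,g). - h + g) ` (D \<times> D) - {0}"
  have fin: "finite P" "finite U" using D by (auto simp: P_def U_def)
  \<comment> \<open>An equal share of \<open>e\<close> for every condition in \<open>P\<close> and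
    \<open>U\<close>.\<close>
  define \<epsilon> where "\<epsilon> = e / (real (card P) + real (card U) + 1)"
  have \<epsilon>: "\<epsilon> > 0" using e by (simp add: \<epsilon>_def add_nonneg_pos)
  have "\<forall>\<^sub>F i in sequentially. real (card (Bm p i)) \<le> \<epsilon> * real (d i)" for p
  proof -
    let ?A = "\<lambda>i. {j \<in> {1..d i}. \<sigma> i (fst p + snd p) j = \<sigma> i (fst p) (\<sigma> i (snd p) j)}"
    have "(\<lambda>i. measure (uniform_count_measure {1..d i}) (?A i)) \<longlonglongrightarrow> 1"
      using sof by (simp add: sofic_approximation_def)
    moreover have "?A i \<subseteq> {1..d i}" for i by blast
    ultimately have "\<forall>\<^sub>F i in sequentially. real (card ({1..d i} - ?A i)) \<le> \<epsilon> * real (d i)"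
      using \<epsilon> by (rule small)
    moreover have "{1..d i} - ?A i = Bm p i" for i by (auto simp: Bm_def)
    ultimately show ?thesis by simp
  qed
  moreover have "\<forall>\<^sub>F i in sequentially. real (card (Bf u i)) \<le> \<epsilon> * real (d i)" if "u \<in> U" for u
  proof -
    let ?A = "\<lambda>i. {j \<in> {1..d i}. \<sigma> i u j \<noteq> j}"
    have "(\<lambda>i. measure (uniform_count_measure {1..d i}) (?A i)) \<longlonglongrightarrow> 1"
      using sof that by (simp add: sofic_approximation_def U_def)
    moreover have "?A i \<subseteq> {1..d i}" for i by blast
    ultimately have "\<forall>\<^sub>F i in sequentially. real (card ({1..d i} - ?A i)) \<le> \<epsilon> * real (d i)"
      using \<epsilon> by (rule small)
    moreover have "{1..d i} - ?A i = Bf u i" for i by (auto simp: Bf_def)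
    ultimately show ?thesis by simp
  qed
  ultimately have "\<forall>\<^sub>F i in sequentially. (\<forall>p\<in>P. real (card (Bm p i)) \<le> \<epsilon> * real (d i)) \<and>
      (\<forall>u\<in>U. real (card (Bf u i)) \<le> \<epsilon> * real (d i))"
    using fin by (intro eventually_conj eventually_ball_finite) auto
  then obtain i where i: "\<And>p. p \<in> P \<Longrightarrow> real (card (Bm p i)) \<le> \<epsilon> * real (d i)"
      "\<And>u. u \<in> U \<Longrightarrow> real (card (Bf u i)) \<le> \<epsilon> * real (d i)"
    by (auto simp: eventually_sequentially)
  interpret permutation_model f "d i" "\<sigma> i" by (rule pm)
  let ?G = "{s \<in> {1..d i}. good D s}"
  have "{1..d i} - ?G \<subseteq> (\<Union>p\<in>P. Bm p i) \<union> (\<Union>u\<in>U. Bf u i)"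
  proof
    fix s assume s: "s \<in> {1..d i} - ?G"
    show "s \<in> (\<Union>p\<in>P. Bm p i) \<union> (\<Union>u\<in>U. Bf u i)"
    proof (rule ccontr)
      assume "s \<notin> (\<Union>p\<in>P. Bm p i) \<union> (\<Union>u\<in>U. Bf u i)"
      then have m: "\<sigma> i (g + h) s = \<sigma> i g (\<sigma> i h s)" if "(g,h) \<in> P" for g h
        using that s by (force simp: Bm_def)
      have n: "\<sigma> i u s \<noteq> s" if "u \<in> U" for u
        using \<open>s \<notin> (\<Union>p\<in>P. Bm p i) \<union> (\<Union>u\<in>U. Bf u i)\<close> that s by (auto simp: Bf_def)
      have "\<sigma> i (0 + 0) s = \<sigma> i 0 (\<sigma> i 0 s)" by (rule m) (simp add: P_def)
      then have z: "\<sigma> i 0 s = s" using \<sigma>_inj[of 0] by simp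
      have "inj_on (\<lambda>g. \<sigma> i g s) D"
      proof (rule inj_onI, rule ccontr)
        fix g h assume gh: "g \<in> D" "h \<in> D" "\<sigma> i g s = \<sigma> i h s" "g \<noteq> h"
        have "- h + g \<noteq> 0" using gh(4) by (metis add.right_neutral add_minus_cancel)
        then have "- h + g \<in> U" using gh unfolding U_def by force
        moreover have "\<sigma> i (h + (- h + g)) s = \<sigma> i h (\<sigma> i (- h + g) s)"
          by (rule m) (use gh in \<open>force simp: P_def\<close>)
        then have "\<sigma> i h (\<sigma> i (- h + g) s) = \<sigma> i h s" using gh(3) by (simp flip: add.assoc)
        then have "\<sigma> i (- h + g) s = s" by (simp add: \<sigma>_inj)
        ultimately show False using n by blast
      qed
      moreover have "\<sigma> i (q + g) s = \<sigma> i q (\<sigma> i g s)" if "q \<in> coeff_supp f" "g \<in> D" for q g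
        by (rule m) (use that in \<open>auto simp: P_def\<close>)
      moreover have "\<sigma> i g s = \<sigma> i q (\<sigma> i (- q + g) s)" if "q \<in> coeff_supp f" "g \<in> D" for q g
      proof -
        have "\<sigma> i (q + (- q + g)) s = \<sigma> i q (\<sigma> i (- q + g) s)"
          by (rule m) (use that in \<open>force simp: P_def\<close>)
        then show ?thesis by (simp flip: add.assoc)
      qed
      ultimately have "good D s" unfolding good_def using s z by blast
      then show False using s by blast
    qed
  qed
  then have "card ({1..d i} - ?G) \<le> card ((\<Union>p\<in>P. Bm p i) \<union> (\<Union>u\<in>U. Bf u i))"
    using fin by (intro card_mono) (auto simp: Bm_def Bf_def)
  also have "\<dots> \<le> (\<Sum>p\<in>P. card (Bm p i)) + (\<Sum>u\<in>U. card (Bf u i))"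
    by (intro order_trans[OF card_Un_le] add_mono card_UN_le fin)
  finally have "real (card ({1..d i} - ?G)) \<le> (\<Sum>p\<in>P. real (card (Bm p i))) + (\<Sum>u\<in>U. real (card (Bf u i)))"
    by (simp flip: of_nat_sum of_nat_add)
  also have "\<dots> \<le> (\<Sum>p\<in>P. \<epsilon> * real (d i)) + (\<Sum>u\<in>U. \<epsilon> * real (d i))"
    by (intro add_mono sum_mono i)
  also have "\<dots> \<le> (real (card P) + real (card U) + 1) * (\<epsilon> * real (d i))"
    using \<epsilon> by (simp add: distrib_right)
  also have "\<dots> = e * real (d i)" unfolding \<epsilon>_def by (simp add: add_nonneg_pos)
  finally have "real (card ({1..d i} - ?G)) \<le> e * real (d i)" .
  moreover have "card ({1..d i} - ?G) = d i - card ?G" by (subst card_Diff_subset) auto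
  ultimately show ?thesis using that[of i] pm d1 by simp
qed


section \<open>Approximating polynomials\<close>

text \<open>Approximate \<open>1 / max t c\<close>, which is continuous and at least
  \<open>1 / C\<close> on all of \<open>[0, C]\<close>. An error below \<open>1 / C\<close> keeps
  \<open>p\<close> positive also on \<open>[0, c]\<close>, where the models may have
  eigenvalues.\<close>

lemma reciprocal_polynomial:
  fixes c C e :: real
  assumes "0 < c" "c \<le> C" "e > 0"
  obtains p where "\<And>t. 0 \<le> t \<Longrightarrow> t \<le> C \<Longrightarrow> 0 < poly p t"
    "\<And>t. c \<le> t \<Longrightarrow> t \<le> C \<Longrightarrow> \<bar>poly p t * t - 1\<bar> \<le> e"
proof -
  define \<delta> where "\<delta> = min (e / C) (1 / (2 * C))"
  have C: "C > 0" using assms by simp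
  have \<delta>: "\<delta> > 0" "\<delta> * C \<le> e" "\<delta> < 1 / C"
    using assms C by (auto simp: \<delta>_def min_def field_simps)
  have "continuous_on {0..C} (\<lambda>t. 1 / max t c)" using assms by (intro continuous_intros) auto
  then obtain p where p: "\<And>t. 0 \<le> t \<Longrightarrow> t \<le> C \<Longrightarrow> \<bar>poly p t - 1 / max t c\<bar> < \<delta>"
    using real_polynomial_approx[OF _ \<delta>(1)] by blast
  show ?thesis
  proof (rule that)
    fix t assume t: "0 \<le> t" "t \<le> C"
    have "1 / C \<le> 1 / max t c" using t assms by (intro divide_left_mono) auto
    then show "0 < poly p t" using p[OF t] \<delta>(3) by linarith
  next
    fix t assume t: "c \<le> t" "t \<le> C"
    have "poly p t * t - 1 = (poly p t - 1 / max t c) * t"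
      using t assms by (simp add: field_simps)
    then have "\<bar>poly p t * t - 1\<bar> = \<bar>poly p t - 1 / max t c\<bar> * t"
      using t assms by (simp add: abs_mult)
    also have "\<dots> \<le> \<delta> * C" using p[of t] t assms \<delta> by (intro mult_mono) auto
    finally show "\<bar>poly p t * t - 1\<bar> \<le> e" using \<delta>(2) by linarith
  qed
qed

text \<open>Aim at \<open>ln p - e\<close> with error \<open>e\<close>, so that \<open>q\<close>
  stays below \<open>ln p\<close> at a total cost of \<open>2 * e\<close>. As
  \<open>e \<le> 1 / 2\<close>, the logarithm of \<open>p(t) t\<close> costs at most another
  \<open>2 * e\<close>.\<close>

lemma log_minorant_polynomial:
  fixes c C e :: real
  assumes c: "0 < c" "c \<le> C" and e: "0 < e" "e \<le> 1 / 2"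
    and pos: "\<And>t. 0 \<le> t \<Longrightarrow> t \<le> C \<Longrightarrow> 0 < poly p t"
    and p: "\<And>t. c \<le> t \<Longrightarrow> t \<le> C \<Longrightarrow> \<bar>poly p t * t - 1\<bar> \<le> e"
  obtains q where "\<And>t. 0 \<le> t \<Longrightarrow> t \<le> C \<Longrightarrow> exp (poly q t) \<le> poly p t"
    "\<And>t. c \<le> t \<Longrightarrow> t \<le> C \<Longrightarrow> \<bar>poly q t + ln t\<bar> \<le> 4 * e"
proof -
  have "continuous_on {0..C} (\<lambda>t. ln (poly p t) - e)"
  proof (intro continuous_on_diff continuous_on_const continuous_on_ln)
    show "continuous_on {0..C} (poly p)" by (intro continuous_intros)
    show "\<forall>t\<in>{0..C}. poly p t \<noteq> 0" using pos by (metis atLeastAtMost_iff less_irrefl)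
  qed
  then obtain q where q: "\<And>t. 0 \<le> t \<Longrightarrow> t \<le> C \<Longrightarrow> \<bar>poly q t - (ln (poly p t) - e)\<bar> < e"
    using real_polynomial_approx[OF _ e(1)] by blast
  show ?thesis
  proof (rule that)
    fix t assume t: "0 \<le> t" "t \<le> C"
    have "poly q t \<le> ln (poly p t)" using q[OF t] by linarith
    then show "exp (poly q t) \<le> poly p t" using pos[OF t] by (metis exp_le_cancel_iff exp_ln)
  next
    fix t assume t: "c \<le> t" "t \<le> C"
    have t0: "0 < t" "0 \<le> t" using t c by auto
    define x where "x = poly p t * t - 1"
    have x: "\<bar>x\<bar> \<le> e" using p[OF t] by (simp add: x_def)
    have "ln (poly p t) + ln t = ln (1 + x)"
      using pos[OF t0(2) t(2)] t0 by (simp add: x_def ln_mult)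
    moreover have "\<bar>ln (1 + x)\<bar> \<le> 2 * e"
    proof -
      have "x \<le> e" "- e \<le> x" using x by auto
      have "ln (1 + x) \<le> x" using \<open>- e \<le> x\<close> e by (intro ln_add_one_self_le_self2) auto
      moreover have "- (2 * e) \<le> ln (1 + x)"
      proof -
        have "ln (inverse (1 + x)) \<le> inverse (1 + x) - 1"
          using \<open>- e \<le> x\<close> e by (intro ln_le_minus_one) auto
        also have "inverse (1 + x) - 1 = - x / (1 + x)"
          using \<open>- e \<le> x\<close> e by (simp add: field_simps)
        also have "\<dots> \<le> 2 * e"
        proof -
          have "- x \<le> 2 * e * (1 / 2)" using \<open>- e \<le> x\<close> by simp
          also have "\<dots> \<le> 2 * e * (1 + x)" using \<open>- e \<le> x\<close> e by (intro mult_left_mono) auto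
          finally have "- x \<le> 2 * e * (1 + x)" .
          moreover have "0 < 1 + x" using \<open>- e \<le> x\<close> e by simp
          ultimately show ?thesis by (simp only: pos_divide_le_eq)
        qed
        finally show ?thesis using \<open>- e \<le> x\<close> e by (simp add: ln_inverse)
      qed
      ultimately show ?thesis using \<open>x \<le> e\<close> e by (intro abs_leI) auto
    qed
    ultimately show "\<bar>poly q t + ln t\<bar> \<le> 4 * e" using q[OF t0(2) t(2)] by linarith
  qed
qed

theorem theorem1p1:
  fixes f :: "('g::{group_add, countable} \<Rightarrow>\<^sub>0 int)^'n^'n"
  assumes "sofic TYPE('g)"
    and "integral_op f \<in> GL_vN"
    and "\<not> invertible f"
  shows "fk_det (integral_op f) > 1"
proof (rule ccontr)
  assume "\<not> fk_det (integral_op f) > 1"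
  moreover have "fk_det (integral_op f) > 0" by (simp add: fk_det_def)
  ultimately have L: "ln (fk_det (integral_op f)) \<le> 0" by simp
  obtain d and \<sigma> :: "nat \<Rightarrow> 'g \<Rightarrow> nat \<Rightarrow> nat" where sof: "sofic_approximation d \<sigma>"
    using assms(1) by (auto simp: sofic_def)
  obtain S0 where "S0 o\<^sub>L integral_op f = id_blinfun" using assms(2) by (auto simp: GL_vN_def)
  then obtain c C0 where c0: "0 < c" "\<And>C. C0 \<le> C \<Longrightarrow> c \<le> C \<and> self_adjoint_between c C (laplacian_op f)"
    using laplacian_op_between by blast
  \<comment> \<open>One interval \<open>[0, C]\<close> must contain the spectra of
    \<open>f* f\<close> and of every model.\<close>
  define C where "C = max C0 ((coeff_norm f)\<^sup>2)"
  have T: "self_adjoint_between c C (laplacian_op f)" and c: "0 < c" "c \<le> C" and Cf: "(coeff_norm f)\<^sup>2 \<le> C"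
    using c0 by (auto simp: C_def)
  obtain \<kappa> :: real and l k :: 'n and \<gamma> :: 'g and F :: "'g set" and h :: "bool \<Rightarrow> 'n \<times> 'g \<Rightarrow> real"
    where \<kappa>: "0 < \<kappa>" "\<kappa> \<le> 1" and F: "finite F" "\<gamma> \<in> F" and hF: "\<And>b k g. g \<notin> F \<Longrightarrow> h b (k, g) = 0"
    and hint: "\<And>b. h b (k, \<gamma>) \<in> \<int>" and hne: "h True (k, \<gamma>) \<noteq> h False (k, \<gamma>)"
    and hz: "\<And>b p e B. (\<And>t. c \<le> t \<Longrightarrow> t \<le> C \<Longrightarrow> \<bar>poly p t * t - 1\<bar> \<le> e) \<Longrightarrow> 0 \<le> e \<Longrightarrow> finite B \<Longrightarrow>
      (\<Sum>i\<in>B. (poly_app p (laplacian f) (\<lambda>i. unit_at (l, 0) i - laplacian f (h b) i) i)\<^sup>2) \<le>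
      (1 + e)\<^sup>2 * (1 - \<kappa>)"
  proof (rule integer_at_point_approximate_solution[OF assms(2,3) T c], goal_cases)
    case 1
    show ?case by (rule that[OF 1(2-)])
  qed
  define n where "n = real CARD('n)"
  have n: "n \<ge> 1" by (simp add: n_def Suc_le_eq)
  \<comment> \<open>\<open>\<eta>\<close> is the number of separated points guaranteed per good
    point, and \<open>\<kappa>\<close> the loss of squared norm at each; \<open>\<theta>\<close> is
    the resulting gain per point.\<close>
  define \<eta> where "\<eta> = 1 / (real (card F))\<^sup>2"
  have cardF: "card F > 0" using F by (auto simp: card_gt_0_iff)
  have \<eta>: "\<eta> > 0" using cardF by (simp add: \<eta>_def)
  define \<theta> where "\<theta> = \<kappa> * \<eta>"
  have \<theta>: "\<theta> > 0" using \<kappa> \<eta> by (simp add: \<theta>_def)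

  \<comment> \<open>The column norms contribute an error of \<open>3 * e\<close> per coordinate and twice the logarithms
    another \<open>8 * e\<close>, together at most a quarter of the gain \<open>\<theta>\<close>.\<close>
  define e where "e = min (1 / 2) (\<theta> / (44 * n))"
  have e: "0 < e" "e \<le> 1 / 2" "11 * n * e \<le> \<theta> / 4"
  proof -
    have "e \<le> \<theta> / (44 * n)" by (simp add: e_def)
    then show "11 * n * e \<le> \<theta> / 4" using n by (simp add: field_simps)
  qed (use \<theta> n in \<open>auto simp: e_def\<close>)
  obtain p where p: "\<And>t. 0 \<le> t \<Longrightarrow> t \<le> C \<Longrightarrow> 0 < poly p t"
    "\<And>t. c \<le> t \<Longrightarrow> t \<le> C \<Longrightarrow> \<bar>poly p t * t - 1\<bar> \<le> e"
    by (rule reciprocal_polynomial[OF c e(1)]) (rule that)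
  obtain q where q: "\<And>t. 0 \<le> t \<Longrightarrow> t \<le> C \<Longrightarrow> exp (poly q t) \<le> poly p t"
    "\<And>t. c \<le> t \<Longrightarrow> t \<le> C \<Longrightarrow> \<bar>poly q t + ln t\<bar> \<le> 4 * e"
    using log_minorant_polynomial[OF c e(1,2) p] by blast
  define \<tau> where "\<tau> r = (\<Sum>k\<in>UNIV. poly_app r (laplacian f) (unit_at (k :: 'n, 0)) (k, 0))" for r
  \<comment> \<open>The contradiction hypothesis enters here: \<open>- q\<close> is within
    \<open>4 * e\<close> of \<open>ln\<close> on \<open>[c, C]\<close>, so
    \<open>\<tau> (- q)\<close> is within \<open>4 * n * e\<close> of twice a logarithm that is at
    most 0.\<close>
  have \<tau>q: "- (4 * n * e) \<le> \<tau> q"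
  proof -
    have "Re (matrix_trace (poly_op (- q) (laplacian_op f))) = - Re (matrix_trace (poly_op q (laplacian_op f)))"
    proof -
      have "- q = Polynomial.smult (-1) q" by simp
      then show ?thesis
        by (simp only: poly_op_smult Re_matrix_trace blinfun.scaleR_left) (simp add: sum_negf)
    qed
    then have "\<tau> (- q) = - \<tau> q" unfolding \<tau>_def Re_matrix_trace_poly_op by simp
    moreover have "\<bar>\<tau> (- q) - 2 * ln (fk_det (integral_op f))\<bar> \<le> n * (4 * e)"
      unfolding \<tau>_def n_def
    proof (rule trace_log_fk_det[OF T c])
      show "\<bar>poly (- q) t - ln t\<bar> \<le> 4 * e" if "c \<le> t" "t \<le> C" for t
        using q(2)[OF that] by (simp add: abs_le_iff)
    qed (use e in simp)
    ultimately show ?thesis using L by (simp add: abs_le_iff)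
  qed

  define H where "H = 1 + (\<Sum>i\<in>UNIV \<times> F. (h True i)\<^sup>2) + (\<Sum>i\<in>UNIV \<times> F. (h False i)\<^sup>2)"
  have H1: "H \<ge> 1" unfolding H_def by (simp add: sum_nonneg)
  have H: "(\<Sum>i\<in>UNIV \<times> F. (h b i)\<^sup>2) \<le> H\<^sup>2" for b
  proof -
    have "(\<Sum>i\<in>UNIV \<times> F. (h b i)\<^sup>2) \<le> H"
      unfolding H_def by (cases b) (simp_all add: sum_nonneg add_nonneg_nonneg)
    also have "\<dots> \<le> H\<^sup>2" using H1 by (simp add: power2_eq_square)
    finally show ?thesis .
  qed
  define W where "W = (poly_bound ((coeff_norm f)\<^sup>2) p * (1 + ((coeff_norm f)\<^sup>2 + 1) * (1 + H)))\<^sup>2"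
  have W: "W \<ge> 0" by (simp add: W_def)

  \<comment> \<open>Per point of the model \<open>J\<close> has about \<open>n * e'^2\<close>
    elements, each charged \<open>2 * W\<close>; this is to stay below \<open>\<theta> / 8\<close>.
    Since \<open>e' \<le> 1\<close>, it suffices to bound \<open>e'\<close> instead of its
    square.\<close>
  define e' where "e' = min 1 (\<theta> / (16 * W * n + 1))"
  have Wn: "0 \<le> W * n" using W n by simp
  have e': "0 < e'" "2 * W * n * e'\<^sup>2 \<le> \<theta> / 8"
  proof -
    show "0 < e'" using \<theta> Wn by (simp add: e'_def add_nonneg_pos)
    have "e' \<le> 1" by (simp add: e'_def)
    then have "e'\<^sup>2 \<le> e'" using \<open>0 < e'\<close> by (simp add: power2_eq_square mult_left_le)
    then have "2 * W * n * e'\<^sup>2 \<le> 2 * W * n * e'" using Wn by (intro mult_left_mono) auto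
    moreover have "e' \<le> \<theta> / (16 * W * n + 1)" by (simp add: e'_def)
    then have "e' * (16 * W * n + 1) \<le> \<theta>" using Wn by (simp add: pos_le_divide_eq add_nonneg_pos)
    ultimately show "2 * W * n * e'\<^sup>2 \<le> \<theta> / 8" using \<open>0 < e'\<close> by (simp add: algebra_simps)
  qed
  obtain r where r: "\<And>t. c \<le> t \<Longrightarrow> t \<le> C \<Longrightarrow> \<bar>poly r t * t - 1\<bar> \<le> e'"
    by (rule reciprocal_polynomial[OF c e'(1)]) (rule that)
  \<comment> \<open>Nonnegative, equal to 1 at 0 and at most \<open>e'^2\<close> on
    \<open>[c, C]\<close>: a majorant of the indicator of 0 with small trace on the group.\<close>
  define r' where "r' = (1 - pCons 0 r)\<^sup>2"
  have pr': "poly r' t = (poly r t * t - 1)\<^sup>2" for t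
    by (simp add: r'_def power2_eq_square algebra_simps)
  have \<tau>r: "\<tau> r' \<le> n * e'\<^sup>2"
  proof -
    have "\<bar>poly r' t\<bar> \<le> e'\<^sup>2" if "c \<le> t" "t \<le> C" for t
      unfolding pr' using r[OF that] e'(1) by (simp add: power2_le_iff_abs_le)
    then have "poly_app r' (laplacian f) (unit_at (k, 0)) (k, 0) \<le> e'\<^sup>2" for k :: 'n
      using poly_app_coord_le[OF T, of "e'\<^sup>2" r' k] by (simp add: abs_le_iff)
    then have "\<tau> r' \<le> (\<Sum>k\<in>(UNIV :: 'n set). e'\<^sup>2)" unfolding \<tau>_def by (rule sum_mono)
    then show ?thesis by (simp add: n_def)
  qed

  define m where "m = max (degree p) (max (degree q) (degree r'))"
  \<comment> \<open>\<open>p\<close> is applied to vectors that have already undergone one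
    Laplacian, hence the two expansions.\<close>
  define Y where "Y = expand f (expand f (insert 0 F))"
  have Y: "finite Y" "0 \<in> Y" using F by (auto simp: Y_def expand_def intro!: finite_expand)
  define D where "D = nbhd f (2 * m) Y"
  have D: "finite D" using Y by (simp add: D_def finite_nbhd)
  define pq where "pq = poly_bound ((coeff_norm f)\<^sup>2) q"
  define pr where "pr = poly_bound ((coeff_norm f)\<^sup>2) r'"
  have pqr: "pq \<ge> 0" "pr \<ge> 0" by (simp_all add: pq_def pr_def poly_bound_nonneg)
  \<comment> \<open>The total coefficient of \<open>x\<close>, the number of bad points, in the
    final inequality; its summand \<open>\<theta>\<close> is the gain forgone at these
    points.\<close>
  define Z where "Z = \<theta> + 2 * W * n * pr + W * n + 2 * \<bar>\<tau> q\<bar> + 2 * n * pq"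
  have Z: "Z \<ge> 0" using \<theta> W n pqr by (simp add: Z_def)
  define \<beta> where "\<beta> = \<theta> / (8 * (Z + 1))"
  have \<beta>: "0 < \<beta>" "\<beta> * Z \<le> \<theta> / 8" using \<theta> Z by (auto simp: \<beta>_def field_simps)
  obtain i where pm: "permutation_model (d i) (\<sigma> i)" and d1: "1 \<le> d i"
    and bad: "real (d i - card {s \<in> {1..d i}. permutation_model.good f (d i) (\<sigma> i) D s}) \<le> \<beta> * real (d i)"
    using sofic_good_points[OF sof D \<beta>(1)] by blast
  interpret permutation_model f "d i" "\<sigma> i" by (rule pm)
  define G where "G = {s \<in> {1..d i}. good D s}"
  define N where "N = real (d i)"
  define x where "x = real (d i - card G)"
  have N: "N \<ge> 1" using d1 by (simp add: N_def)
  have x: "0 \<le> x" "x \<le> \<beta> * N" using bad by (simp_all add: x_def N_def G_def)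
  have Gsub: "G \<subseteq> {1..d i}" unfolding G_def by blast
  have "card G \<le> d i" using card_mono[OF finite_atLeastAtMost Gsub] by simp
  then have cG: "real (card G) = N - x" by (simp add: N_def x_def of_nat_diff)
  obtain S where S: "S \<subseteq> G"
    "\<And>s s'. s \<in> S \<Longrightarrow> s' \<in> S \<Longrightarrow> s \<noteq> s' \<Longrightarrow> (\<lambda>g. \<sigma> i g s) ` F \<inter> (\<lambda>g. \<sigma> i g s') ` F = {}"
    "card G \<le> card S * (card F)\<^sup>2"
    using exists_separated_subset[OF Gsub F(1)] F(2) by blast
  have cS: "(N - x) * \<eta> \<le> real (card S)"
  proof -
    have "real (card G) \<le> real (card S * (card F)\<^sup>2)" using S(3) by (rule of_nat_mono)
    then show ?thesis using cardF unfolding cG by (simp add: \<eta>_def field_simps)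
  qed
  have hF': "supported F (h b)" for b using hF by (simp add: supported_def)
  obtain j :: nat where j: "\<And>r. (\<And>x. 0 \<le> x \<Longrightarrow> x \<le> C \<Longrightarrow> 0 \<le> poly r x) \<Longrightarrow> 1 \<le> poly r 0 \<Longrightarrow>
      real j \<le> (\<Sum>i\<in>I. poly_app r model_lap (unit_at i) i)"
    and main: "2 * (\<Sum>i\<in>I. poly_app q model_lap (unit_at i) i) \<le>
      (real (card I) - real (card S)) * (1 + e)\<^sup>2 + real (card S) * ((1 + e)\<^sup>2 * (1 - \<kappa>)) +
      W * (2 * real j + real CARD('n) * real (d i - card G)) - real (card I)"
  proof (rule model_inequality[of C q p F \<gamma> h k m G "(1 + e)\<^sup>2" l "(1 + e)\<^sup>2 * (1 - \<kappa>)" S H W,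
        OF Cf q(1) F hF' hint hne])
    show "degree p \<le> m" by (simp add: m_def)
    show "G = {s \<in> {1..d i}. good (nbhd f (2 * m) (expand f (expand f (insert 0 F)))) s}"
      by (simp add: G_def D_def Y_def)
    show "(\<Sum>i\<in>B. (poly_app p (laplacian f) (laplacian f (unit_at (l, 0))) i)\<^sup>2) \<le> (1 + e)\<^sup>2"
      if "finite B" for l B
      by (rule poly_app_column_le[OF T _ p(2) that]) (use e in auto)
    show "(\<Sum>i\<in>B. (poly_app p (laplacian f) (\<lambda>i. unit_at (l, 0) i - laplacian f (h b) i) i)\<^sup>2) \<le>
      (1 + e)\<^sup>2 * (1 - \<kappa>)" if "finite B" for b B
      by (rule hz[OF p(2) _ that]) (use e in auto)
    show "W = (poly_bound ((coeff_norm f)\<^sup>2) p * (1 + ((coeff_norm f)\<^sup>2 + 1) * (1 + H)))\<^sup>2" by (rule W_def)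
  qed (use S H H1 that in auto)
  have trace: "\<bar>(\<Sum>i\<in>I. poly_app u model_lap (unit_at i) i) - (N - x) * \<tau> u\<bar> \<le>
      n * x * poly_bound ((coeff_norm f)\<^sup>2) u" if "degree u \<le> m" for u
    using model_trace_close[OF that Y, of G] unfolding cG \<tau>_def[symmetric] x_def[symmetric] n_def[symmetric]
    by (simp add: G_def D_def)
  have trq: "N * \<tau> q - x * \<bar>\<tau> q\<bar> - n * x * pq \<le> (\<Sum>i\<in>I. poly_app q model_lap (unit_at i) i)"
  proof -
    have "x * \<tau> q \<le> x * \<bar>\<tau> q\<bar>" using x(1) by (intro mult_left_mono) auto
    moreover have "\<bar>(\<Sum>i\<in>I. poly_app q model_lap (unit_at i) i) - (N - x) * \<tau> q\<bar> \<le> n * x * pq"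
      unfolding pq_def by (rule trace) (simp add: m_def)
    ultimately show ?thesis by (simp add: abs_le_iff algebra_simps)
  qed
  have jle: "real j \<le> N * (n * e'\<^sup>2) + n * x * pr"
  proof -
    have "real j \<le> (\<Sum>i\<in>I. poly_app r' model_lap (unit_at i) i)"
      by (rule j) (simp_all add: pr')
    also have "\<dots> \<le> (N - x) * \<tau> r' + n * x * pr"
    proof -
      have "degree r' \<le> m" by (simp add: m_def)
      from trace[OF this] show ?thesis unfolding pr_def abs_le_iff by linarith
    qed
    also have "(N - x) * \<tau> r' \<le> (N - x) * (n * e'\<^sup>2)"
      using \<tau>r by (intro mult_left_mono) (auto simp flip: cG)
    also have "\<dots> \<le> N * (n * e'\<^sup>2)" using x n by (intro mult_right_mono) auto
    finally show ?thesis by simp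
  qed
  have cI: "real (card I) = n * N" by (simp add: card_I n_def N_def)
  have sq: "1 \<le> (1 + e)\<^sup>2" "(1 + e)\<^sup>2 - 1 \<le> 3 * e"
  proof -
    have "e * e \<le> e * 1" using e by (intro mult_left_mono) auto
    then show "(1 + e)\<^sup>2 - 1 \<le> 3 * e" by (simp add: power2_eq_square algebra_simps)
    show "1 \<le> (1 + e)\<^sup>2" using e by simp
  qed
  have "2 * (\<Sum>i\<in>I. poly_app q model_lap (unit_at i) i) \<le>
      n * N * ((1 + e)\<^sup>2 - 1) - (real (card S) * \<kappa>) * (1 + e)\<^sup>2 + W * (2 * real j + n * x)"
    using main unfolding cI n_def[symmetric] x_def[symmetric] by (simp add: algebra_simps)
  moreover have "n * N * ((1 + e)\<^sup>2 - 1) \<le> n * N * (3 * e)"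
    using sq n N by (intro mult_left_mono) auto
  moreover have "(real (card S) * \<kappa>) * 1 \<le> (real (card S) * \<kappa>) * (1 + e)\<^sup>2"
    using sq \<kappa> by (intro mult_left_mono) auto
  moreover have "(N - x) * \<eta> * \<kappa> \<le> real (card S) * \<kappa>"
    using cS \<kappa> by (intro mult_right_mono) auto
  moreover have "W * (2 * real j + n * x) \<le> W * (2 * (N * (n * e'\<^sup>2) + n * x * pr) + n * x)"
    using jle W by (intro mult_left_mono) auto
  moreover have "N * (- (4 * n * e)) \<le> N * \<tau> q" using \<tau>q N by (intro mult_left_mono) auto
  \<comment> \<open>The three errors are at most \<open>\<theta> / 4\<close>,
    \<open>\<theta> / 8\<close> and \<open>\<theta> / 8\<close> per point, together only half of the
    gain.\<close>
  ultimately have "N * \<theta> \<le> N * (11 * n * e) + N * (2 * W * n * e'\<^sup>2) + x * Z"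
    using trq unfolding Z_def \<theta>_def by (simp add: algebra_simps)
  moreover have "N * (11 * n * e) \<le> N * (\<theta> / 4)" "N * (2 * W * n * e'\<^sup>2) \<le> N * (\<theta> / 8)"
    using e(3) e'(2) N by (auto intro!: mult_left_mono)
  moreover have "x * Z \<le> N * (\<theta> / 8)"
  proof -
    have "x * Z \<le> (\<beta> * N) * Z" by (rule mult_right_mono[OF x(2) Z])
    also have "\<dots> = N * (\<beta> * Z)" by simp
    also have "\<dots> \<le> N * (\<theta> / 8)" using \<beta>(2) N by (intro mult_left_mono) auto
    finally show ?thesis .
  qed
  ultimately have "N * \<theta> \<le> N * (\<theta> / 2)" by (simp add: algebra_simps)
  then show False using N \<theta> by (simp add: mult_le_cancel_left)
qed

end
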